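(* Let $0<H<\frac1d$, and let $\omega:[a,b]\to\mathbb{R}^d$ be a Gaussian process with continuous paths. Suppose moreover that $\omega$ is locally non-deterministic with parameter $H$, that is, for every integer $n\ge2$ there exist constants $c_n>0$ and $\delta_n>0$ such that for every sequence of times $a\le s_1<s_2<\dots<s_n\le b$ with $|s_n-s_1|\le\delta_n$ and every $(x_1,\dots,x_{n-1})\in(\mathbb{R}^d)^{n-1}$, $$\mathrm{Var}\Big(\sum_{k=1}^{n-1}x_k\cdot(\omega_{s_{k+1}}-\omega_{s_k})\Big)\ge2c_n\sum_{k=1}^{n-1}|x_k|^2|s_{k+1}-s_k|^{2H}.$$ Let $\alpha\ge0$, $1\le p\le q\le\infty$ be such that $$\frac1p+\Big(\alpha-\frac dq\Big)H<1-dH,\qquad \alpha<\Big(\frac1H-d\Big)\min\Big(\frac12,\frac1{q'}\Big),$$ where $\frac1{q'}=1-\frac1q$. Then, almost surely, $$\mu^\omega_{a,\cdot}\in C^{p\text{-var}}([a,b];B^\alpha_{q,\infty}).$$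
   Context: The occupation measure of $\omega$ is $\mu^\omega_{s,t}=\int_s^t\delta_{\omega_\tau}\,d\tau$, i.e. $\mu^\omega_{s,t}(A)=\mathrm{Leb}\{\tau\in[s,t]:\omega_\tau\in A\}$, and $\mu^\omega_{a,\cdot}$ denotes $t\mapsto\mu^\omega_{a,t}$. For a normed space $E$, $C^{p\text{-var}}([a,b];E)$ is the space of continuous $f:[a,b]\to E$ of finite $p$-variation, i.e. $\sup\sum_{h=1}^n\|f(t_h)-f(t_{h-1})\|_E^p<\infty$, the supremum being over all finite partitions $a=t_0<\dots<t_n=b$. $B^s_{p,q}=B^s_{p,q}(\mathbb{R}^d)$ are the standard Besov spaces. *)

theory Defs
  imports "HOL-Probability.Probability"
begin

section \<open>Schwartz functions and tempered distributions\<close>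

primrec iter_deriv ::
  "'a::real_normed_vector list \<Rightarrow> ('a \<Rightarrow> 'b::real_normed_vector) \<Rightarrow> 'a \<Rightarrow> 'b" where
  "iter_deriv [] f = f"
| "iter_deriv (v # vs) f = (\<lambda>x. frechet_derivative (iter_deriv vs f) (at x) v)"

definition smooth :: "('a::euclidean_space \<Rightarrow> 'b::real_normed_vector) \<Rightarrow> bool" where
  "smooth f \<longleftrightarrow> (\<forall>vs. set vs \<subseteq> Basis \<longrightarrow> (\<forall>x. iter_deriv vs f differentiable at x))"

definition schwartz :: "('a::euclidean_space \<Rightarrow> complex) set" where
  "schwartz = {f. smooth f \<and>
     (\<forall>vs N. set vs \<subseteq> Basis \<longrightarrow> bounded (range (\<lambda>x. (1 + norm x) ^ N *\<^sub>R iter_deriv vs f x)))}"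

definition schwartz_seminorm :: "nat \<Rightarrow> ('a::euclidean_space \<Rightarrow> complex) \<Rightarrow> real" where
  "schwartz_seminorm N f =
     (SUP (vs, x) \<in> {vs. set vs \<subseteq> Basis \<and> length vs \<le> N} \<times> UNIV.
        (1 + norm x) ^ N * norm (iter_deriv vs f x))"

text \<open>A tempered distribution is a functional on all functions of which only the values on
  \<^term>\<open>schwartz\<close> matter.\<close>

definition tempered_distribution :: "(('a::euclidean_space \<Rightarrow> complex) \<Rightarrow> complex) \<Rightarrow> bool" where
  "tempered_distribution T \<longleftrightarrow>
     (\<forall>f\<in>schwartz. \<forall>g\<in>schwartz. T (\<lambda>x. f x + g x) = T f + T g) \<and>
     (\<forall>c. \<forall>f\<in>schwartz. T (\<lambda>x. c * f x) = c * T f) \<and>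
     (\<exists>C N. \<forall>f\<in>schwartz. norm (T f) \<le> C * schwartz_seminorm N f)"

definition measure_distribution :: "'a::euclidean_space measure \<Rightarrow> ('a \<Rightarrow> complex) \<Rightarrow> complex" where
  "measure_distribution \<mu> f = (\<integral>x. f x \<partial>\<mu>)"


section \<open>Besov spaces\<close>

definition inv_fourier :: "('a::euclidean_space \<Rightarrow> complex) \<Rightarrow> 'a \<Rightarrow> complex" where
  "inv_fourier g x =
     of_real (1 / (2 * pi) ^ DIM('a)) * (\<integral>\<xi>. exp (\<i> * of_real (\<xi> \<bullet> x)) * g \<xi> \<partial>lborel)"

text \<open>The Besov spaces below carry the dyadic partition of unity as a parameter; different partitions
  give the same space with equivalent norms.\<close>

definition dyadic_partition :: "('a::euclidean_space \<Rightarrow> real) \<Rightarrow> ('a \<Rightarrow> real) \<Rightarrow> bool" where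
  "dyadic_partition \<psi> \<phi> \<longleftrightarrow>
     smooth \<psi> \<and> smooth \<phi> \<and>
     range \<psi> \<subseteq> {0..1} \<and> range \<phi> \<subseteq> {0..1} \<and>
     (\<forall>\<xi> \<eta>. norm \<xi> = norm \<eta> \<longrightarrow> \<psi> \<xi> = \<psi> \<eta> \<and> \<phi> \<xi> = \<phi> \<eta>) \<and>
     (\<forall>\<xi>. \<psi> \<xi> \<noteq> 0 \<longrightarrow> norm \<xi> \<le> 4/3) \<and>
     (\<forall>\<xi>. \<phi> \<xi> \<noteq> 0 \<longrightarrow> 3/4 \<le> norm \<xi> \<and> norm \<xi> \<le> 8/3) \<and>
     (\<forall>\<xi>. (\<lambda>j. \<phi> (\<xi> /\<^sub>R 2 ^ j)) sums (1 - \<psi> \<xi>))"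

text \<open>The dyadic blocks \<open>\<Delta>\<^sub>-\<^sub>1, \<Delta>\<^sub>0, \<Delta>\<^sub>1, \<dots>\<close> are numbered from \<open>0\<close>, so that index \<open>k\<close>
  stands for the frequency scale \<open>2 ^ (k - 1)\<close>.\<close>

definition lp_symbol :: "('a::euclidean_space \<Rightarrow> real) \<Rightarrow> ('a \<Rightarrow> real) \<Rightarrow> nat \<Rightarrow> 'a \<Rightarrow> real" where
  "lp_symbol \<psi> \<phi> k \<xi> = (case k of 0 \<Rightarrow> \<psi> \<xi> | Suc j \<Rightarrow> \<phi> (\<xi> /\<^sub>R 2 ^ j))"

text \<open>The block is the convolution of \<open>T\<close> with the inverse Fourier transform of the symbol.\<close>

definition lp_block ::
  "('a::euclidean_space \<Rightarrow> real) \<Rightarrow> ('a \<Rightarrow> real) \<Rightarrow> nat \<Rightarrow>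
   (('a \<Rightarrow> complex) \<Rightarrow> complex) \<Rightarrow> 'a \<Rightarrow> complex" where
  "lp_block \<psi> \<phi> k T x = T (\<lambda>y. inv_fourier (\<lambda>\<xi>. of_real (lp_symbol \<psi> \<phi> k \<xi>)) (x - y))"

definition ennreal_powr :: "ennreal \<Rightarrow> real \<Rightarrow> ennreal" where
  "ennreal_powr x r = (if x = \<infinity> then \<infinity> else ennreal (enn2real x powr r))"

definition Lp_norm :: "'a measure \<Rightarrow> ennreal \<Rightarrow> ('a \<Rightarrow> ennreal) \<Rightarrow> ennreal" where
  "Lp_norm M p f =
     (if p = \<infinity> then esssup M f
      else ennreal_powr (\<integral>\<^sup>+x. ennreal_powr (f x) (enn2real p) \<partial>M) (enn2real (1 / p)))"

definition besov_norm ::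
  "('a::euclidean_space \<Rightarrow> real) \<Rightarrow> ('a \<Rightarrow> real) \<Rightarrow> real \<Rightarrow> ennreal \<Rightarrow> ennreal \<Rightarrow>
   (('a \<Rightarrow> complex) \<Rightarrow> complex) \<Rightarrow> ennreal" where
  "besov_norm \<psi> \<phi> s p q T =
     Lp_norm (count_space (UNIV :: nat set)) q
       (\<lambda>k. ennreal (2 powr (s * (real k - 1))) *
            Lp_norm lborel p (\<lambda>x. ennreal (norm (lp_block \<psi> \<phi> k T x))))"

definition besov_space ::
  "('a::euclidean_space \<Rightarrow> real) \<Rightarrow> ('a \<Rightarrow> real) \<Rightarrow> real \<Rightarrow> ennreal \<Rightarrow> ennreal \<Rightarrow>
   (('a \<Rightarrow> complex) \<Rightarrow> complex) set" where
  "besov_space \<psi> \<phi> s p q = {T. tempered_distribution T \<and> besov_norm \<psi> \<phi> s p q T < \<infinity>}"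


section \<open>Continuous functions of finite \<open>p\<close>-variation\<close>

definition partitions :: "real \<Rightarrow> real \<Rightarrow> (nat \<times> (nat \<Rightarrow> real)) set" where
  "partitions a b = {(n, t). t 0 = a \<and> t n = b \<and> strict_mono_on {0..n} t}"

text \<open>For \<open>p = \<infinity>\<close> the sum of \<open>p\<close>-th powers is read, as usual, as the largest increment.\<close>

definition p_variation ::
  "('e::minus \<Rightarrow> ennreal) \<Rightarrow> ennreal \<Rightarrow> real \<Rightarrow> real \<Rightarrow> (real \<Rightarrow> 'e) \<Rightarrow> ennreal" where
  "p_variation N p a b f =
     (SUP (n, t) \<in> partitions a b.
        if p = \<infinity> then SUP h\<in>{1..n}. N (f (t h) - f (t (h - 1)))
        else \<Sum>h=1..n. ennreal_powr (N (f (t h) - f (t (h - 1)))) (enn2real p))"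

text \<open>\<open>E\<close> is the normed space and \<open>N\<close> its norm.\<close>

definition C_pvar ::
  "'e::minus set \<Rightarrow> ('e \<Rightarrow> ennreal) \<Rightarrow> ennreal \<Rightarrow> real \<Rightarrow> real \<Rightarrow> (real \<Rightarrow> 'e) set" where
  "C_pvar E N p a b =
     {f. (\<forall>t\<in>{a..b}. f t \<in> E) \<and>
         (\<forall>t\<in>{a..b}. ((\<lambda>s. N (f s - f t)) \<longlongrightarrow> 0) (at t within {a..b})) \<and>
         p_variation N p a b f < \<infinity>}"


section \<open>Gaussian processes and occupation measures\<close>

text \<open>Degenerate (almost surely constant) variables count as Gaussian.\<close>

definition gaussian_rv :: "'w measure \<Rightarrow> ('w \<Rightarrow> real) \<Rightarrow> bool" where
  "gaussian_rv M X \<longleftrightarrow> X \<in> borel_measurable M \<and>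
     ((\<exists>m. AE w in M. X w = m) \<or>
      (\<exists>m \<sigma>. \<sigma> > 0 \<and> distributed M lborel X (\<lambda>x. ennreal (normal_density m \<sigma> x))))"

definition gaussian_process ::
  "'w measure \<Rightarrow> real set \<Rightarrow> (real \<Rightarrow> 'w \<Rightarrow> 'a::euclidean_space) \<Rightarrow> bool" where
  "gaussian_process M I \<omega> \<longleftrightarrow>
     (\<forall>J x. finite J \<and> J \<subseteq> I \<longrightarrow> gaussian_rv M (\<lambda>w. \<Sum>t\<in>J. x t \<bullet> \<omega> t w))"

definition locally_nondeterministic ::
  "'w measure \<Rightarrow> real \<Rightarrow> real \<Rightarrow> real \<Rightarrow> (real \<Rightarrow> 'w \<Rightarrow> 'a::euclidean_space) \<Rightarrow> bool" where
  "locally_nondeterministic M a b H \<omega> \<longleftrightarrow>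
     (\<forall>n\<ge>2. \<exists>c>0. \<exists>\<delta>>0. \<forall>(s::nat \<Rightarrow> real) (x::nat \<Rightarrow> 'a).
        strict_mono_on {1..n} s \<and> a \<le> s 1 \<and> s n \<le> b \<and> \<bar>s n - s 1\<bar> \<le> \<delta> \<longrightarrow>
          prob_space.variance M (\<lambda>w. \<Sum>k=1..n-1. x k \<bullet> (\<omega> (s (k + 1)) w - \<omega> (s k) w))
            \<ge> 2 * c * (\<Sum>k=1..n-1. (norm (x k))\<^sup>2 * \<bar>s (k + 1) - s k\<bar> powr (2 * H)))"

definition occupation_measure ::
  "(real \<Rightarrow> 'a::euclidean_space) \<Rightarrow> real \<Rightarrow> real \<Rightarrow> 'a measure" where
  "occupation_measure \<omega> s t = distr (restrict_space lborel {s..t}) borel \<omega>"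

end

theory Submission
  imports Defs
begin

text \<open>The block \<open>\<Delta>\<^sub>k\<close> of the occupation measure of \<open>[s,t]\<close> is the function
  \<open>x \<mapsto> \<integral>K\<^sub>k (x - \<omega>\<^sub>\<tau>) d\<tau>\<close>, where \<open>\<tau>\<close> ranges over \<open>[s,t]\<close>. For even \<open>m\<close> its \<open>m\<close>-th power is an
  ordered \<open>m\<close>-fold time integral. If all kernels except the one at the first time are written as Fourier
  integrals, then integration over \<open>x\<close> leaves only increments of \<open>\<omega>\<close>, and local nondeterminism bounds the
  expectation by \<open>exp (- c * \<Sum>\<^sub>j |\<eta>\<^sub>j|^2 (\<tau>\<^sub>j\<^sub>+\<^sub>1 - \<tau>\<^sub>j)^(2H))\<close>, where the \<open>\<eta>\<^sub>j\<close> are tail sums of the frequencies.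
  All frequencies have size about \<open>2^k\<close>, so of two consecutive \<open>\<eta>\<^sub>j\<close> at least one is that large. This gain
  at every second time yields, for \<open>(2\<beta> + d)H < 1\<close>, the bound
  \<open>C 2^(-k\<beta>m) (t - s)^(dH + m(1 - dH - \<beta>H))\<close> for the expected \<open>m\<close>-th power of the \<open>L^m\<close> norm. Other finite
  exponents \<open>q\<close> follow by interpolation between \<open>1\<close>, \<open>2\<close> and even \<open>m\<close>; for \<open>q = \<infinity>\<close> the Lipschitz constant of a
  block is polynomial in \<open>2^k\<close>, so its supremum is controlled by its \<open>L^m\<close> norm with a loss that vanishes
  as \<open>m \<rightarrow> \<infinity>\<close>. Finally the increment over \<open>[u,v]\<close> is chained along the dyadic cells contained in \<open>[u,v]\<close>.
  The intervals of a partition share no cells, so almost sure finiteness of a weighted sum over all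
  dyadic cells bounds the \<open>p\<close>-variation, and its tail gives continuity.\<close>

section \<open>Test functions and decay of the kernels\<close>

text \<open>Even \<open>m\<close> matters because the kernels are real: |D|^m is then D^m, free of
  absolute values, and splits into time and frequency integrals. The one kernel kept in physical
  space makes the integral over the unbounded variable x converge; its \<open>L^1\<close> norm is
  uniform in k. The obstacle is that a tail sum of large frequencies can be small by cancellation,
  and then the exponential yields no power of 2^k. Hence the gain is charged to every second time
  only, twice as strongly: a good gap u costs u^(-v) with v = (2\<beta> + d)H, where d compensates
  the volume 2^(kd) of the frequencies and v < 1 is integrability at 0. This is the origin of 1/2 in
  min(1/2, 1/q'); the entry 1/q' comes from interpolating the second moment with the first, which
  has no decay in k. The condition on p counts dyadic cells: 2^n cells of expected weight
  2^(-n\<gamma>P) are summable when \<gamma>P > 1, with \<gamma> = 1 - dH - \<beta>H + dH/q for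
  finite q. Both conditions are strict; the slack pays for some \<beta> > \<alpha>, which makes the
  blocks summable in k.\<close>

lemma iter_deriv_append:
  "iter_deriv (vs @ ws) f = iter_deriv vs (iter_deriv ws f)"
  by (induction vs) auto

lemma smooth_differentiable: "smooth f \<Longrightarrow> f differentiable at x"
  unfolding smooth_def by (metis empty_subsetI iter_deriv.simps(1) list.set(1))

lemma smooth_frechet_derivative:
  assumes "smooth f" "b \<in> Basis"
  shows "smooth (\<lambda>x. frechet_derivative f (at x) b)"
  unfolding smooth_def
proof (intro allI impI)
  fix vs :: "'a list" and x assume "set vs \<subseteq> Basis"
  then have "iter_deriv (vs @ [b]) f differentiable at x"
    using assms unfolding smooth_def by auto
  then show "iter_deriv vs (\<lambda>x. frechet_derivative f (at x) b) differentiable at x"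
    by (simp add: iter_deriv_append)
qed

lemma smooth_continuous:
  assumes "smooth f" shows "continuous_on UNIV f"
  using smooth_differentiable[OF assms] 
  by (simp add: continuous_at_imp_continuous_on differentiable_imp_continuous_within)

text \<open>The complement of the closed ball is open and \<open>f\<close> vanishes on it, hence so
  does the derivative. Differentiating a symbol thus keeps the support radius, which the decay
  induction relies on.\<close>

lemma frechet_derivative_support:
  fixes f :: "'a::euclidean_space \<Rightarrow> real"
  assumes "\<And>x. f x \<noteq> 0 \<Longrightarrow> norm x \<le> r" "frechet_derivative f (at x) b \<noteq> 0"
  shows "norm x \<le> r"
proof (rule ccontr)
  assume "\<not> norm x \<le> r"
  then have x: "x \<in> - cball 0 r" by auto
  have "((\<lambda>_. 0::real) has_derivative (\<lambda>_. 0)) (at x)" by simp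
  then have "(f has_derivative (\<lambda>_. 0)) (at x)"
    by (rule has_derivative_transform_within_open[OF _ _ x]) (use assms(1) in auto)
  then have "frechet_derivative f (at x) = (\<lambda>_. 0)"
    using frechet_derivative_at by metis
  with assms(2) show False by simp
qed

lemma bounded_range_if_compact_support:
  fixes f :: "'a::euclidean_space \<Rightarrow> 'b::real_normed_vector"
  assumes "continuous_on UNIV f" "\<And>x. f x \<noteq> 0 \<Longrightarrow> norm x \<le> r"
  obtains B where "B > 0" "\<And>x. norm (f x) \<le> B"
proof -
  have "continuous_on (cball 0 r) f" using assms(1) by (rule continuous_on_subset) simp
  then have "bounded (f ` cball 0 r)"
    by (intro compact_imp_bounded compact_continuous_image) auto
  then obtain B where B: "B > 0" "\<forall>y\<in>f ` cball 0 r. norm y \<le> B"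
    unfolding bounded_pos by auto
  have "norm (f x) \<le> B" for x
  proof (cases "f x = 0")
    case False
    then have "x \<in> cball 0 r" using assms(2) by simp
    then show ?thesis using B(2) by simp
  qed (use B(1) in simp)
  with that B(1) show ?thesis by blast
qed

lemma integrable_indicator_cball:
  "integrable lborel (\<lambda>x::'a::euclidean_space. B * indicator (cball 0 r) x :: real)"
  by (intro integrable_mult_right integrable_real_indicator) (use emeasure_lborel_cball_finite[of "0::'a" r] in auto)

lemma integrable_compact_support:
  fixes f :: "'a::euclidean_space \<Rightarrow> 'b::euclidean_space"
  assumes "continuous_on UNIV f" "\<And>x. f x \<noteq> 0 \<Longrightarrow> norm x \<le> r"
  shows "integrable lborel f"
proof -
  obtain B where B: "B > 0" "\<And>x. norm (f x) \<le> B"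
    using bounded_range_if_compact_support[OF assms] by blast
  show ?thesis
  proof (rule Bochner_Integration.integrable_bound[OF integrable_indicator_cball[of B r]])
    show "f \<in> borel_measurable lborel"
      using assms(1) by (simp add: borel_measurable_continuous_onI)
    show "AE x in lborel. norm (f x) \<le> norm (B * indicator (cball 0 r) x)"
      using B assms(2) by (intro AE_I2) (auto simp: indicator_def mult_le_0_iff abs_if)
  qed
qed

text \<open>By translation invariance all difference quotients have integral \<open>0\<close>.\<close>

lemma integral_derivative_eq_0:
  fixes g :: "'a::euclidean_space \<Rightarrow> complex"
  assumes g: "\<And>x. (g has_derivative g' x) (at x)"
    and supp: "\<And>x. g x \<noteq> 0 \<Longrightarrow> norm x \<le> r"
    and bd: "\<And>x. norm (g' x v) \<le> B"
  shows "(\<integral>x. g' x v \<partial>lborel) = 0"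
proof -
  have cont: "continuous_on UNIV g"
    using g by (meson continuous_at_imp_continuous_on has_derivative_continuous)
  have int: "integrable lborel g" by (rule integrable_compact_support[OF cont supp])
  \<comment> \<open>Step sizes at most 1 keep all difference quotients supported in the ball of
    radius \<open>r + norm v\<close>, on which the dominating function lives.\<close>
  define h where "h n = inverse (real (Suc n))" for n
  have h: "0 < h n" "h n \<le> 1" for n by (auto simp: h_def divide_simps)
  have h0: "h \<longlonglongrightarrow> 0" unfolding h_def by (rule LIMSEQ_inverse_real_of_nat)
  define q where "q n x = (g (x + h n *\<^sub>R v) - g x) /\<^sub>R h n" for n x
  have B0: "B \<ge> 0" using bd[of 0] norm_ge_zero order_trans by blast
  have shift: "integrable lborel (\<lambda>x. g (x + c))" "(\<integral>x. g (x + c) \<partial>lborel) = (\<integral>x. g x \<partial>lborel)" for c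
  proof -
    have m: "g \<in> borel_measurable borel" using cont by (simp add: borel_measurable_continuous_onI)
    have m2: "(+) c \<in> borel \<rightarrow>\<^sub>M borel" by measurable
    have "integrable (distr lborel borel ((+) c)) g" using int by (simp add: lborel_distr_plus)
    then show "integrable lborel (\<lambda>x. g (x + c))"
      using integrable_distr_eq[of "(+) c" lborel borel g] m m2 by (simp add: add.commute)
    have "(\<integral>x. g x \<partial>lborel) = (\<integral>x. g x \<partial>distr lborel borel ((+) c))" by (simp add: lborel_distr_plus)
    also have "\<dots> = (\<integral>x. g (c + x) \<partial>lborel)"
      using m by (subst integral_distr) auto
    finally show "(\<integral>x. g (x + c) \<partial>lborel) = (\<integral>x. g x \<partial>lborel)" by (simp add: add.commute)
  qed
  have q0: "(\<integral>x. q n x \<partial>lborel) = 0" for n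
    unfolding q_def using shift int by simp
  \<comment> \<open>Mean value inequality along the segment from \<open>x\<close> to
    \<open>x + t *\<^sub>R v\<close>; after division by \<open>t\<close> it bounds every quotient by
    \<open>B\<close>.\<close>
  have lip: "norm (g (x + t *\<^sub>R v) - g x) \<le> t * B" if "t > 0" for x t
  proof -
    have "norm (g (x + t *\<^sub>R v) - g (x + 0 *\<^sub>R v)) \<le> B * norm (t - 0)"
    proof (rule differentiable_bound[where S="{0..t}" and f' = "\<lambda>s y. g' (x + s *\<^sub>R v) (y *\<^sub>R v)"])
      fix s assume "s \<in> {0..t}"
      have "((\<lambda>s. x + s *\<^sub>R v) has_derivative (\<lambda>y. y *\<^sub>R v)) (at s within {0..t})"
        by (auto intro!: derivative_eq_intros)
      then show "((\<lambda>s. g (x + s *\<^sub>R v)) has_derivative (\<lambda>y. g' (x + s *\<^sub>R v) (y *\<^sub>R v))) (at s within {0..t})"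
        by (rule has_derivative_compose[OF _ g])
      have lin: "linear (g' (x + s *\<^sub>R v))"
        using g has_derivative_linear by blast
      show "onorm (\<lambda>y. g' (x + s *\<^sub>R v) (y *\<^sub>R v)) \<le> B"
        using bd B0 by (intro onorm_bound) (auto simp: linear_scale[OF lin] mult.commute[of B] intro!: mult_left_mono)
    qed (use that in auto)
    then show ?thesis using that by (simp add: mult.commute)
  qed
  have lim: "(\<lambda>n. q n x) \<longlonglongrightarrow> g' x v" for x
  proof -
      have "((\<lambda>s. g (x + s *\<^sub>R v)) has_vector_derivative g' x v) (at 0)"
      proof -
        have "((\<lambda>s. x + s *\<^sub>R v) has_derivative (\<lambda>y. y *\<^sub>R v)) (at 0)"
          by (auto intro!: derivative_eq_intros)
        from has_derivative_compose[OF this, of g "g' x"] g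
        have "((\<lambda>s. g (x + s *\<^sub>R v)) has_derivative (\<lambda>y. g' x (y *\<^sub>R v))) (at 0)" by simp
        moreover have "linear (g' x)" using g has_derivative_linear by blast
        ultimately show ?thesis
          by (simp add: has_vector_derivative_def linear_scale)
      qed
      then have "((\<lambda>s. norm (g (x + s *\<^sub>R v) - g x - s *\<^sub>R g' x v) / norm s) \<longlongrightarrow> 0) (at 0)"
        by (simp add: has_vector_derivative_def has_derivative_at)
      moreover have "norm (g (x + s *\<^sub>R v) - g x - s *\<^sub>R g' x v) / norm s
          = norm ((g (x + s *\<^sub>R v) - g x) /\<^sub>R s - g' x v)" if "s \<noteq> 0" for s
      proof -
        have "(g (x + s *\<^sub>R v) - g x) /\<^sub>R s - g' x v = (g (x + s *\<^sub>R v) - g x - s *\<^sub>R g' x v) /\<^sub>R s"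
          using that by (simp add: algebra_simps)
        then show ?thesis by (simp add: divide_inverse mult.commute)
      qed
      ultimately have "((\<lambda>s. norm ((g (x + s *\<^sub>R v) - g x) /\<^sub>R s - g' x v)) \<longlongrightarrow> 0) (at 0)"
        by (elim Lim_transform_eventually) (auto simp: eventually_at_filter)
      then have "((\<lambda>s. (g (x + s *\<^sub>R v) - g x) /\<^sub>R s) \<longlongrightarrow> g' x v) (at 0)"
        by (simp add: tendsto_norm_zero_iff LIM_zero_iff)
      moreover have "filterlim h (at 0) sequentially"
        using h0 h(1) by (auto simp: filterlim_at less_imp_neq[symmetric] intro!: always_eventually)
      ultimately show "(\<lambda>n. q n x) \<longlonglongrightarrow> g' x v"
        unfolding q_def by (rule filterlim_compose)
    qed
  have "(\<lambda>n. \<integral>x. q n x \<partial>lborel) \<longlonglongrightarrow> (\<integral>x. g' x v \<partial>lborel)"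
  proof (rule integral_dominated_convergence[where w = "\<lambda>x. B * indicator (cball 0 (r + norm v)) x"])
    show qm: "q n \<in> borel_measurable lborel" for n
    proof -
      have "continuous_on UNIV (q n)" unfolding q_def
        by (intro continuous_intros continuous_on_compose2[OF cont]) auto
      then show ?thesis by (simp add: borel_measurable_continuous_onI)
    qed
    show "AE x in lborel. (\<lambda>n. q n x) \<longlonglongrightarrow> g' x v" using lim by simp
    show "(\<lambda>x. g' x v) \<in> borel_measurable lborel"
      by (rule borel_measurable_LIMSEQ_metric[OF qm lim])
    show "integrable lborel (\<lambda>x. B * indicator (cball 0 (r + norm v)) x)"
      by (rule integrable_indicator_cball)
    show "AE x in lborel. norm (q n x) \<le> B * indicator (cball 0 (r + norm v)) x" for n
    proof (rule AE_I2)
      fix x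
      show "norm (q n x) \<le> B * indicator (cball 0 (r + norm v)) x"
      proof (cases "q n x = 0")
        case True then show ?thesis using B0 by simp
      next
        case False
        then have "g x \<noteq> 0 \<or> g (x + h n *\<^sub>R v) \<noteq> 0" unfolding q_def by auto
        then have "norm x \<le> r + norm v"
        proof
          assume "g x \<noteq> 0" then show ?thesis using supp[of x] norm_ge_zero[of v] by linarith
        next
          assume "g (x + h n *\<^sub>R v) \<noteq> 0"
          then have "norm (x + h n *\<^sub>R v) \<le> r" by (rule supp)
          moreover have "norm x \<le> norm (x + h n *\<^sub>R v) + norm (h n *\<^sub>R v)"
            by (metis add_diff_cancel_right' norm_triangle_ineq4)
          moreover have "norm (h n *\<^sub>R v) \<le> norm v"
            using h[of n] by (simp add: mult_left_le_one_le)
          ultimately show ?thesis by linarith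
        qed
        moreover have "norm (q n x) \<le> B"
        proof -
          have "norm (q n x) = norm (g (x + h n *\<^sub>R v) - g x) / h n"
            unfolding q_def norm_scaleR using h(1)[of n] by (simp add: divide_inverse mult.commute)
          then show ?thesis using lip[OF h(1)[of n], of x] h(1)[of n] by (simp add: pos_divide_le_eq mult.commute)
        qed
        ultimately show ?thesis by simp
      qed
    qed
  qed
  moreover have "(\<lambda>n. \<integral>x. q n x \<partial>lborel) \<longlonglongrightarrow> 0" using q0 by simp
  ultimately show ?thesis by (rule LIMSEQ_unique)
qed

text \<open>Integration by parts: the derivative in direction \<open>b\<close> of the exponential
  times \<open>f\<close> integrates to zero, and the product rule splits it into the two
  sides.\<close>

lemma inv_fourier_derivative:
  fixes f :: "'a::euclidean_space \<Rightarrow> real"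
  assumes f: "smooth f" and supp: "\<And>x. f x \<noteq> 0 \<Longrightarrow> norm x \<le> r" and b: "b \<in> Basis"
  shows "inv_fourier (\<lambda>\<xi>. of_real (frechet_derivative f (at \<xi>) b)) x
    = - \<i> * of_real (x \<bullet> b) * inv_fourier (\<lambda>\<xi>. of_real (f \<xi>)) x"
proof -
  define f' where "f' \<xi> = frechet_derivative f (at \<xi>)" for \<xi>
  define g where "g \<xi> = exp (\<i> * of_real (\<xi> \<bullet> x)) * of_real (f \<xi>)" for \<xi> :: 'a
  have df: "(f has_derivative f' \<xi>) (at \<xi>)" for \<xi>
    using smooth_differentiable[OF f] frechet_derivative_works unfolding f'_def by blast
  have cf: "continuous_on UNIV f" by (rule smooth_continuous[OF f])
  have sf': "smooth (\<lambda>\<xi>. f' \<xi> b)" unfolding f'_def by (rule smooth_frechet_derivative[OF f b])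
  have cf': "continuous_on UNIV (\<lambda>\<xi>. f' \<xi> b)" by (rule smooth_continuous[OF sf'])
  have supp': "norm \<xi> \<le> r" if "f' \<xi> b \<noteq> 0" for \<xi>
    using frechet_derivative_support[OF supp] that unfolding f'_def by blast
  obtain B1 where B1: "\<And>\<xi>. norm (f \<xi>) \<le> B1" 
    using bounded_range_if_compact_support[OF cf supp] by blast
  obtain B2 where B2: "\<And>\<xi>. norm (f' \<xi> b) \<le> B2"
    using bounded_range_if_compact_support[OF cf' supp'] by blast
  have dg: "(g has_derivative (\<lambda>v. exp (\<i> * of_real (\<xi> \<bullet> x)) * of_real (f' \<xi> v)
      + \<i> * of_real (v \<bullet> x) * exp (\<i> * of_real (\<xi> \<bullet> x)) * of_real (f \<xi>))) (at \<xi>)" for \<xi>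
  proof -
    have 1: "((\<lambda>\<xi>. exp (\<i> * of_real (\<xi> \<bullet> x))) has_derivative 
        (\<lambda>v. (\<i> * of_real (v \<bullet> x)) * exp (\<i> * of_real (\<xi> \<bullet> x)))) (at \<xi>)"
    proof -
      have "((\<lambda>\<xi>. \<i> * of_real (\<xi> \<bullet> x)) has_derivative (\<lambda>v. \<i> * of_real (v \<bullet> x))) (at \<xi>)"
        by (auto intro!: derivative_eq_intros)
      moreover have "(exp has_derivative (\<lambda>y. y * exp (\<i> * of_real (\<xi> \<bullet> x)))) (at (\<i> * of_real (\<xi> \<bullet> x)))"
        using DERIV_exp[of "\<i> * of_real (\<xi> \<bullet> x)"] unfolding has_field_derivative_def by (simp add: mult_commute_abs)
      ultimately show ?thesis by (rule has_derivative_compose)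
    qed
    have 2: "((\<lambda>\<xi>. complex_of_real (f \<xi>)) has_derivative (\<lambda>v. of_real (f' \<xi> v))) (at \<xi>)"
      using bounded_linear.has_derivative[OF bounded_linear_of_real df] .
    show ?thesis unfolding g_def using has_derivative_mult[OF 1 2] by simp
  qed
  have "(\<integral>\<xi>. exp (\<i> * of_real (\<xi> \<bullet> x)) * of_real (f' \<xi> b)
      + \<i> * of_real (b \<bullet> x) * exp (\<i> * of_real (\<xi> \<bullet> x)) * of_real (f \<xi>) \<partial>lborel) = 0"
  proof (rule integral_derivative_eq_0[OF dg, where r = r and B = "B2 + \<bar>b \<bullet> x\<bar> * B1"])
    show "norm \<xi> \<le> r" if "g \<xi> \<noteq> 0" for \<xi> using that supp unfolding g_def by auto
    show "norm (exp (\<i> * of_real (\<xi> \<bullet> x)) * complex_of_real (f' \<xi> b)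
      + \<i> * of_real (b \<bullet> x) * exp (\<i> * of_real (\<xi> \<bullet> x)) * of_real (f \<xi>)) \<le> B2 + \<bar>b \<bullet> x\<bar> * B1" for \<xi>
      using B1[of \<xi>] B2[of \<xi>]
      by (intro order_trans[OF norm_triangle_ineq] add_mono) (auto simp: norm_mult intro!: mult_left_mono)
  qed
  moreover have i1: "integrable lborel (\<lambda>\<xi>. exp (\<i> * of_real (\<xi> \<bullet> x)) * complex_of_real (f' \<xi> b))"
    by (rule integrable_compact_support[where r=r]) (auto intro!: continuous_intros cf' supp')
  moreover have i2: "integrable lborel (\<lambda>\<xi>. exp (\<i> * of_real (\<xi> \<bullet> x)) * complex_of_real (f \<xi>))"
    by (rule integrable_compact_support[where r=r]) (auto intro!: continuous_intros cf supp)
  ultimately have "(\<integral>\<xi>. exp (\<i> * of_real (\<xi> \<bullet> x)) * of_real (f' \<xi> b) \<partial>lborel)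
      + \<i> * of_real (b \<bullet> x) * (\<integral>\<xi>. exp (\<i> * of_real (\<xi> \<bullet> x)) * of_real (f \<xi>) \<partial>lborel) = 0"
    by (simp add: mult.assoc)
  then show ?thesis
    unfolding inv_fourier_def f'_def[symmetric]
    by (simp add: inner_commute algebra_simps add_eq_0_iff2)
qed

text \<open>Each factor \<open>x \<bullet> b\<close> is traded for one derivative of the symbol, so
  the induction must let \<open>f\<close> vary. With no factor left, the \<open>L^1\<close> norm of
  the symbol is the bound.\<close>

lemma inv_fourier_decay:
  fixes f :: "'a::euclidean_space \<Rightarrow> real"
  assumes "smooth f" "\<And>x. f x \<noteq> 0 \<Longrightarrow> norm x \<le> r" "b \<in> Basis"
  shows "\<exists>C\<ge>0. \<forall>x. \<bar>x \<bullet> b\<bar> ^ N * norm (inv_fourier (\<lambda>\<xi>. of_real (f \<xi>)) x) \<le> C"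
  using assms(1,2)
proof (induction N arbitrary: f)
  case 0
  let ?f = "\<lambda>\<xi>. complex_of_real (f \<xi>)"
  have "norm (inv_fourier ?f x) \<le> 1 / (2*pi) ^ DIM('a) * (\<integral>\<xi>. norm (?f \<xi>) \<partial>lborel)" for x
  proof -
    have "norm (\<integral>\<xi>. exp (\<i> * of_real (\<xi> \<bullet> x)) * ?f \<xi> \<partial>lborel) \<le> (\<integral>\<xi>. norm (exp (\<i> * of_real (\<xi> \<bullet> x)) * ?f \<xi>) \<partial>lborel)"
      by (rule integral_norm_bound)
    moreover have "norm (complex_of_real (1 / (2 * pi) ^ DIM('a))) = 1 / (2 * pi) ^ DIM('a)"
      by (subst norm_of_real) simp
    ultimately show ?thesis unfolding inv_fourier_def norm_mult
      by (simp add: norm_mult divide_right_mono del: of_real_divide of_real_power)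
  qed
  then show ?case by (intro exI[of _ "1 / (2*pi) ^ DIM('a) * (\<integral>\<xi>. norm (?f \<xi>) \<partial>lborel)"]) auto
next
  case (Suc N)
  let ?g = "\<lambda>\<xi>. frechet_derivative f (at \<xi>) b"
  have "\<exists>C\<ge>0. \<forall>x. \<bar>x \<bullet> b\<bar> ^ N * norm (inv_fourier (\<lambda>\<xi>. of_real (?g \<xi>)) x) \<le> C"
    using frechet_derivative_support[OF Suc.prems(2)]
    by (intro Suc.IH smooth_frechet_derivative[OF Suc.prems(1) assms(3)]) blast
  then show ?case
    by (simp add: inv_fourier_derivative[OF Suc.prems(1) Suc.prems(2) assms(3)] norm_mult mult_ac)
qed

text \<open>Integration by parts yields decay in one coordinate at a time. Comparison through the
  largest coordinate turns this into a product over the coordinates, whose integral factorises; d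
  factors of second order explain the power 2d.\<close>

lemma prod_one_plus_square_le:
  fixes x :: "'a::euclidean_space"
  shows "(\<Prod>b\<in>Basis. 1 + (x \<bullet> b)\<^sup>2) \<le> 2 ^ DIM('a) * (1 + (\<Sum>b\<in>Basis. \<bar>x \<bullet> b\<bar> ^ (2 * DIM('a))))"
proof -
  define m where "m = Max ((\<lambda>b. \<bar>x \<bullet> b\<bar>) ` (Basis::'a set))"
  have mge: "\<bar>x \<bullet> b\<bar> \<le> m" if "b \<in> Basis" for b unfolding m_def using that by (intro Max_ge) auto
  have "m \<in> (\<lambda>b. \<bar>x \<bullet> b\<bar>) ` (Basis::'a set)" unfolding m_def by (intro Max_in) auto
  then obtain b0 where b0: "b0 \<in> Basis" "m = \<bar>x \<bullet> b0\<bar>" by auto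
  have m0: "m \<ge> 0" using b0 by simp
  have "(\<Prod>b\<in>Basis. 1 + (x \<bullet> b)\<^sup>2) \<le> (\<Prod>b\<in>(Basis::'a set). 1 + m\<^sup>2)"
    using mge by (intro prod_mono conjI) (auto intro!: add_nonneg_nonneg simp flip: abs_le_square_iff simp: m0)
  also have "\<dots> = (1 + m\<^sup>2) ^ DIM('a)" by simp
  also have "\<dots> \<le> (2 * max 1 (m\<^sup>2)) ^ DIM('a)" by (intro power_mono) auto
  also have "\<dots> = 2 ^ DIM('a) * (max 1 (m\<^sup>2)) ^ DIM('a)" by (simp add: power_mult_distrib)
  also have "(max 1 (m\<^sup>2)) ^ DIM('a) \<le> 1 + m ^ (2 * DIM('a))"
    by (auto simp: max_def power_mult m0)
  also have "m ^ (2 * DIM('a)) \<le> (\<Sum>b\<in>Basis. \<bar>x \<bullet> b\<bar> ^ (2 * DIM('a)))"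
    unfolding b0(2) by (rule member_le_sum[OF b0(1)]) auto
  finally show ?thesis by simp
qed

lemma inv_fourier_prod_decay:
  fixes f :: "'a::euclidean_space \<Rightarrow> real"
  assumes "smooth f" "\<And>x. f x \<noteq> 0 \<Longrightarrow> norm x \<le> r"
  shows "\<exists>C\<ge>0. \<forall>x. norm (inv_fourier (\<lambda>\<xi>. of_real (f \<xi>)) x) \<le> C * (\<Prod>b\<in>Basis. inverse (1 + (x \<bullet> b)\<^sup>2))"
proof -
  let ?K = "\<lambda>x. norm (inv_fourier (\<lambda>\<xi>. of_real (f \<xi>)) x)"
  obtain b0 :: 'a where b0: "b0 \<in> Basis" using nonempty_Basis by blast
  obtain C0 where C0: "C0 \<ge> 0" "\<And>x. ?K x \<le> C0"
    using inv_fourier_decay[OF assms b0, of 0] by auto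
  have "\<forall>b\<in>Basis. \<exists>C\<ge>0. \<forall>x. \<bar>x \<bullet> b\<bar> ^ (2 * DIM('a)) * ?K x \<le> C"
    using inv_fourier_decay[OF assms] by blast
  then obtain C where C: "\<And>b. b \<in> Basis \<Longrightarrow> C b \<ge> 0" 
    "\<And>b x. b \<in> Basis \<Longrightarrow> \<bar>x \<bullet> b\<bar> ^ (2 * DIM('a)) * ?K x \<le> C b" by metis
  define D where "D = 2 ^ DIM('a) * (C0 + sum C Basis)"
  have "?K x \<le> D * (\<Prod>b\<in>Basis. inverse (1 + (x \<bullet> b)\<^sup>2))" for x
  proof -
    let ?P = "\<Prod>b\<in>Basis. 1 + (x \<bullet> b)\<^sup>2"
    have P: "?P > 0" by (intro prod_pos) (auto simp: add_pos_nonneg)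
    have "?P * ?K x \<le> 2 ^ DIM('a) * (1 + (\<Sum>b\<in>Basis. \<bar>x \<bullet> b\<bar> ^ (2 * DIM('a)))) * ?K x"
      by (intro mult_right_mono prod_one_plus_square_le) auto
    also have "\<dots> = 2 ^ DIM('a) * (?K x + (\<Sum>b\<in>Basis. \<bar>x \<bullet> b\<bar> ^ (2 * DIM('a)) * ?K x))"
      by (simp add: algebra_simps sum_distrib_left)
    also have "\<dots> \<le> D" unfolding D_def
      using C C0 by (intro mult_left_mono add_mono sum_mono) auto
    finally have "?K x \<le> D * inverse ?P" using P by (simp add: field_simps)
    then show ?thesis by (simp add: prod_inversef[symmetric] o_def)
  qed
  moreover have "D \<ge> 0" unfolding D_def using C(1) C0(1) by (intro mult_nonneg_nonneg add_nonneg_nonneg sum_nonneg) auto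
  ultimately show ?thesis by blast
qed

lemma nn_integral_prod_inverse_finite:
  "(\<integral>\<^sup>+x. ennreal (\<Prod>b\<in>(Basis::'a::euclidean_space set). inverse (1 + (x \<bullet> b)\<^sup>2)) \<partial>lborel) < \<infinity>"
proof -
  have "integrable lborel (\<lambda>y::real. inverse (1 + y\<^sup>2))"
    using integrable_inverse_1_plus_square unfolding set_integrable_def by simp
  then have fin: "(\<integral>\<^sup>+y. ennreal (inverse (1 + y\<^sup>2)) \<partial>lborel) < \<infinity>"
    unfolding integrable_iff_bounded by (simp add: abs_of_nonneg)
  have "(\<integral>\<^sup>+x. ennreal (\<Prod>b\<in>(Basis::'a set). inverse (1 + (x \<bullet> b)\<^sup>2)) \<partial>lborel)
     = (\<integral>\<^sup>+x. (\<Prod>b\<in>(Basis::'a set). ennreal (inverse (1 + (x \<bullet> b)\<^sup>2))) \<partial>lborel)"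
    by (simp add: prod_ennreal)
  also have "\<dots> = (\<Prod>b\<in>(Basis::'a set). \<integral>\<^sup>+y. ennreal (inverse (1 + y\<^sup>2)) \<partial>lborel)"
    by (rule nn_integral_lborel_prod) auto
  also have "\<dots> < \<infinity>" using fin by (simp add: power_less_top_ennreal)
  finally show ?thesis .
qed

section \<open>Dilations and translations of Lebesgue integrals\<close>

lemma nn_integral_scaleR:
  fixes f :: "'a::euclidean_space \<Rightarrow> ennreal"
  assumes [measurable]: "f \<in> borel_measurable borel" and c: "c \<noteq> 0"
  shows "(\<integral>\<^sup>+x. f x \<partial>lborel) = ennreal (\<bar>c\<bar> ^ DIM('a)) * (\<integral>\<^sup>+x. f (c *\<^sub>R x) \<partial>lborel)"
proof -
  have "(\<integral>\<^sup>+x. f x \<partial>lborel) = (\<integral>\<^sup>+x. f x \<partial>density (distr lborel borel (\<lambda>x. 0 + c *\<^sub>R x)) (\<lambda>_. ennreal (\<bar>c\<bar>^DIM('a))))"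
    by (rule arg_cong[OF lborel_affine[OF c]])
  also have "\<dots> = ennreal (\<bar>c\<bar> ^ DIM('a)) * (\<integral>\<^sup>+x. f (c *\<^sub>R x) \<partial>lborel)"
    by (simp add: nn_integral_density nn_integral_distr nn_integral_cmult)
  finally show ?thesis .
qed

lemma integral_scaleR:
  fixes f :: "'a::euclidean_space \<Rightarrow> 'b::euclidean_space"
  assumes [measurable]: "f \<in> borel_measurable borel" and c: "c \<noteq> 0"
  shows "(\<integral>x. f x \<partial>lborel) = (\<bar>c\<bar> ^ DIM('a)) *\<^sub>R (\<integral>x. f (c *\<^sub>R x) \<partial>lborel)"
proof -
  have "(\<integral>x. f x \<partial>lborel) = (\<integral>x. f x \<partial>density (distr lborel borel (\<lambda>x. 0 + c *\<^sub>R x)) (\<lambda>_. ennreal (\<bar>c\<bar>^DIM('a))))"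
    by (rule arg_cong[OF lborel_affine[OF c]])
  also have "\<dots> = (\<bar>c\<bar> ^ DIM('a)) *\<^sub>R (\<integral>x. f (c *\<^sub>R x) \<partial>lborel)"
    by (simp add: integral_density integral_distr)
  finally show ?thesis .
qed

lemma integral_minus_arg:
  fixes f :: "'a::euclidean_space \<Rightarrow> 'b::euclidean_space"
  assumes "f \<in> borel_measurable borel"
  shows "(\<integral>x. f (- x) \<partial>lborel) = (\<integral>x. f x \<partial>lborel)"
  using integral_scaleR[OF assms, of "-1"] by simp

lemma nn_integral_shift:
  fixes f :: "'a::euclidean_space \<Rightarrow> ennreal"
  assumes [measurable]: "f \<in> borel_measurable borel"
  shows "(\<integral>\<^sup>+x. f (x + c) \<partial>lborel) = (\<integral>\<^sup>+x. f x \<partial>lborel)"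
proof -
  have "(\<integral>\<^sup>+x. f x \<partial>lborel) = (\<integral>\<^sup>+x. f x \<partial>distr lborel borel ((+) c))" by (simp add: lborel_distr_plus)
  then show ?thesis by (simp add: nn_integral_distr add.commute)
qed

lemma integral_shift:
  fixes f :: "'a::euclidean_space \<Rightarrow> 'b::euclidean_space"
  assumes [measurable]: "f \<in> borel_measurable borel"
  shows "(\<integral>x. f (x + c) \<partial>lborel) = (\<integral>x. f x \<partial>lborel)"
proof -
  have "(\<integral>x. f x \<partial>lborel) = (\<integral>x. f x \<partial>distr lborel borel ((+) c))" by (simp add: lborel_distr_plus)
  then show ?thesis by (simp add: integral_distr add.commute)
qed

section \<open>Littlewood--Paley kernels: size, smoothness and uniform integrability\<close>

text \<open>\<open>lp_block\<close> tests a distribution against translates of this function, so for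
  an occupation measure the block becomes a time integral of \<open>lp_kernel\<close> along the
  path.\<close>

definition lp_kernel :: "('a::euclidean_space \<Rightarrow> real) \<Rightarrow> ('a \<Rightarrow> real) \<Rightarrow> nat \<Rightarrow> 'a \<Rightarrow> complex" where
  "lp_kernel \<psi> \<phi> k = inv_fourier (\<lambda>\<xi>. of_real (lp_symbol \<psi> \<phi> k \<xi>))"

lemma inv_fourier_scaleR:
  fixes f :: "'a::euclidean_space \<Rightarrow> complex"
  assumes [measurable]: "f \<in> borel_measurable borel" and c: "c > 0"
  shows "inv_fourier (\<lambda>\<xi>. f (\<xi> /\<^sub>R c)) x = of_real (c ^ DIM('a)) * inv_fourier f (c *\<^sub>R x)"
proof -
  have "(\<integral>\<xi>. exp (\<i> * of_real (\<xi> \<bullet> x)) * f (\<xi> /\<^sub>R c) \<partial>lborel)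
     = (\<bar>c\<bar> ^ DIM('a)) *\<^sub>R (\<integral>\<xi>. exp (\<i> * of_real ((c *\<^sub>R \<xi>) \<bullet> x)) * f ((c *\<^sub>R \<xi>) /\<^sub>R c) \<partial>lborel)"
    using c by (intro integral_scaleR) auto
  then show ?thesis using c unfolding inv_fourier_def by (simp add: scaleR_conv_of_real)
qed

lemma fourier_prefactor_le: "norm (complex_of_real (1 / (2 * pi) ^ n)) \<le> 1"
proof -
  have "1 \<le> (2 * pi) ^ n" using pi_gt3 by (intro one_le_power) simp
  then show ?thesis by (subst norm_of_real) (simp add: divide_le_eq_1)
qed

lemma inv_fourier_L1:
  fixes f :: "'a::euclidean_space \<Rightarrow> real"
  assumes "smooth f" "\<And>x. f x \<noteq> 0 \<Longrightarrow> norm x \<le> r"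
  shows "\<exists>C\<ge>0. (\<integral>\<^sup>+x. ennreal (norm (inv_fourier (\<lambda>\<xi>. of_real (f \<xi>)) x)) \<partial>lborel) \<le> ennreal C"
proof -
  obtain C where C: "C \<ge> 0" "\<And>x. norm (inv_fourier (\<lambda>\<xi>. of_real (f \<xi>)) x) \<le> C * (\<Prod>b\<in>Basis. inverse (1 + (x \<bullet> b)\<^sup>2))"
    using inv_fourier_prod_decay[OF assms] by blast
  let ?I = "\<integral>\<^sup>+x. ennreal (\<Prod>b\<in>(Basis::'a set). inverse (1 + (x \<bullet> b)\<^sup>2)) \<partial>lborel"
  have "(\<integral>\<^sup>+x. ennreal (norm (inv_fourier (\<lambda>\<xi>. of_real (f \<xi>)) x)) \<partial>lborel)
    \<le> (\<integral>\<^sup>+x. ennreal C * ennreal (\<Prod>b\<in>(Basis::'a set). inverse (1 + (x \<bullet> b)\<^sup>2)) \<partial>lborel)"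
    using C by (intro nn_integral_mono) (auto simp: ennreal_mult'[symmetric] intro!: ennreal_leI)
  also have "\<dots> = ennreal C * ?I" by (intro nn_integral_cmult) auto
  also have "\<dots> = ennreal (C * enn2real ?I)"
    using nn_integral_prod_inverse_finite[where ?'a='a] C by (simp add: ennreal_mult' less_top)
  finally show ?thesis using C by (intro exI[of _ "C * enn2real ?I"]) auto
qed

lemma exp_i_diff_le: "norm (exp (\<i> * of_real a) - exp (\<i> * of_real b)) \<le> \<bar>a - b\<bar>"
proof -
  have "norm (exp (\<i> * of_real a) - exp (\<i> * of_real b)) \<le> 1 * norm (a - b)"
  proof (rule differentiable_bound[where S=UNIV and f' = "\<lambda>s y. of_real y * (\<i> * exp (\<i> * of_real s))"])
    fix s :: real
    show "((\<lambda>a. exp (\<i> * of_real a)) has_derivative (\<lambda>y. of_real y * (\<i> * exp (\<i> * of_real s)))) (at s within UNIV)"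
    proof -
      have "((\<lambda>a. \<i> * complex_of_real a) has_derivative (\<lambda>v. \<i> * of_real v)) (at s)"
        by (auto intro!: derivative_eq_intros)
      moreover have "(exp has_derivative (\<lambda>y. y * exp (\<i> * of_real s))) (at (\<i> * complex_of_real s))"
        using DERIV_exp[of "\<i> * of_real s"] unfolding has_field_derivative_def by (simp add: mult_commute_abs)
      ultimately have "((\<lambda>a. exp (\<i> * of_real a)) has_derivative (\<lambda>v. \<i> * of_real v * exp (\<i> * of_real s))) (at s)"
        by (rule has_derivative_compose)
      then show ?thesis by (simp add: mult_ac)
    qed
    show "onorm (\<lambda>y. complex_of_real y * (\<i> * exp (\<i> * of_real s))) \<le> 1"
      by (intro onorm_bound) (auto simp: norm_mult)
  qed auto
  then show ?thesis by simp
qed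

text \<open>The volume of the ball of radius 4/3, which contains the support of the symbol of block
  0. For block \<open>k\<close> this volume is multiplied by 2^(kd).\<close>

definition symbol_vol :: "nat \<Rightarrow> real" where
  "symbol_vol d = unit_ball_vol (real d) * (4/3) ^ d"

lemma symbol_vol_pos: "symbol_vol d > 0"
  unfolding symbol_vol_def by (auto intro!: mult_pos_pos unit_ball_vol_pos)

context
  fixes \<psi> \<phi> :: "'a::euclidean_space \<Rightarrow> real"
  assumes dy: "dyadic_partition \<psi> \<phi>"
begin

lemma lp_symbol_bounds: "0 \<le> lp_symbol \<psi> \<phi> k \<xi>" "lp_symbol \<psi> \<phi> k \<xi> \<le> 1"
proof -
  have "range \<psi> \<subseteq> {0..1}" "range \<phi> \<subseteq> {0..1}" using dy unfolding dyadic_partition_def by blast+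
  then have "0 \<le> \<psi> \<xi>" "\<psi> \<xi> \<le> 1" "0 \<le> \<phi> \<xi>" "\<phi> \<xi> \<le> 1" for \<xi>
    by (meson atLeastAtMost_iff range_subsetD)+
  then show "0 \<le> lp_symbol \<psi> \<phi> k \<xi>" "lp_symbol \<psi> \<phi> k \<xi> \<le> 1"
    unfolding lp_symbol_def by (auto split: nat.split)
qed

lemma lp_symbol_even: "lp_symbol \<psi> \<phi> k (- \<xi>) = lp_symbol \<psi> \<phi> k \<xi>"
proof -
  have "\<psi> \<xi> = \<psi> \<eta> \<and> \<phi> \<xi> = \<phi> \<eta>" if "norm \<xi> = norm \<eta>" for \<xi> \<eta>
    using dy that unfolding dyadic_partition_def by blast
  from this[of "- \<xi>" \<xi>] this[of "- \<xi> /\<^sub>R 2 ^ j" "\<xi> /\<^sub>R 2 ^ j" for j]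
  show ?thesis unfolding lp_symbol_def by (auto split: nat.split)
qed

text \<open>For \<open>k = Suc j\<close> the outer radius 8/3 * 2^j equals 4/3 * 2^k, so a single
  formula also covers the low-frequency block.\<close>

lemma lp_symbol_support: "lp_symbol \<psi> \<phi> k \<xi> \<noteq> 0 \<Longrightarrow> norm \<xi> \<le> 4/3 * 2 ^ k"
proof -
  have *: "\<psi> \<xi> \<noteq> 0 \<Longrightarrow> norm \<xi> \<le> 4/3" "\<phi> \<xi> \<noteq> 0 \<Longrightarrow> norm \<xi> \<le> 8/3" for \<xi>
    using dy unfolding dyadic_partition_def by blast+
  assume "lp_symbol \<psi> \<phi> k \<xi> \<noteq> 0"
  then show ?thesis unfolding lp_symbol_def
    using *(1)[of \<xi>] *(2)[of "\<xi> /\<^sub>R 2 ^ j" for j] by (auto split: nat.splits simp: field_simps)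
qed

text \<open>The inner radius of the annulus, 3/4 * 2^j, rewritten with the index of the block. Block
  0 has no such bound, so the moment estimate must treat it by other means.\<close>

lemma lp_symbol_support_lower: "lp_symbol \<psi> \<phi> (Suc j) \<xi> \<noteq> 0 \<Longrightarrow> 3/8 * 2 ^ Suc j \<le> norm \<xi>"
proof -
  have *: "\<phi> \<xi> \<noteq> 0 \<Longrightarrow> 3/4 \<le> norm \<xi>" for \<xi>
    using dy unfolding dyadic_partition_def by blast+
  assume "lp_symbol \<psi> \<phi> (Suc j) \<xi> \<noteq> 0"
  then show ?thesis unfolding lp_symbol_def using *[of "\<xi> /\<^sub>R 2 ^ j"] by (auto simp: field_simps)
qed

lemma lp_symbol_continuous: "continuous_on UNIV (lp_symbol \<psi> \<phi> k)"
proof -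
  have s: "smooth \<psi>" "smooth \<phi>" using dy unfolding dyadic_partition_def by blast+
  have "continuous_on UNIV (\<lambda>\<xi>. \<phi> (\<xi> /\<^sub>R 2 ^ j))" for j
    by (rule continuous_on_compose2[OF smooth_continuous[OF s(2)]]) (auto intro!: continuous_intros)
  then show ?thesis unfolding lp_symbol_def using smooth_continuous[OF s(1)] by (cases k) simp_all
qed

lemma lp_symbol_measurable [measurable]: "lp_symbol \<psi> \<phi> k \<in> borel_measurable borel"
  using lp_symbol_continuous by (rule borel_measurable_continuous_onI)

lemma lp_kernel_integrand_integrable:
  "integrable lborel (\<lambda>\<xi>. exp (\<i> * of_real (\<xi> \<bullet> x)) * complex_of_real (lp_symbol \<psi> \<phi> k \<xi>))"
proof (rule integrable_compact_support)
  show "continuous_on UNIV (\<lambda>\<xi>. exp (\<i> * of_real (\<xi> \<bullet> x)) * complex_of_real (lp_symbol \<psi> \<phi> k \<xi>))"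
    by (auto intro!: continuous_intros lp_symbol_continuous)
  show "norm \<xi> \<le> 4/3 * 2 ^ k" if "exp (\<i> * of_real (\<xi> \<bullet> x)) * complex_of_real (lp_symbol \<psi> \<phi> k \<xi>) \<noteq> 0" for \<xi>
    by (rule lp_symbol_support) (use that in auto)
qed

text \<open>Conjugation amounts to replacing \<xi> by -\<xi> under the integral, and the symbol is
  even. Real kernels allow even powers in place of powers of the norm.\<close>

lemma lp_kernel_real: "Im (lp_kernel \<psi> \<phi> k x) = 0"
proof -
  let ?g = "\<lambda>\<xi>. exp (\<i> * of_real (\<xi> \<bullet> x)) * complex_of_real (lp_symbol \<psi> \<phi> k \<xi>)"
  have "cnj (\<integral>\<xi>. ?g \<xi> \<partial>lborel) = (\<integral>\<xi>. cnj (?g \<xi>) \<partial>lborel)" by (rule Bochner_Integration.integral_cnj[symmetric])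
  also have "\<dots> = (\<integral>\<xi>. ?g (- \<xi>) \<partial>lborel)"
    by (simp add: lp_symbol_even exp_cnj)
  also have "\<dots> = (\<integral>\<xi>. ?g \<xi> \<partial>lborel)" by (rule integral_minus_arg) simp
  finally have "Im (cnj (\<integral>\<xi>. ?g \<xi> \<partial>lborel)) = Im (\<integral>\<xi>. ?g \<xi> \<partial>lborel)" by (rule arg_cong)
  then have I: "Im (\<integral>\<xi>. ?g \<xi> \<partial>lborel) = 0" unfolding cnj.sel by simp
  have "Im (of_real c * (\<integral>\<xi>. ?g \<xi> \<partial>lborel)) = 0" for c
    by (simp only: times_complex.sel Im_complex_of_real I mult_zero_left mult_zero_right add_0)
  then show ?thesis unfolding lp_kernel_def inv_fourier_def .
qed

lemma nn_integral_lp_symbol_le: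
  "(\<integral>\<^sup>+\<xi>. ennreal (lp_symbol \<psi> \<phi> k \<xi>) \<partial>lborel)
    \<le> ennreal (unit_ball_vol (real DIM('a)) * (4/3) ^ DIM('a) * 2 ^ (k * DIM('a)))"
proof -
  have "(\<integral>\<^sup>+\<xi>. ennreal (lp_symbol \<psi> \<phi> k \<xi>) \<partial>lborel) \<le> (\<integral>\<^sup>+\<xi>. indicator (cball (0::'a) (4/3 * 2 ^ k)) \<xi> \<partial>lborel)"
  proof (intro nn_integral_mono)
    fix \<xi> show "ennreal (lp_symbol \<psi> \<phi> k \<xi>) \<le> indicator (cball 0 (4/3 * 2 ^ k)) \<xi>"
      using lp_symbol_bounds[of k \<xi>] lp_symbol_support[of k \<xi>]
      by (cases "lp_symbol \<psi> \<phi> k \<xi> = 0") (auto simp: ennreal_le_1)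
  qed
  also have "\<dots> = emeasure lborel (cball 0 (4/3 * 2 ^ k) :: 'a set)" by simp
  also have "\<dots> = ennreal (unit_ball_vol (real DIM('a)) * (4/3 * 2 ^ k) ^ DIM('a))"
    by (subst emeasure_cball) auto
  also have "(4/3 * 2 ^ k :: real) ^ DIM('a) = (4/3) ^ DIM('a) * 2 ^ (k * DIM('a))"
    by (simp only: power_mult_distrib power_mult)
  finally show ?thesis by (simp add: mult.assoc)
qed

lemma integral_lp_symbol_le:
  "(\<integral>\<xi>. lp_symbol \<psi> \<phi> k \<xi> \<partial>lborel) \<le> symbol_vol DIM('a) * 2 ^ (k * DIM('a))"
  unfolding symbol_vol_def
  using nn_integral_lp_symbol_le[of k] lp_symbol_bounds
  by (subst integral_eq_nn_integral)
     (auto intro!: enn2real_leI unit_ball_vol_nonneg)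

lemma lp_kernel_bound: "norm (lp_kernel \<psi> \<phi> k x) \<le> symbol_vol DIM('a) * 2 ^ (k * DIM('a))"
proof -
  let ?g = "\<lambda>\<xi>. exp (\<i> * of_real (\<xi> \<bullet> x)) * complex_of_real (lp_symbol \<psi> \<phi> k \<xi>)"
  have "norm (lp_kernel \<psi> \<phi> k x) \<le> 1 * norm (\<integral>\<xi>. ?g \<xi> \<partial>lborel)"
    unfolding lp_kernel_def inv_fourier_def norm_mult by (intro mult_right_mono fourier_prefactor_le) auto
  also have "\<dots> \<le> (\<integral>\<xi>. norm (?g \<xi>) \<partial>lborel)" by simp
  also have "\<dots> = (\<integral>\<xi>. lp_symbol \<psi> \<phi> k \<xi> \<partial>lborel)"
    using lp_symbol_bounds by (simp add: norm_mult)
  also note integral_lp_symbol_le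
  finally show ?thesis by simp
qed

text \<open>The difference of the two exponentials costs a factor |\<xi>|, which is at most 4/3 *
  2^k on the support. This extra power of 2^k is what the case \<open>q = \<infinity>\<close> has to
  absorb.\<close>

lemma lp_kernel_lipschitz:
  "norm (lp_kernel \<psi> \<phi> k x - lp_kernel \<psi> \<phi> k y) \<le> 4/3 * symbol_vol DIM('a) * 2 ^ (k * (DIM('a) + 1)) * norm (x - y)"
proof -
  let ?g = "\<lambda>x \<xi>. exp (\<i> * of_real (\<xi> \<bullet> x)) * complex_of_real (lp_symbol \<psi> \<phi> k \<xi>)"
  have int: "integrable lborel (\<lambda>\<xi>. lp_symbol \<psi> \<phi> k \<xi>)"
    by (rule integrable_compact_support[OF lp_symbol_continuous lp_symbol_support])
  have "lp_kernel \<psi> \<phi> k x - lp_kernel \<psi> \<phi> k y = of_real (1 / (2 * pi) ^ DIM('a)) * (\<integral>\<xi>. ?g x \<xi> - ?g y \<xi> \<partial>lborel)"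
    unfolding lp_kernel_def inv_fourier_def
    by (subst Bochner_Integration.integral_diff[OF lp_kernel_integrand_integrable lp_kernel_integrand_integrable])
       (simp add: right_diff_distrib)
  then have "norm (lp_kernel \<psi> \<phi> k x - lp_kernel \<psi> \<phi> k y) \<le> 1 * norm (\<integral>\<xi>. ?g x \<xi> - ?g y \<xi> \<partial>lborel)"
    unfolding norm_mult by (simp only: norm_mult) (intro mult_right_mono fourier_prefactor_le norm_ge_zero)
  also have "\<dots> \<le> (\<integral>\<xi>. norm (?g x \<xi> - ?g y \<xi>) \<partial>lborel)" by simp
  also have "\<dots> \<le> (\<integral>\<xi>. 4/3 * 2 ^ k * norm (x - y) * lp_symbol \<psi> \<phi> k \<xi> \<partial>lborel)"
  proof (rule integral_mono)
    show "integrable lborel (\<lambda>\<xi>. norm (?g x \<xi> - ?g y \<xi>))"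
      by (intro integrable_norm Bochner_Integration.integrable_diff lp_kernel_integrand_integrable)
    show "integrable lborel (\<lambda>\<xi>. 4/3 * 2 ^ k * norm (x - y) * lp_symbol \<psi> \<phi> k \<xi>)"
      by (intro integrable_mult_right int)
    fix \<xi>
    have "norm (?g x \<xi> - ?g y \<xi>) = norm (exp (\<i> * of_real (\<xi> \<bullet> x)) - exp (\<i> * of_real (\<xi> \<bullet> y))) * lp_symbol \<psi> \<phi> k \<xi>"
      using lp_symbol_bounds[of k \<xi>] by (simp add: norm_mult flip: left_diff_distrib)
    also have "\<dots> \<le> \<bar>\<xi> \<bullet> x - \<xi> \<bullet> y\<bar> * lp_symbol \<psi> \<phi> k \<xi>"
      using lp_symbol_bounds[of k \<xi>] by (intro mult_right_mono exp_i_diff_le)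
    also have "\<bar>\<xi> \<bullet> x - \<xi> \<bullet> y\<bar> \<le> norm \<xi> * norm (x - y)"
      by (simp add: Cauchy_Schwarz_ineq2 flip: inner_diff_right)
    also have "norm \<xi> * norm (x - y) * lp_symbol \<psi> \<phi> k \<xi> \<le> 4/3 * 2 ^ k * norm (x - y) * lp_symbol \<psi> \<phi> k \<xi>"
    proof (cases "lp_symbol \<psi> \<phi> k \<xi> = 0")
      case False
      show ?thesis by (intro mult_right_mono lp_symbol_support[OF False] lp_symbol_bounds norm_ge_zero)
    qed simp
    finally show "norm (?g x \<xi> - ?g y \<xi>) \<le> 4/3 * 2 ^ k * norm (x - y) * lp_symbol \<psi> \<phi> k \<xi>"
      using lp_symbol_bounds[of k \<xi>] by (simp add: mult_right_mono)
  qed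
  also have "\<dots> = 4/3 * 2 ^ k * norm (x - y) * (\<integral>\<xi>. lp_symbol \<psi> \<phi> k \<xi> \<partial>lborel)" by simp
  also have "\<dots> \<le> 4/3 * 2 ^ k * norm (x - y) * (symbol_vol DIM('a) * 2 ^ (k * DIM('a)))"
    by (intro mult_left_mono integral_lp_symbol_le) auto
  finally show ?thesis by (simp add: power_add algebra_simps)
qed

lemma lp_kernel_continuous: "continuous_on UNIV (lp_kernel \<psi> \<phi> k)"
proof (rule continuous_at_imp_continuous_on, intro ballI)
  fix x
  have "((\<lambda>y. lp_kernel \<psi> \<phi> k y - lp_kernel \<psi> \<phi> k x) \<longlongrightarrow> 0) (at x)"
  proof (rule Lim_null_comparison)
    show "\<forall>\<^sub>F y in at x. norm (lp_kernel \<psi> \<phi> k y - lp_kernel \<psi> \<phi> k x) 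
      \<le> 4/3 * symbol_vol DIM('a) * 2 ^ (k * (DIM('a) + 1)) * norm (y - x)"
      using lp_kernel_lipschitz by (intro always_eventually) blast
    have "((\<lambda>y. 4/3 * symbol_vol DIM('a) * 2 ^ (k * (DIM('a) + 1)) * norm (y - x)) 
      \<longlongrightarrow> 4/3 * symbol_vol DIM('a) * 2 ^ (k * (DIM('a) + 1)) * norm (x - x)) (at x)"
      by (intro tendsto_intros)
    then show "((\<lambda>y. 4/3 * symbol_vol DIM('a) * 2 ^ (k * (DIM('a) + 1)) * norm (y - x)) \<longlongrightarrow> 0) (at x)" by simp
  qed
  then show "isCont (lp_kernel \<psi> \<phi> k) x" by (simp add: isCont_def LIM_zero_iff)
qed

lemma lp_kernel_measurable [measurable]: "lp_kernel \<psi> \<phi> k \<in> borel_measurable borel"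
  using lp_kernel_continuous by (rule borel_measurable_continuous_onI)

text \<open>The positive blocks are dilates of one function in the \<open>L^1\<close> normalisation,
  so besides block 0 only one integral has to be finite.\<close>

lemma lp_kernel_L1: "\<exists>C>0. \<forall>k. (\<integral>\<^sup>+x. ennreal (norm (lp_kernel \<psi> \<phi> k x)) \<partial>lborel) \<le> ennreal C"
proof -
  have s: "smooth \<psi>" "smooth \<phi>" and su: "\<And>\<xi>. \<psi> \<xi> \<noteq> 0 \<Longrightarrow> norm \<xi> \<le> 4/3" "\<And>\<xi>. \<phi> \<xi> \<noteq> 0 \<Longrightarrow> norm \<xi> \<le> 8/3"
    using dy unfolding dyadic_partition_def by blast+
  obtain C1 where C1: "C1 \<ge> 0" "(\<integral>\<^sup>+x. ennreal (norm (inv_fourier (\<lambda>\<xi>. of_real (\<psi> \<xi>)) x)) \<partial>lborel) \<le> ennreal C1"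
    using inv_fourier_L1[OF s(1) su(1)] by blast
  obtain C2 where C2: "C2 \<ge> 0" "(\<integral>\<^sup>+x. ennreal (norm (inv_fourier (\<lambda>\<xi>. of_real (\<phi> \<xi>)) x)) \<partial>lborel) \<le> ennreal C2"
    using inv_fourier_L1[OF s(2) su(2)] by blast
  have "(\<integral>\<^sup>+x. ennreal (norm (lp_kernel \<psi> \<phi> k x)) \<partial>lborel) \<le> ennreal (1 + C1 + C2)" for k
  proof (cases k)
    case 0
    then show ?thesis using order_trans[OF C1(2), of "ennreal (1 + C1 + C2)"] C1(1) C2(1)
      unfolding lp_kernel_def lp_symbol_def by (auto intro: ennreal_leI)
  next
    case (Suc j)
    let ?K = "inv_fourier (\<lambda>\<xi>. complex_of_real (\<phi> \<xi>))"
    have [measurable]: "\<phi> \<in> borel_measurable borel"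
      using smooth_continuous[OF s(2)] by (rule borel_measurable_continuous_onI)
    have kj: "lp_kernel \<psi> \<phi> k x = of_real ((2^j) ^ DIM('a)) * ?K (2 ^ j *\<^sub>R x)" for x
      unfolding lp_kernel_def lp_symbol_def Suc nat.case
      by (subst inv_fourier_scaleR[of "\<lambda>\<xi>. complex_of_real (\<phi> \<xi>)" "2 ^ j"]) auto
    \<comment> \<open>Read backwards, the dilation expresses the mother kernel by
      \<open>lp_kernel\<close>, from which it inherits measurability.\<close>
    have K': "?K x = of_real (1 / (2^j) ^ DIM('a)) * lp_kernel \<psi> \<phi> k (x /\<^sub>R 2 ^ j)" for x
      unfolding kj by simp
    have [measurable]: "?K \<in> borel_measurable borel"
      unfolding K'[abs_def] by measurable
    have "(\<integral>\<^sup>+x. ennreal (norm (lp_kernel \<psi> \<phi> k x)) \<partial>lborel) 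
        = (\<integral>\<^sup>+x. ennreal ((2^j) ^ DIM('a)) * ennreal (norm (?K (2 ^ j *\<^sub>R x))) \<partial>lborel)"
      unfolding kj by (simp add: norm_mult norm_power ennreal_mult')
    also have "\<dots> = ennreal (\<bar>2^j\<bar> ^ DIM('a)) * (\<integral>\<^sup>+x. ennreal (norm (?K (2 ^ j *\<^sub>R x))) \<partial>lborel)"
      by (subst nn_integral_cmult) auto
    also have "\<dots> = (\<integral>\<^sup>+x. ennreal (norm (?K x)) \<partial>lborel)"
      by (rule nn_integral_scaleR[symmetric]) auto
    also have "\<dots> \<le> ennreal (1 + C1 + C2)"
      using order_trans[OF C2(2), of "ennreal (1 + C1 + C2)"] C1(1) C2(1) by (auto intro: ennreal_leI)
    finally show ?thesis .
  qed
  then show ?thesis using C1(1) C2(1) by (intro exI[of _ "1 + C1 + C2"]) auto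
qed

end

section \<open>Smoothed occupation densities of a random path\<close>

text \<open>A nondegenerate variable is standardised and the characteristic function of the standard
  normal law applies. An almost surely constant one has variance 0, and the trivial bound 1
  suffices.\<close>

lemma (in prob_space) gaussian_char_le:
  assumes "gaussian_rv M X"
  shows "norm (\<integral>w. exp (\<i> * of_real (X w)) \<partial>M) \<le> exp (- variance X / 2)"
proof -
  have X [measurable]: "X \<in> borel_measurable M" using assms by (simp add: gaussian_rv_def)
  from assms consider m where "AE w in M. X w = m" 
    | m \<sigma> where "\<sigma> > 0" "distributed M lborel X (\<lambda>x. ennreal (normal_density m \<sigma> x))"
    unfolding gaussian_rv_def by blast
  then show ?thesis
  proof cases
    case 1
    have "expectation X = (\<integral>w. m \<partial>M)" using 1 by (intro integral_cong_AE) auto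
    then have e: "expectation X = m" by (simp add: prob_space)
    have "variance X = (\<integral>w. 0 \<partial>M)" unfolding e using 1 by (intro integral_cong_AE) auto
    then have v: "variance X = 0" by simp
    have "norm (\<integral>w. exp (\<i> * of_real (X w)) \<partial>M) \<le> (\<integral>w. norm (exp (\<i> * of_real (X w))) \<partial>M)"
      by (rule integral_norm_bound)
    also have "\<dots> = 1" by (simp add: prob_space)
    finally show ?thesis using v by simp
  next
    case 2
    have v: "variance X = \<sigma>\<^sup>2" using normal_distributed_variance[OF 2] .
    define Y where "Y w = (X w - m) / \<sigma>" for w
    have [measurable]: "Y \<in> borel_measurable M" unfolding Y_def by measurable
    have "distributed M lborel Y std_normal_density"
      using normal_standard_normal_convert[OF 2(1), of X m] 2(2) unfolding Y_def by blast
    then have dY: "distr M lborel Y = std_normal_distribution"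
      by (simp add: distributed_def)
    have XY: "X w = m + \<sigma> * Y w" for w using 2(1) by (simp add: Y_def)
    have "(\<integral>w. exp (\<i> * of_real (X w)) \<partial>M) = exp (\<i> * of_real m) * (\<integral>w. exp (\<i> * of_real (\<sigma> * Y w)) \<partial>M)"
      unfolding XY by (simp add: distrib_left exp_add)
    also have "(\<integral>w. exp (\<i> * of_real (\<sigma> * Y w)) \<partial>M) = (\<integral>y. exp (\<i> * of_real (\<sigma> * y)) \<partial>distr M lborel Y)"
      by (subst integral_distr) auto
    also have "\<dots> = of_real (exp (- \<sigma>\<^sup>2 / 2))"
      using char_std_normal_distribution[THEN fun_cong, of \<sigma>] unfolding dY char_def by simp
    finally show ?thesis unfolding v by (simp add: norm_mult)
  qed
qed

definition smoothed_occupation ::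
  "('a::euclidean_space \<Rightarrow> complex) \<Rightarrow> (real \<Rightarrow> 'a) \<Rightarrow> real \<Rightarrow> real \<Rightarrow> 'a \<Rightarrow> complex" where
  "smoothed_occupation K X s r x = (\<integral>\<tau>. indicator {s..r} \<tau> *\<^sub>R K (x - X \<tau>) \<partial>lborel)"

text \<open>What the peeling argument uses about one Littlewood--Paley kernel. In the application
  \<open>KB\<close> grows like 2^(kd), while \<open>KL\<close> does not depend on the block, so only
  \<open>KL\<close> may enter the main estimate. \<open>\<theta>\<close> is the symbol.\<close>

locale kernel_process = prob_space M for M :: "'w measure" +
  fixes \<omega> :: "real \<Rightarrow> 'w \<Rightarrow> 'a::euclidean_space"
    and K :: "'a \<Rightarrow> complex" and \<theta> :: "'a \<Rightarrow> real" and c\<^sub>0 KB KL :: real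
  assumes process_measurable [measurable]: "\<And>t. \<omega> t \<in> borel_measurable M"
    and process_continuous: "\<And>w. w \<in> space M \<Longrightarrow> continuous_on UNIV (\<lambda>t. \<omega> t w)"
    and K_continuous: "continuous_on UNIV K"
    and K_real: "\<And>x. Im (K x) = 0"
    and K_bound: "\<And>x. norm (K x) \<le> KB"
    and K_L1: "(\<integral>\<^sup>+x. ennreal (norm (K x)) \<partial>lborel) \<le> ennreal KL" and KL_nonneg: "0 \<le> KL"
    and K_fourier: "\<And>x. K x = of_real c\<^sub>0 * (\<integral>\<xi>. exp (\<i> * of_real (\<xi> \<bullet> x)) * of_real (\<theta> \<xi>) \<partial>lborel)"
    and c\<^sub>0: "norm (complex_of_real c\<^sub>0) \<le> 1"
    and \<theta>_nonneg: "\<And>\<xi>. 0 \<le> \<theta> \<xi>"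
    and \<theta>_integrable: "integrable lborel \<theta>"
begin

lemma K_measurable [measurable]: "K \<in> borel_measurable borel"
  using K_continuous by (rule borel_measurable_continuous_onI)

lemma KB_nonneg: "0 \<le> KB" using K_bound[of 0] norm_ge_zero order_trans by blast

lemma \<theta>_measurable [measurable]: "\<theta> \<in> borel_measurable borel"
  using \<theta>_integrable borel_measurable_integrable by fastforce

text \<open>Freezing time to the grid of mesh 2^(-n) leaves countably many measurable pieces, and
  path continuity gives the limit.\<close>

lemma process_jointly_measurable [measurable]:
  "(\<lambda>z. \<omega> (fst z) (snd z)) \<in> borel_measurable (borel \<Otimes>\<^sub>M M)"
proof (rule borel_measurable_LIMSEQ_metric)
  define f where "f n z = \<omega> (real_of_int \<lfloor>2 ^ n * fst z\<rfloor> / 2 ^ n) (snd z)" for n :: nat and z :: "real \<times> 'w"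
  show "f n \<in> borel_measurable (borel \<Otimes>\<^sub>M M)" for n
    unfolding f_def by (rule measurable_compose_countable) measurable
  fix z :: "real \<times> 'w" assume z: "z \<in> space (borel \<Otimes>\<^sub>M M)"
  then have "snd z \<in> space M" by (auto simp: space_pair_measure)
  from process_continuous[OF this] have c: "isCont (\<lambda>t. \<omega> t (snd z)) (fst z)"
    by (simp add: continuous_on_eq_continuous_at)
  have "(\<lambda>n. real_of_int \<lfloor>2 ^ n * fst z\<rfloor> / 2 ^ n) \<longlonglongrightarrow> fst z"
  proof (rule real_tendsto_sandwich)
    show "\<forall>\<^sub>F n in sequentially. fst z - (1/2) ^ n \<le> real_of_int \<lfloor>2 ^ n * fst z\<rfloor> / 2 ^ n"
    proof (rule always_eventually, rule allI)
      fix n :: nat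
      have "2 ^ n * fst z - 1 \<le> real_of_int \<lfloor>2 ^ n * fst z\<rfloor>" by linarith
      then have "(2 ^ n * fst z - 1) / 2 ^ n \<le> real_of_int \<lfloor>2 ^ n * fst z\<rfloor> / 2 ^ n" by (intro divide_right_mono) auto
      then show "fst z - (1/2) ^ n \<le> real_of_int \<lfloor>2 ^ n * fst z\<rfloor> / 2 ^ n"
        by (simp add: diff_divide_distrib power_one_over)
    qed
    show "\<forall>\<^sub>F n in sequentially. real_of_int \<lfloor>2 ^ n * fst z\<rfloor> / 2 ^ n \<le> fst z"
    proof (rule always_eventually, rule allI)
      fix n :: nat
      have "real_of_int \<lfloor>2 ^ n * fst z\<rfloor> \<le> 2 ^ n * fst z" by linarith
      then show "real_of_int \<lfloor>2 ^ n * fst z\<rfloor> / 2 ^ n \<le> fst z" by (simp add: divide_le_eq mult.commute)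
    qed
    have "(\<lambda>n. fst z - (1/2) ^ n) \<longlonglongrightarrow> fst z - 0" by (intro tendsto_intros LIMSEQ_power_zero) auto
    then show "(\<lambda>n. fst z - (1/2) ^ n) \<longlonglongrightarrow> fst z" by simp
  qed auto
  then show "(\<lambda>n. f n z) \<longlonglongrightarrow> \<omega> (fst z) (snd z)"
    unfolding f_def by (rule isCont_tendsto_compose[OF c])
qed

lemma process_measurable2 [measurable (raw)]:
  assumes [measurable]: "f \<in> borel_measurable L" "h \<in> measurable L M"
  shows "(\<lambda>z. \<omega> (f z) (h z)) \<in> borel_measurable L"
  using measurable_compose[OF measurable_Pair[OF assms] process_jointly_measurable] by simp

abbreviation N :: "('a \<times> 'w) measure" where "N \<equiv> lborel \<Otimes>\<^sub>M M"

abbreviation D :: "real \<Rightarrow> real \<Rightarrow> 'a \<Rightarrow> 'w \<Rightarrow> complex" where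
  "D s r x w \<equiv> smoothed_occupation K (\<lambda>\<tau>. \<omega> \<tau> w) s r x"

sublocale XM: pair_sigma_finite lborel M
  by (intro pair_sigma_finite.intro sigma_finite_measure_axioms sigma_finite_lborel)

lemma N_sigma_finite: "sigma_finite_measure N"
  by (rule XM.sigma_finite_measure_axioms) 

lemma D_measurable [measurable (raw)]:
  assumes [measurable]: "f1 \<in> borel_measurable L" "f2 \<in> borel_measurable L" "f \<in> borel_measurable L" "h \<in> measurable L M"
  shows "(\<lambda>z. D (f1 z) (f2 z) (f z) (h z)) \<in> borel_measurable L"
proof -
  have eq: "indicator {s..r} \<tau> = (if s \<le> \<tau> \<and> \<tau> \<le> r then 1 else 0::real)" for s r \<tau> :: real
    by (auto simp: indicator_def)
  show ?thesis unfolding smoothed_occupation_def eq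
    by measurable
qed

lemma D_integrand_continuous:
  "w \<in> space M \<Longrightarrow> continuous_on UNIV (\<lambda>\<tau>. K (x - \<omega> \<tau> w))"
  by (intro continuous_on_compose2[OF K_continuous] continuous_intros process_continuous) auto

lemma D_integrand_integrable:
  "w \<in> space M \<Longrightarrow> integrable lborel (\<lambda>\<tau>. indicator {s..r} \<tau> *\<^sub>R K (x - \<omega> \<tau> w))"
  by (rule borel_integrable_compact) (auto intro: continuous_on_subset[OF D_integrand_continuous])

lemma D_eq_integral:
  assumes "w \<in> space M"
  shows "D s r x w = integral {s..r} (\<lambda>\<tau>. K (x - \<omega> \<tau> w))"
  using set_borel_integral_eq_integral(2)[of "{s..r}" "\<lambda>\<tau>. K (x - \<omega> \<tau> w)"] D_integrand_integrable[OF assms, of s r x]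
  by (simp add: smoothed_occupation_def set_integrable_def set_lebesgue_integral_def)

lemma D_self [simp]: "D s s x w = 0"
  unfolding smoothed_occupation_def
proof (rule integral_eq_zero_AE)
  have "AE \<tau> in lborel. \<tau> \<noteq> s" by (rule AE_lborel_singleton)
  then show "AE \<tau> in lborel. indicator {s..s} \<tau> *\<^sub>R K (x - \<omega> \<tau> w) = 0" by eventually_elim auto
qed

lemma D_additive:
  assumes "w \<in> space M" "s \<le> r" "r \<le> t"
  shows "D s t x w = D s r x w + D r t x w"
  unfolding D_eq_integral[OF assms(1)]
  by (rule Henstock_Kurzweil_Integration.integral_combine[symmetric, OF assms(2,3)])
     (intro integrable_continuous_real continuous_on_subset[OF D_integrand_continuous[OF assms(1)]], simp)

lemma D_bound:
  assumes "w \<in> space M" "s \<le> r"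
  shows "norm (D s r x w) \<le> KB * (r - s)"
  unfolding D_eq_integral[OF assms(1)]
  by (rule order_trans[OF integral_bound[OF assms(2), where B=KB]])
     (auto intro!: continuous_on_subset[OF D_integrand_continuous[OF assms(1)]] K_bound)

lemma nn_integral_K_shift: "(\<integral>\<^sup>+x. ennreal (norm (K (x - c))) \<partial>lborel) \<le> ennreal KL"
  using nn_integral_shift[of "\<lambda>x. ennreal (norm (K x))" "- c"] K_L1 by simp

lemma nn_integral_N_g: "(\<integral>\<^sup>+z. ennreal (norm (K (fst z - \<omega> \<tau> (snd z)))) \<partial>N) \<le> ennreal KL"
proof -
  have "(\<integral>\<^sup>+z. ennreal (norm (K (fst z - \<omega> \<tau> (snd z)))) \<partial>N) 
      = (\<integral>\<^sup>+w. \<integral>\<^sup>+x. ennreal (norm (K (x - \<omega> \<tau> w))) \<partial>lborel \<partial>M)"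
    by (subst XM.nn_integral_snd[symmetric]) auto
  also have "\<dots> \<le> (\<integral>\<^sup>+w. ennreal KL \<partial>M)"
    by (intro nn_integral_mono nn_integral_K_shift)
  also have "\<dots> = ennreal KL" by (simp add: emeasure_space_1)
  finally show ?thesis .
qed

lemma nn_integral_D_x:
  assumes "s \<le> r" "w \<in> space M"
  shows "(\<integral>\<^sup>+x. ennreal (norm (D s r x w)) \<partial>lborel) \<le> ennreal (KL * (r - s))"
proof -
  have "(\<integral>\<^sup>+x. ennreal (norm (D s r x w)) \<partial>lborel) 
    \<le> (\<integral>\<^sup>+x. \<integral>\<^sup>+\<tau>. indicator {s..r} \<tau> * ennreal (norm (K (x - \<omega> \<tau> w))) \<partial>lborel \<partial>lborel)"
  proof (intro nn_integral_mono)
    fix x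
    have "ennreal (norm (D s r x w)) \<le> (\<integral>\<^sup>+\<tau>. ennreal (norm (indicator {s..r} \<tau> *\<^sub>R K (x - \<omega> \<tau> w))) \<partial>lborel)"
      unfolding smoothed_occupation_def by (intro integral_norm_bound_ennreal D_integrand_integrable assms)
    also have "\<dots> = (\<integral>\<^sup>+\<tau>. indicator {s..r} \<tau> * ennreal (norm (K (x - \<omega> \<tau> w))) \<partial>lborel)"
      by (intro nn_integral_cong) (auto simp: indicator_def)
    finally show "ennreal (norm (D s r x w)) \<le> (\<integral>\<^sup>+\<tau>. indicator {s..r} \<tau> * ennreal (norm (K (x - \<omega> \<tau> w))) \<partial>lborel)" .
  qed
  also have "\<dots> = (\<integral>\<^sup>+\<tau>. \<integral>\<^sup>+x. indicator {s..r} \<tau> * ennreal (norm (K (x - \<omega> \<tau> w))) \<partial>lborel \<partial>lborel)"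
  proof (rule lborel_pair.Fubini')
    have [measurable]: "w \<in> space M" by fact
    show "(\<lambda>(\<tau>, x). indicator {s..r} \<tau> * ennreal (norm (K (x - \<omega> \<tau> w)))) \<in> borel_measurable (lborel \<Otimes>\<^sub>M lborel)"
      by measurable
  qed
  also have "\<dots> \<le> (\<integral>\<^sup>+\<tau>. indicator {s..r} \<tau> * ennreal KL \<partial>lborel)"
    by (intro nn_integral_mono) (auto simp: indicator_def nn_integral_K_shift)
  also have "\<dots> = ennreal (KL * (r - s))"
    using assms KL_nonneg by (subst nn_integral_multc) (auto simp: ennreal_mult' mult.commute)
  finally show ?thesis .
qed

lemma nn_integral_D_N:
  assumes "s \<le> r"
  shows "(\<integral>\<^sup>+z. ennreal (norm (D s r (fst z) (snd z))) \<partial>N) \<le> ennreal (KL * (r - s))"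
proof -
  have "(\<integral>\<^sup>+z. ennreal (norm (D s r (fst z) (snd z))) \<partial>N) 
      = (\<integral>\<^sup>+w. \<integral>\<^sup>+x. ennreal (norm (D s r x w)) \<partial>lborel \<partial>M)"
    by (subst XM.nn_integral_snd[symmetric]) auto
  also have "\<dots> \<le> (\<integral>\<^sup>+w. ennreal (KL * (r - s)) \<partial>M)"
    by (intro nn_integral_mono nn_integral_D_x assms) auto
  also have "\<dots> = ennreal (KL * (r - s))" by (simp add: emeasure_space_1)
  finally show ?thesis .
qed

text \<open>All factors but one are bounded by \<open>KB * (r - s)\<close>, the remaining one is
  integrable. At least one factor is needed because \<open>N\<close> has infinite mass; hence the
  exponent \<open>Suc n\<close>.\<close>

lemma integrable_D_power:
  assumes "s \<le> r"
  shows "integrable N (\<lambda>z. D s r (fst z) (snd z) ^ Suc n)"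
proof (rule integrableI_bounded)
  show "(\<lambda>z. D s r (fst z) (snd z) ^ Suc n) \<in> borel_measurable N" by measurable
  have "(\<integral>\<^sup>+z. ennreal (norm (D s r (fst z) (snd z) ^ Suc n)) \<partial>N)
    \<le> (\<integral>\<^sup>+z. ennreal ((KB * (r - s)) ^ n) * ennreal (norm (D s r (fst z) (snd z))) \<partial>N)"
  proof (intro nn_integral_mono)
    fix z assume "z \<in> space N"
    then have "snd z \<in> space M" by (auto simp: space_pair_measure)
    from D_bound[OF this assms, of "fst z"]
    show "ennreal (norm (D s r (fst z) (snd z) ^ Suc n)) \<le> ennreal ((KB * (r - s)) ^ n) * ennreal (norm (D s r (fst z) (snd z)))"
      using KB_nonneg assms
      by (subst ennreal_mult[symmetric])
         (auto simp: norm_mult norm_power mult.commute[of "norm _"] intro!: ennreal_leI mult_right_mono power_mono)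
  qed
  also have "\<dots> = ennreal ((KB * (r - s)) ^ n) * (\<integral>\<^sup>+z. ennreal (norm (D s r (fst z) (snd z))) \<partial>N)"
    by (intro nn_integral_cmult) auto
  also have "\<dots> \<le> ennreal ((KB * (r - s)) ^ n) * ennreal (KL * (r - s))"
    by (intro mult_left_mono nn_integral_D_N assms) auto
  also have "\<dots> < \<infinity>" by (simp add: ennreal_mult_less_top)
  finally show "(\<integral>\<^sup>+z. ennreal (norm (D s r (fst z) (snd z) ^ Suc n)) \<partial>N) < \<infinity>" .
qed

text \<open>Fundamental theorem of calculus for a power of \<open>D s \<tau> x w\<close> as a
  function of \<open>\<tau>\<close>. The new variable is the latest of the times and the remaining
  power lives on the interval before it, so repetition orders all times.\<close>

lemma D_power_eq:
  assumes w: "w \<in> space M" and "s \<le> r"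
  shows "D s r x w ^ Suc n = of_nat (Suc n) *
    (\<integral>\<tau>. indicator {s..r} \<tau> *\<^sub>R (D s \<tau> x w ^ n * K (x - \<omega> \<tau> w)) \<partial>lborel)"
proof -
  let ?g = "\<lambda>\<tau>. K (x - \<omega> \<tau> w)"
  have cg: "continuous_on {s..r} ?g" by (rule continuous_on_subset[OF D_integrand_continuous[OF w]]) auto
  have dD: "((\<lambda>\<tau>. D s \<tau> x w) has_vector_derivative ?g \<tau>) (at \<tau> within {s..r})" if "\<tau> \<in> {s..r}" for \<tau>
    unfolding D_eq_integral[OF w] using integral_has_vector_derivative[OF cg that] .
  have dP: "((\<lambda>\<tau>. D s \<tau> x w ^ Suc n) has_vector_derivative of_nat (Suc n) * (D s \<tau> x w ^ n * ?g \<tau>)) (at \<tau> within {s..r})" 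
    if "\<tau> \<in> {s..r}" for \<tau>
  proof -
    have "((\<lambda>z::complex. z ^ Suc n) has_field_derivative of_nat (Suc n) * D s \<tau> x w ^ n) (at (D s \<tau> x w))"
      by (auto intro!: derivative_eq_intros simp del: power_Suc)
    from field_vector_diff_chain_within[OF dD[OF that] has_field_derivative_at_within[OF this]]
    show ?thesis by (simp add: o_def mult_ac)
  qed
  have "continuous_on {s..r} (\<lambda>\<tau>. D s \<tau> x w)"
    by (rule continuous_on_vector_derivative[OF dD])
  then have "continuous_on {s..r} (\<lambda>\<tau>. of_nat (Suc n) * (D s \<tau> x w ^ n * ?g \<tau>))"
    by (intro continuous_intros cg)
  from integral_FTC_Icc[OF \<open>s \<le> r\<close> dP this]
  have "(\<integral>\<tau>. indicator {s..r} \<tau> *\<^sub>R (of_nat (Suc n) * (D s \<tau> x w ^ n * ?g \<tau>)) \<partial>lborel) = D s r x w ^ Suc n"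
    by simp
  then show ?thesis by (simp only: mult_scaleR_right[symmetric] integral_mult_right_zero)
qed

end

section \<open>Peeling one time and one frequency\<close>

context kernel_process begin

text \<open>\<open>E\<close> carries the exponentials of the later times. Absolute bounds only
  justify Fubini; the modulus is taken after integration over \<open>N\<close>, so that the
  oscillation survives.\<close>

lemma norm_integral_D_power_le:
  assumes E [measurable]: "E \<in> borel_measurable N" and E1: "\<And>z. norm (E z) \<le> 1" and "s \<le> r"
  shows "ennreal (norm (\<integral>z. E z * D s r (fst z) (snd z) ^ Suc n \<partial>N)) \<le> ennreal (Suc n) *
    (\<integral>\<^sup>+\<tau>. indicator {s..<r} \<tau> *
      ennreal (norm (\<integral>z. E z * (D s \<tau> (fst z) (snd z) ^ n * K (fst z - \<omega> \<tau> (snd z))) \<partial>N)) \<partial>lborel)"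
proof -
  interpret NL: pair_sigma_finite N lborel
    by (intro pair_sigma_finite.intro N_sigma_finite sigma_finite_lborel)
  define f where "f z \<tau> = indicator {s..r} \<tau> *\<^sub>R (E z * (D s \<tau> (fst z) (snd z) ^ n * K (fst z - \<omega> \<tau> (snd z))))"
    for z and \<tau> :: real
  have eq: "indicator {s..r} \<tau> = (if s \<le> \<tau> \<and> \<tau> \<le> r then 1 else 0::real)" for s r \<tau> :: real
    by (auto simp: indicator_def)
  have [measurable]: "case_prod f \<in> borel_measurable (N \<Otimes>\<^sub>M lborel)"
    unfolding f_def eq by measurable
  have int: "integrable (N \<Otimes>\<^sub>M lborel) (case_prod f)"
  proof (rule integrableI_bounded)
    have "(\<integral>\<^sup>+p. ennreal (norm (case_prod f p)) \<partial>(N \<Otimes>\<^sub>M lborel)) 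
        = (\<integral>\<^sup>+\<tau>. \<integral>\<^sup>+z. ennreal (norm (f z \<tau>)) \<partial>N \<partial>lborel)"
      by (subst NL.nn_integral_snd[symmetric]) auto
    also have "\<dots> \<le> (\<integral>\<^sup>+\<tau>. indicator {s..r} \<tau> * (ennreal ((KB * (r - s)) ^ n) * ennreal KL) \<partial>lborel)"
    proof (intro nn_integral_mono)
      fix \<tau> :: real
      show "(\<integral>\<^sup>+z. ennreal (norm (f z \<tau>)) \<partial>N) \<le> indicator {s..r} \<tau> * (ennreal ((KB * (r - s)) ^ n) * ennreal KL)"
      proof (cases "\<tau> \<in> {s..r}")
        case True
        have "(\<integral>\<^sup>+z. ennreal (norm (f z \<tau>)) \<partial>N) 
          \<le> (\<integral>\<^sup>+z. ennreal ((KB * (r - s)) ^ n) * ennreal (norm (K (fst z - \<omega> \<tau> (snd z)))) \<partial>N)"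
        proof (intro nn_integral_mono)
          fix z assume "z \<in> space N"
          then have "snd z \<in> space M" by (auto simp: space_pair_measure)
          then have "norm (D s \<tau> (fst z) (snd z)) \<le> KB * (\<tau> - s)" using True by (intro D_bound) auto
          also have "\<dots> \<le> KB * (r - s)" using True KB_nonneg by (intro mult_left_mono) auto
          finally have D: "norm (D s \<tau> (fst z) (snd z)) ^ n \<le> (KB * (r - s)) ^ n" by (intro power_mono) auto
          have "norm (f z \<tau>) = norm (E z) * (norm (D s \<tau> (fst z) (snd z)) ^ n * norm (K (fst z - \<omega> \<tau> (snd z))))"
            using True by (simp add: f_def norm_mult norm_power)
          also have "\<dots> \<le> 1 * ((KB * (r - s)) ^ n * norm (K (fst z - \<omega> \<tau> (snd z))))"
            using E1[of z] D KB_nonneg assms by (intro mult_mono) auto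
          finally show "ennreal (norm (f z \<tau>)) \<le> ennreal ((KB * (r - s)) ^ n) * ennreal (norm (K (fst z - \<omega> \<tau> (snd z))))"
            using KB_nonneg assms by (subst ennreal_mult[symmetric]) (auto intro!: ennreal_leI)
        qed
        also have "\<dots> = ennreal ((KB * (r - s)) ^ n) * (\<integral>\<^sup>+z. ennreal (norm (K (fst z - \<omega> \<tau> (snd z)))) \<partial>N)"
          by (intro nn_integral_cmult) measurable
        also have "\<dots> \<le> ennreal ((KB * (r - s)) ^ n) * ennreal KL"
          by (intro mult_left_mono nn_integral_N_g) auto
        finally show ?thesis using True by simp
      qed (simp add: f_def)
    qed
    also have "\<dots> = emeasure lborel {s..r} * (ennreal ((KB * (r - s)) ^ n) * ennreal KL)"
      by (subst nn_integral_multc) auto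
    also have "\<dots> < \<infinity>" using assms by (simp add: ennreal_mult_less_top)
    finally show "(\<integral>\<^sup>+p. ennreal (norm (case_prod f p)) \<partial>(N \<Otimes>\<^sub>M lborel)) < \<infinity>" .
  qed measurable
  have "(\<integral>z. E z * D s r (fst z) (snd z) ^ Suc n \<partial>N) = (\<integral>z. of_nat (Suc n) * (\<integral>\<tau>. f z \<tau> \<partial>lborel) \<partial>N)"
  proof (rule Bochner_Integration.integral_cong[OF refl])
    fix z assume "z \<in> space N"
    then have "snd z \<in> space M" by (auto simp: space_pair_measure)
    have "(\<integral>\<tau>. f z \<tau> \<partial>lborel) = E z * (\<integral>\<tau>. indicator {s..r} \<tau> *\<^sub>R (D s \<tau> (fst z) (snd z) ^ n * K (fst z - \<omega> \<tau> (snd z))) \<partial>lborel)"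
      unfolding f_def by (simp only: mult_scaleR_right[symmetric] integral_mult_right_zero)
    then show "E z * D s r (fst z) (snd z) ^ Suc n = of_nat (Suc n) * (\<integral>\<tau>. f z \<tau> \<partial>lborel)"
      using D_power_eq[OF \<open>snd z \<in> space M\<close> assms(3), of "fst z" n] by (simp only: mult_ac)
  qed
  also have "\<dots> = of_nat (Suc n) * (\<integral>z. \<integral>\<tau>. f z \<tau> \<partial>lborel \<partial>N)"
    by (rule integral_mult_right_zero)
  also have "(\<integral>z. \<integral>\<tau>. f z \<tau> \<partial>lborel \<partial>N) = (\<integral>\<tau>. \<integral>z. f z \<tau> \<partial>N \<partial>lborel)"
    by (rule NL.Fubini_integral[OF int, symmetric])
  finally have "ennreal (norm (\<integral>z. E z * D s r (fst z) (snd z) ^ Suc n \<partial>N)) 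
      = ennreal (Suc n) * ennreal (norm (\<integral>\<tau>. \<integral>z. f z \<tau> \<partial>N \<partial>lborel))"
    by (simp add: norm_mult ennreal_mult' del: of_nat_Suc)
  also have "ennreal (norm (\<integral>\<tau>. \<integral>z. f z \<tau> \<partial>N \<partial>lborel)) \<le> (\<integral>\<^sup>+\<tau>. ennreal (norm (\<integral>z. f z \<tau> \<partial>N)) \<partial>lborel)"
    by (rule integral_norm_bound_ennreal[OF NL.integrable_snd[OF int]])
  also have "\<dots> = (\<integral>\<^sup>+\<tau>. indicator {s..<r} \<tau> *
      ennreal (norm (\<integral>z. E z * (D s \<tau> (fst z) (snd z) ^ n * K (fst z - \<omega> \<tau> (snd z))) \<partial>N)) \<partial>lborel)"
  proof (rule nn_integral_cong_AE)
    \<comment> \<open>Dropping the null endpoint makes the next time strictly smaller than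
      \<open>r\<close>; local nondeterminism is stated for strictly increasing times.\<close>
    have "AE \<tau> in lborel. \<tau> \<noteq> r" by (rule AE_lborel_singleton)
    then show "AE \<tau> in lborel. ennreal (norm (\<integral>z. f z \<tau> \<partial>N)) = indicator {s..<r} \<tau> *
      ennreal (norm (\<integral>z. E z * (D s \<tau> (fst z) (snd z) ^ n * K (fst z - \<omega> \<tau> (snd z))) \<partial>N))"
      by eventually_elim (auto simp: f_def indicator_def)
  qed
  finally show ?thesis by (simp add: mult_left_mono)
qed

text \<open>Exchanging the frequency integral with the integral over \<open>N\<close> requires
  \<open>F\<close> itself to be integrable. In the chain \<open>F\<close> contains a positive power
  of \<open>D\<close>, and for the very first time the kernel stays as it is.\<close>

lemma norm_integral_fourier_le:
  assumes F: "integrable N F"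
  shows "ennreal (norm (\<integral>z. F z * K (fst z - \<omega> \<sigma> (snd z)) \<partial>N)) \<le>
    (\<integral>\<^sup>+\<xi>. ennreal (\<theta> \<xi>) *
      ennreal (norm (\<integral>z. F z * exp (\<i> * of_real (\<xi> \<bullet> (fst z - \<omega> \<sigma> (snd z)))) \<partial>N)) \<partial>lborel)"
proof -
  interpret NL: pair_sigma_finite N "lborel :: 'a measure"
    by (intro pair_sigma_finite.intro N_sigma_finite sigma_finite_lborel)
  have [measurable]: "F \<in> borel_measurable N" using F by (rule borel_measurable_integrable)
  define f where "f z \<xi> = F z * (exp (\<i> * of_real (\<xi> \<bullet> (fst z - \<omega> \<sigma> (snd z)))) * complex_of_real (\<theta> \<xi>))" for z \<xi>
  have [measurable]: "case_prod f \<in> borel_measurable (N \<Otimes>\<^sub>M lborel)"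
    unfolding f_def by measurable
  have nf: "ennreal (norm (f z \<xi>)) = ennreal (norm (F z)) * ennreal (\<theta> \<xi>)" for z \<xi>
    using \<theta>_nonneg[of \<xi>] by (simp add: f_def norm_mult ennreal_mult')
  have int: "integrable (N \<Otimes>\<^sub>M lborel) (case_prod f)"
  proof (rule integrableI_bounded)
    have "(\<integral>\<^sup>+p. ennreal (norm (case_prod f p)) \<partial>(N \<Otimes>\<^sub>M lborel)) 
        = (\<integral>\<^sup>+\<xi>. \<integral>\<^sup>+z. ennreal (norm (f z \<xi>)) \<partial>N \<partial>lborel)"
      by (subst NL.nn_integral_snd[symmetric]) auto
    also have "\<dots> = (\<integral>\<^sup>+z. ennreal (norm (F z)) \<partial>N) * (\<integral>\<^sup>+\<xi>. ennreal (\<theta> \<xi>) \<partial>lborel)"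
      unfolding nf by (simp add: nn_integral_cmult nn_integral_multc)
    also have "\<dots> < \<infinity>"
      using F \<theta>_integrable \<theta>_nonneg unfolding integrable_iff_bounded by (simp add: ennreal_mult_less_top)
    finally show "(\<integral>\<^sup>+p. ennreal (norm (case_prod f p)) \<partial>(N \<Otimes>\<^sub>M lborel)) < \<infinity>" .
  qed measurable
  have "(\<integral>z. F z * K (fst z - \<omega> \<sigma> (snd z)) \<partial>N) = (\<integral>z. of_real c\<^sub>0 * (\<integral>\<xi>. f z \<xi> \<partial>lborel) \<partial>N)"
    unfolding f_def K_fourier by (simp add: mult_ac)
  also have "\<dots> = of_real c\<^sub>0 * (\<integral>z. \<integral>\<xi>. f z \<xi> \<partial>lborel \<partial>N)"
    by (rule integral_mult_right_zero)
  also have "(\<integral>z. \<integral>\<xi>. f z \<xi> \<partial>lborel \<partial>N) = (\<integral>\<xi>. \<integral>z. f z \<xi> \<partial>N \<partial>lborel)"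
    by (rule NL.Fubini_integral[OF int, symmetric])
  finally have "norm (\<integral>z. F z * K (fst z - \<omega> \<sigma> (snd z)) \<partial>N) \<le> 1 * norm (\<integral>\<xi>. \<integral>z. f z \<xi> \<partial>N \<partial>lborel)"
    using c\<^sub>0 by (simp only: norm_mult) (intro mult_right_mono norm_ge_zero)
  then have "ennreal (norm (\<integral>z. F z * K (fst z - \<omega> \<sigma> (snd z)) \<partial>N)) \<le> ennreal (norm (\<integral>\<xi>. \<integral>z. f z \<xi> \<partial>N \<partial>lborel))"
    by (intro ennreal_leI) simp
  also have "\<dots> \<le> (\<integral>\<^sup>+\<xi>. ennreal (norm (\<integral>z. f z \<xi> \<partial>N)) \<partial>lborel)"
    by (rule integral_norm_bound_ennreal[OF NL.integrable_snd[OF int]])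
  also have "\<dots> = (\<integral>\<^sup>+\<xi>. ennreal (\<theta> \<xi>) *
      ennreal (norm (\<integral>z. F z * exp (\<i> * of_real (\<xi> \<bullet> (fst z - \<omega> \<sigma> (snd z)))) \<partial>N)) \<partial>lborel)"
  proof (intro nn_integral_cong)
    fix \<xi>
    have "(\<integral>z. f z \<xi> \<partial>N) = of_real (\<theta> \<xi>) * (\<integral>z. F z * exp (\<i> * of_real (\<xi> \<bullet> (fst z - \<omega> \<sigma> (snd z)))) \<partial>N)"
      unfolding f_def by (simp only: mult_ac integral_mult_right_zero[symmetric])
    then show "ennreal (norm (\<integral>z. f z \<xi> \<partial>N)) = ennreal (\<theta> \<xi>) *
      ennreal (norm (\<integral>z. F z * exp (\<i> * of_real (\<xi> \<bullet> (fst z - \<omega> \<sigma> (snd z)))) \<partial>N))"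
      using \<theta>_nonneg[of \<xi>] by (simp add: norm_mult ennreal_mult')
  qed
  finally show ?thesis .
qed

text \<open>Substituting \<open>x + \<omega> \<sigma>\<close> for \<open>x\<close> leaves only increments, the quantities that local nondeterminism controls.\<close>

lemma norm_integral_K_le_char:
  fixes \<tau> :: "nat \<Rightarrow> real" and \<xi> :: "nat \<Rightarrow> 'a"
  shows "norm (\<integral>z. exp (\<i> * of_real (\<Sum>j\<in>J. \<xi> j \<bullet> (fst z - \<omega> (\<tau> j) (snd z)))) * K (fst z - \<omega> \<sigma> (snd z)) \<partial>N)
    \<le> KL * norm (\<integral>w. exp (\<i> * of_real (\<Sum>j\<in>J. \<xi> j \<bullet> (\<omega> \<sigma> w - \<omega> (\<tau> j) w))) \<partial>M)"
proof -
  let ?F = "\<lambda>x w. exp (\<i> * of_real (\<Sum>j\<in>J. \<xi> j \<bullet> (x - \<omega> (\<tau> j) w))) * K (x - \<omega> \<sigma> w)"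
  let ?X = "\<lambda>w. exp (\<i> * of_real (\<Sum>j\<in>J. \<xi> j \<bullet> (\<omega> \<sigma> w - \<omega> (\<tau> j) w)))"
  \<comment> \<open>The Fourier transform of \<open>K\<close> at the total frequency. Only its size,
    at most \<open>KL\<close>, is used.\<close>
  define A where "A = (\<integral>x. exp (\<i> * of_real (\<Sum>j\<in>J. \<xi> j \<bullet> x)) * K x \<partial>lborel)"
  have int: "integrable N (case_prod ?F)"
  proof (rule integrableI_bounded)
    have "(\<integral>\<^sup>+p. ennreal (norm (case_prod ?F p)) \<partial>N) = (\<integral>\<^sup>+z. ennreal (norm (K (fst z - \<omega> \<sigma> (snd z)))) \<partial>N)"
      by (intro nn_integral_cong) (auto simp: norm_mult)
    also have "\<dots> \<le> ennreal KL" by (rule nn_integral_N_g)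
    finally show "(\<integral>\<^sup>+p. ennreal (norm (case_prod ?F p)) \<partial>N) < \<infinity>" by (auto simp: less_top[symmetric] top_unique)
  qed measurable
  have nA: "norm A \<le> KL"
  proof -
    have "integrable lborel (\<lambda>x. exp (\<i> * of_real (\<Sum>j\<in>J. \<xi> j \<bullet> x)) * K x)"
      by (rule integrableI_bounded, measurable) 
         (use K_L1 in \<open>auto simp: norm_mult less_top[symmetric] top_unique\<close>)
    then have "ennreal (norm A) \<le> (\<integral>\<^sup>+x. ennreal (norm (exp (\<i> * of_real (\<Sum>j\<in>J. \<xi> j \<bullet> x)) * K x)) \<partial>lborel)"
      unfolding A_def by (rule integral_norm_bound_ennreal)
    also have "\<dots> \<le> ennreal KL" using K_L1 by (simp add: norm_mult)
    finally show ?thesis using KL_nonneg by simp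
  qed
  have "(\<integral>z. ?F (fst z) (snd z) \<partial>N) = (\<integral>w. \<integral>x. ?F x w \<partial>lborel \<partial>M)"
    using XM.integral_snd[OF int] unfolding case_prod_unfold by (rule sym)
  also have "\<dots> = (\<integral>w. ?X w * A \<partial>M)"
  proof (rule Bochner_Integration.integral_cong[OF refl])
    fix w assume [measurable]: "w \<in> space M"
    have "(\<integral>x. ?F x w \<partial>lborel) = (\<integral>x. ?F (x + \<omega> \<sigma> w) w \<partial>lborel)"
      by (rule integral_shift[symmetric]) measurable
    also have "\<dots> = (\<integral>x. ?X w * (exp (\<i> * of_real (\<Sum>j\<in>J. \<xi> j \<bullet> x)) * K x) \<partial>lborel)"
    proof (rule Bochner_Integration.integral_cong[OF refl])
      fix x
      have "(\<Sum>j\<in>J. \<xi> j \<bullet> (x + \<omega> \<sigma> w - \<omega> (\<tau> j) w)) 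
          = (\<Sum>j\<in>J. \<xi> j \<bullet> (\<omega> \<sigma> w - \<omega> (\<tau> j) w)) + (\<Sum>j\<in>J. \<xi> j \<bullet> x)"
        by (simp add: sum.distrib[symmetric] inner_diff_right inner_add_right algebra_simps)
      then show "?F (x + \<omega> \<sigma> w) w = ?X w * (exp (\<i> * of_real (\<Sum>j\<in>J. \<xi> j \<bullet> x)) * K x)"
        by (simp only: of_real_add distrib_left exp_add mult.assoc) simp
    qed
    also have "\<dots> = ?X w * A" unfolding A_def by (rule integral_mult_right_zero)
    finally show "(\<integral>x. ?F x w \<partial>lborel) = ?X w * A" .
  qed
  also have "\<dots> = (\<integral>w. ?X w \<partial>M) * A" by (rule integral_mult_left_zero)
  finally have "norm (\<integral>z. ?F (fst z) (snd z) \<partial>N) = norm A * norm (\<integral>w. ?X w \<partial>M)" by (simp add: norm_mult)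
  then show ?thesis using nA by (simp add: mult_right_mono)
qed

end

text \<open>Summation by parts: telescoping \<open>f 1 - f j\<close> into consecutive increments and
  exchanging the sums collects the frequencies into tail sums, the coefficients that local
  nondeterminism asks for.\<close>

lemma sum_tail_swap:
  fixes \<xi> :: "nat \<Rightarrow> 'a::real_inner" and f :: "nat \<Rightarrow> 'a"
  shows "(\<Sum>j\<in>{2..m}. \<xi> j \<bullet> (f 1 - f j)) = - (\<Sum>k\<in>{1..<m}. (\<Sum>j\<in>{k+1..m}. \<xi> j) \<bullet> (f (k + 1) - f k))"
proof -
  have "(\<Sum>k\<in>{1..<m}. (\<Sum>j\<in>{k+1..m}. \<xi> j) \<bullet> (f (k + 1) - f k)) 
      = (\<Sum>k\<in>{1..<m}. \<Sum>j\<in>{k+1..m}. \<xi> j \<bullet> (f (k + 1) - f k))" by (simp add: inner_sum_left)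
  also have "\<dots> = (\<Sum>(k,j)\<in>Sigma {1..<m} (\<lambda>k. {k+1..m}). \<xi> j \<bullet> (f (k + 1) - f k))"
    by (subst sum.Sigma) auto
  also have "\<dots> = (\<Sum>(j,k)\<in>Sigma {2..m} (\<lambda>j. {1..<j}). \<xi> j \<bullet> (f (k + 1) - f k))"
    by (rule sum.reindex_bij_witness[of _ "\<lambda>(j,k). (k,j)" "\<lambda>(k,j). (j,k)"]) auto
  also have "\<dots> = (\<Sum>j\<in>{2..m}. \<Sum>k\<in>{1..<j}. \<xi> j \<bullet> (f (k + 1) - f k))"
    by (subst sum.Sigma) auto
  also have "\<dots> = (\<Sum>j\<in>{2..m}. \<xi> j \<bullet> (f j - f 1))"
  proof (rule sum.cong[OF refl])
    fix j assume "j \<in> {2..m}"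
    then have "(\<Sum>k\<in>{1..<j}. f (k + 1) - f k) = f j - f 1"
      using sum_Suc_diff'[of 1 j f] by simp
    then show "(\<Sum>k\<in>{1..<j}. \<xi> j \<bullet> (f (k + 1) - f k)) = \<xi> j \<bullet> (f j - f 1)"
      by (simp only: inner_sum_right[symmetric])
  qed
  also have "- \<dots> = (\<Sum>j\<in>{2..m}. \<xi> j \<bullet> (f 1 - f j))"
    by (simp add: sum_negf[symmetric] inner_diff_right)
  finally show ?thesis by simp
qed

section \<open>The moment estimate by peeling off times\<close>

text \<open>\<open>Theta\<close> integrates out one time gap. \<open>chain_weight n \<eta>\<close> accounts for \<open>n\<close> peeled times (and their
  frequencies) when the frequencies of the later times sum to \<open>\<eta>\<close>.\<close>

definition Theta :: "real \<Rightarrow> real \<Rightarrow> real \<Rightarrow> 'a::euclidean_space \<Rightarrow> ennreal" where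
  "Theta c H T \<eta> = (\<integral>\<^sup>+u. indicator {0..T} u * ennreal (exp (- c * ((norm \<eta>)\<^sup>2 * u powr (2 * H)))) \<partial>lborel)"

primrec chain_weight :: "('a::euclidean_space \<Rightarrow> real) \<Rightarrow> real \<Rightarrow> real \<Rightarrow> real \<Rightarrow> nat \<Rightarrow> 'a \<Rightarrow> ennreal" where
  "chain_weight \<theta> c H T 0 \<eta> = 1"
| "chain_weight \<theta> c H T (Suc n) \<eta> =
     (\<integral>\<^sup>+\<xi>. ennreal (\<theta> \<xi>) * (Theta c H T (\<eta> + \<xi>) * chain_weight \<theta> c H T n (\<eta> + \<xi>)) \<partial>lborel)"

text \<open>The bound that local nondeterminism gives for a characteristic function, restricted to
  the gaps between the times \<open>n\<close> to \<open>m\<close> that are already fixed. At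
  \<open>n = 1\<close> it is the full bound, at \<open>n = m\<close> it equals 1.\<close>

definition lnd_decay :: "real \<Rightarrow> real \<Rightarrow> nat \<Rightarrow> nat \<Rightarrow> (nat \<Rightarrow> real) \<Rightarrow> (nat \<Rightarrow> 'a::euclidean_space) \<Rightarrow> real" where
  "lnd_decay c H m n \<tau> \<xi> =
     exp (- c * (\<Sum>k\<in>{n..<m}. (norm (\<Sum>j\<in>{k+1..m}. \<xi> j))\<^sup>2 * \<bar>\<tau> (k + 1) - \<tau> k\<bar> powr (2 * H)))"

lemma Theta_measurable [measurable]: "Theta c H T \<in> borel_measurable (borel :: 'a::euclidean_space measure)"
proof -
  have eq: "indicator {0..T} u = (if 0 \<le> u \<and> u \<le> T then 1 else 0::ennreal)" for u :: real
    by (auto simp: indicator_def)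
  show ?thesis unfolding Theta_def[abs_def] eq by measurable
qed

lemma chain_weight_measurable [measurable]:
  assumes [measurable]: "\<theta> \<in> borel_measurable borel"
  shows "chain_weight \<theta> c H T n \<in> borel_measurable borel"
proof (induction n)
  case 0
  have "chain_weight \<theta> c H T 0 = (\<lambda>\<eta>. 1)" by auto
  then show ?case by simp
next
  case (Suc n)
  note [measurable] = Suc
  have "chain_weight \<theta> c H T (Suc n) = (\<lambda>\<eta>. \<integral>\<^sup>+\<xi>. ennreal (\<theta> \<xi>) * (Theta c H T (\<eta> + \<xi>) * chain_weight \<theta> c H T n (\<eta> + \<xi>)) \<partial>lborel)"
    by auto
  then show ?case by simp
qed

text \<open>The substitution \<sigma> = r - u turns integration over the next earlier time into
  integration over the gap.\<close>

lemma nn_integral_reflect_Theta: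
  assumes "s \<le> r" "r - s \<le> T"
  shows "(\<integral>\<^sup>+\<sigma>. indicator {s..<r} \<sigma> * ennreal (exp (- c * ((norm \<eta>)\<^sup>2 * \<bar>r - \<sigma>\<bar> powr (2 * H)))) \<partial>lborel) \<le> Theta c H T \<eta>"
proof -
  have "(\<integral>\<^sup>+\<sigma>. indicator {s..<r} \<sigma> * ennreal (exp (- c * ((norm \<eta>)\<^sup>2 * \<bar>r - \<sigma>\<bar> powr (2 * H)))) \<partial>lborel)
    = ennreal \<bar>-1\<bar> * (\<integral>\<^sup>+u. indicator {s..<r} (r + (-1) * u) * ennreal (exp (- c * ((norm \<eta>)\<^sup>2 * \<bar>r - (r + (-1) * u)\<bar> powr (2 * H)))) \<partial>lborel)"
    by (rule nn_integral_real_affine) auto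
  also have "\<dots> \<le> Theta c H T \<eta>"
    unfolding Theta_def using assms by (auto intro!: nn_integral_mono simp: indicator_def)
  finally show ?thesis .
qed

text \<open>A frequency with index \<open>n + 2\<close> enters the tail sum of the gap starting at
  \<open>n + 1\<close> but of no later gap, since those tail sums begin at \<open>n + 3\<close>.
  Hence fixing one more time contributes exactly one factor.\<close>

lemma lnd_decay_step:
  assumes "n + 2 \<le> m"
  shows "lnd_decay c H m (n + 1) (\<tau>(n + 1 := \<sigma>)) (\<xi>(n + 2 := \<xi>')) =
    exp (- c * ((norm ((\<Sum>j\<in>{n+3..m}. \<xi> j) + \<xi>'))\<^sup>2 * \<bar>\<tau> (n + 2) - \<sigma>\<bar> powr (2 * H))) * lnd_decay c H m (n + 2) \<tau> \<xi>"
proof -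
  have s: "{n + 1..<m} = insert (n + 1) {n + 2..<m}" using assms by auto
  have t: "{n + 2..m} = insert (n + 2) {n + 3..m}" using assms by auto
  have 1: "(\<Sum>j\<in>{n+2..m}. (\<xi>(n + 2 := \<xi>')) j) = (\<Sum>j\<in>{n+3..m}. \<xi> j) + \<xi>'"
    unfolding t by (simp add: add.commute)
  have 2: "(\<Sum>k\<in>{n + 2..<m}. (norm (\<Sum>j\<in>{k+1..m}. (\<xi>(n + 2 := \<xi>')) j))\<^sup>2 * \<bar>(\<tau>(n + 1 := \<sigma>)) (k + 1) - (\<tau>(n + 1 := \<sigma>)) k\<bar> powr (2 * H))
    = (\<Sum>k\<in>{n + 2..<m}. (norm (\<Sum>j\<in>{k+1..m}. \<xi> j))\<^sup>2 * \<bar>\<tau> (k + 1) - \<tau> k\<bar> powr (2 * H))"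
  proof (rule sum.cong[OF refl])
    fix k assume k: "k \<in> {n + 2..<m}"
    have "(\<Sum>j\<in>{k+1..m}. (\<xi>(n + 2 := \<xi>')) j) = (\<Sum>j\<in>{k+1..m}. \<xi> j)"
      using k by (intro sum.cong) auto
    then show "(norm (\<Sum>j\<in>{k+1..m}. (\<xi>(n + 2 := \<xi>')) j))\<^sup>2 * \<bar>(\<tau>(n + 1 := \<sigma>)) (k + 1) - (\<tau>(n + 1 := \<sigma>)) k\<bar> powr (2 * H)
      = (norm (\<Sum>j\<in>{k+1..m}. \<xi> j))\<^sup>2 * \<bar>\<tau> (k + 1) - \<tau> k\<bar> powr (2 * H)" using k by simp
  qed
  have 3: "(\<Sum>k\<in>{n + 1..<m}. (norm (\<Sum>j\<in>{k+1..m}. (\<xi>(n + 2 := \<xi>')) j))\<^sup>2 * \<bar>(\<tau>(n + 1 := \<sigma>)) (k + 1) - (\<tau>(n + 1 := \<sigma>)) k\<bar> powr (2 * H))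
    = (norm ((\<Sum>j\<in>{n+3..m}. \<xi> j) + \<xi>'))\<^sup>2 * \<bar>\<tau> (n + 2) - \<sigma>\<bar> powr (2 * H)
      + (\<Sum>k\<in>{n + 2..<m}. (norm (\<Sum>j\<in>{k+1..m}. \<xi> j))\<^sup>2 * \<bar>\<tau> (k + 1) - \<tau> k\<bar> powr (2 * H))"
    unfolding s using 1 2 by simp
  show ?thesis unfolding lnd_decay_def 3 by (simp add: distrib_left exp_add[symmetric] del: mult_minus_left)
qed

context kernel_process begin

lemma gaussian_rv_increments:
  fixes m :: nat and \<tau> :: "nat \<Rightarrow> real"
  assumes gp: "gaussian_process M {a..b} \<omega>" and \<tau>: "strict_mono_on {1..m} \<tau>" and "\<And>j. j \<in> {1..m} \<Longrightarrow> \<tau> j \<in> {a..b}" and m: "1 \<le> m"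
  shows "gaussian_rv M (\<lambda>w. \<Sum>j\<in>{2..m}. \<xi> j \<bullet> (\<omega> (\<tau> 1) w - \<omega> (\<tau> j) w))"
proof -
  have inj: "inj_on \<tau> {1..m}" 
  proof (rule inj_onI)
    fix i j assume "i \<in> {1..m}" "j \<in> {1..m}" "\<tau> i = \<tau> j"
    then show "i = j" using strict_mono_onD[OF \<tau>, of i j] strict_mono_onD[OF \<tau>, of j i]
      by (cases i j rule: linorder_cases) auto
  qed
  \<comment> \<open>Expanding the increments, every \<open>\<xi> j\<close> also occurs at the first
    time, which therefore collects their sum. \<open>gaussian_process\<close> indexes coefficients
    by times, so \<open>z\<close> transports them along the injective \<open>\<tau>\<close>.\<close>
  define y where "y j = (if j = 1 then (\<Sum>j\<in>{2..m}. \<xi> j) else - \<xi> j)" for j :: nat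
  define z where "z t = y (the_inv_into {1..m} \<tau> t)" for t
  have "gaussian_rv M (\<lambda>w. \<Sum>t\<in>\<tau> ` {1..m}. z t \<bullet> \<omega> t w)"
    using gp assms(3) unfolding gaussian_process_def by blast
  also have "(\<lambda>w. \<Sum>t\<in>\<tau> ` {1..m}. z t \<bullet> \<omega> t w) = (\<lambda>w. \<Sum>j\<in>{2..m}. \<xi> j \<bullet> (\<omega> (\<tau> 1) w - \<omega> (\<tau> j) w))"
  proof
    fix w
    have "(\<Sum>t\<in>\<tau> ` {1..m}. z t \<bullet> \<omega> t w) = (\<Sum>j\<in>{1..m}. y j \<bullet> \<omega> (\<tau> j) w)"
      using inj by (subst sum.reindex) (auto simp: z_def the_inv_into_f_f intro!: sum.cong)
    also have "\<dots> = (\<Sum>j\<in>insert 1 {2..m}. y j \<bullet> \<omega> (\<tau> j) w)"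
      using m by (intro sum.cong) auto
    also have "(\<Sum>j\<in>insert 1 {2..m}. y j \<bullet> \<omega> (\<tau> j) w) = (\<Sum>j\<in>{2..m}. \<xi> j) \<bullet> \<omega> (\<tau> 1) w + (\<Sum>j\<in>{2..m}. y j \<bullet> \<omega> (\<tau> j) w)"
      by (subst sum.insert) (auto simp: y_def)
    also have "(\<Sum>j\<in>{2..m}. y j \<bullet> \<omega> (\<tau> j) w) = (\<Sum>j\<in>{2..m}. - (\<xi> j \<bullet> \<omega> (\<tau> j) w))"
      by (intro sum.cong) (auto simp: y_def)
    finally show "(\<Sum>t\<in>\<tau> ` {1..m}. z t \<bullet> \<omega> t w) = (\<Sum>j\<in>{2..m}. \<xi> j \<bullet> (\<omega> (\<tau> 1) w - \<omega> (\<tau> j) w))"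
      by (simp add: inner_diff_right sum_subtractf inner_sum_left sum_negf)
  qed
  finally show ?thesis .
qed

lemma variance_uminus:
  fixes X :: "'w \<Rightarrow> real"
  shows "variance (\<lambda>w. - X w) = variance X"
proof -
  have "(- X w - expectation (\<lambda>w. - X w))\<^sup>2 = (X w - expectation X)\<^sup>2" for w
    using power2_commute[of "expectation X" "X w"] by simp
  then show ?thesis by simp
qed

context
  fixes a b c H \<delta> :: real and m :: nat
  assumes gp: "gaussian_process M {a..b} \<omega>" and m2: "2 \<le> m"
    and lnd: "\<And>s x. strict_mono_on {1..m} s \<Longrightarrow> a \<le> s 1 \<Longrightarrow> s m \<le> b \<Longrightarrow> \<bar>s m - s 1\<bar> \<le> \<delta> \<Longrightarrow>
      variance (\<lambda>w. \<Sum>k=1..m-1. x k \<bullet> (\<omega> (s (k + 1)) w - \<omega> (s k) w))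
        \<ge> 2 * c * (\<Sum>k=1..m-1. (norm (x k))\<^sup>2 * \<bar>s (k + 1) - s k\<bar> powr (2 * H))"
begin

text \<open>The constant \<open>2 * c\<close> of local nondeterminism absorbs the factor 1/2 in the
  Gaussian characteristic function. The minus sign from \<open>sum_tail_swap\<close> does not affect
  the variance.\<close>

lemma lnd_char_bound:
  fixes \<xi> :: "nat \<Rightarrow> 'a"
  assumes \<tau>: "strict_mono_on {1..m} \<tau>" "a \<le> \<tau> 1" "\<tau> m \<le> b" "\<tau> m - \<tau> 1 \<le> \<delta>"
  shows "norm (\<integral>w. exp (\<i> * of_real (\<Sum>j\<in>{2..m}. \<xi> j \<bullet> (\<omega> (\<tau> 1) w - \<omega> (\<tau> j) w))) \<partial>M) \<le> lnd_decay c H m 1 \<tau> \<xi>"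
proof -
  let ?X = "\<lambda>w. \<Sum>j\<in>{2..m}. \<xi> j \<bullet> (\<omega> (\<tau> 1) w - \<omega> (\<tau> j) w)"
  have mono: "\<tau> i \<le> \<tau> j" if "i \<in> {1..m}" "j \<in> {1..m}" "i \<le> j" for i j
    using strict_mono_on_imp_mono_on[OF \<tau>(1)] that by (auto simp: mono_on_def)
  have in_ab: "\<tau> j \<in> {a..b}" if "j \<in> {1..m}" for j
    using mono[of 1 j] mono[of j m] that \<tau>(2,3) by auto
  have set: "{1..m-1} = {1..<m}" using m2 by auto
  have "norm (\<integral>w. exp (\<i> * of_real (?X w)) \<partial>M) \<le> exp (- variance ?X / 2)"
    by (rule gaussian_char_le[OF gaussian_rv_increments[OF gp \<tau>(1) in_ab]]) (use m2 in auto)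
  also have "variance ?X = variance (\<lambda>w. \<Sum>k=1..m-1. (\<Sum>j\<in>{k+1..m}. \<xi> j) \<bullet> (\<omega> (\<tau> (k + 1)) w - \<omega> (\<tau> k) w))"
  proof -
    have eq: "?X = (\<lambda>w. - (\<Sum>k=1..m-1. (\<Sum>j\<in>{k+1..m}. \<xi> j) \<bullet> (\<omega> (\<tau> (k + 1)) w - \<omega> (\<tau> k) w)))"
      unfolding set by (rule ext, rule sum_tail_swap)
    show ?thesis by (rule trans[OF arg_cong[OF eq, of "\<lambda>X. variance X"] variance_uminus])
  qed
  also have "exp (- variance (\<lambda>w. \<Sum>k=1..m-1. (\<Sum>j\<in>{k+1..m}. \<xi> j) \<bullet> (\<omega> (\<tau> (k + 1)) w - \<omega> (\<tau> k) w)) / 2) 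
      \<le> lnd_decay c H m 1 \<tau> \<xi>"
    unfolding lnd_decay_def using lnd[OF \<tau>(1,2,3), of "\<lambda>k. \<Sum>j\<in>{k+1..m}. \<xi> j"] \<tau>(4) mono[of 1 m] m2
    unfolding set by simp
  finally show ?thesis .
qed

text \<open>Induction on the number \<open>n\<close> of times still hidden in the power of
  \<open>D\<close>. In a step the kernel at the current earliest fixed time becomes a Fourier
  integral, one factor of \<open>D\<close> releases a new time together with its kernel, and the
  hypothesis applies to the enlarged lists; hence \<open>\<tau>\<close> and \<open>\<xi>\<close> are
  generalised. At \<open>n = 0\<close> the last kernel is integrated over \<open>x\<close>. Each
  release costs the current exponent, and these multiply to \<open>fact n\<close>.\<close>

lemma chain_bound:
  fixes \<xi> :: "nat \<Rightarrow> 'a"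
  assumes "a \<le> s" "t \<le> b" "t - s \<le> \<delta>" "t - s \<le> T"
    and "n + 1 \<le> m" "strict_mono_on {n + 1..m} \<tau>" "s \<le> \<tau> (n + 1)" "\<tau> m \<le> t"
  shows "ennreal (norm (\<integral>z. exp (\<i> * of_real (\<Sum>j\<in>{n+2..m}. \<xi> j \<bullet> (fst z - \<omega> (\<tau> j) (snd z)))) *
      (D s (\<tau> (n + 1)) (fst z) (snd z) ^ n * K (fst z - \<omega> (\<tau> (n + 1)) (snd z))) \<partial>N))
    \<le> ennreal (fact n * KL * lnd_decay c H m (n + 1) \<tau> \<xi>) * chain_weight \<theta> c H T n (\<Sum>j\<in>{n+2..m}. \<xi> j)"
  using assms(5-)
proof (induction n arbitrary: \<tau> \<xi>)
  case 0
  have "norm (\<integral>z. exp (\<i> * of_real (\<Sum>j\<in>{2..m}. \<xi> j \<bullet> (fst z - \<omega> (\<tau> j) (snd z)))) * K (fst z - \<omega> (\<tau> 1) (snd z)) \<partial>N)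
    \<le> KL * norm (\<integral>w. exp (\<i> * of_real (\<Sum>j\<in>{2..m}. \<xi> j \<bullet> (\<omega> (\<tau> 1) w - \<omega> (\<tau> j) w))) \<partial>M)"
    by (rule norm_integral_K_le_char)
  also have "\<dots> \<le> KL * lnd_decay c H m 1 \<tau> \<xi>"
    using 0 assms(1-4) by (intro mult_left_mono lnd_char_bound KL_nonneg) auto
  finally show ?case by (simp add: ennreal_leI numeral_2_eq_2)
next
  case (Suc n)
  define \<eta> where "\<eta> = (\<Sum>j\<in>{n+3..m}. \<xi> j)"
  define r where "r = \<tau> (n + 2)"
  have nm: "n + 2 \<le> m" using Suc.prems by simp
  have mono2: "strict_mono_on {n+2..m} \<tau>" using Suc.prems(2) by simp
  have rm: "r \<le> \<tau> m"
    using strict_mono_on_imp_mono_on[OF mono2] nm unfolding r_def by (auto simp: mono_on_def)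
  have sr: "s \<le> r" using Suc.prems(3) by (simp add: r_def)
  define E where "E z = exp (\<i> * of_real (\<Sum>j\<in>{n+3..m}. \<xi> j \<bullet> (fst z - \<omega> (\<tau> j) (snd z))))" for z
  have [measurable]: "E \<in> borel_measurable N" unfolding E_def by measurable
  have E1: "norm (E z) \<le> 1" for z by (simp add: E_def)
  define G where "G = fact n * KL * lnd_decay c H m (n + 2) \<tau> \<xi>"
  have G0: "G \<ge> 0" unfolding G_def lnd_decay_def using KL_nonneg by simp
  have int: "integrable N (\<lambda>z. E z * D s r (fst z) (snd z) ^ Suc n)"
    by (rule Bochner_Integration.integrable_bound[OF integrable_D_power[OF sr, of n]])
       (use E1 in \<open>auto simp: norm_mult intro!: mult_left_le_one_le\<close>)
  have inner: "ennreal (norm (\<integral>z. E z * D s r (fst z) (snd z) ^ Suc n * exp (\<i> * of_real (\<xi>' \<bullet> (fst z - \<omega> r (snd z)))) \<partial>N))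
    \<le> ennreal (Suc n) * (ennreal G * (Theta c H T (\<eta> + \<xi>') * chain_weight \<theta> c H T n (\<eta> + \<xi>')))" for \<xi>'
  proof -
    define E' where "E' z = exp (\<i> * of_real (\<Sum>j\<in>{n+2..m}. (\<xi>(n + 2 := \<xi>')) j \<bullet> (fst z - \<omega> (\<tau> j) (snd z))))" for z
    have set: "{n+2..m} = insert (n + 2) {n+3..m}" using nm by auto
    have sumeq: "(\<Sum>j\<in>{n+2..m}. (\<xi>(n + 2 := \<xi>')) j) = \<eta> + \<xi>'"
      unfolding set \<eta>_def by (simp add: add.commute)
    have "E' z = E z * exp (\<i> * of_real (\<xi>' \<bullet> (fst z - \<omega> r (snd z))))" for z
    proof -
      have "(\<Sum>j\<in>{n+2..m}. (\<xi>(n + 2 := \<xi>')) j \<bullet> (fst z - \<omega> (\<tau> j) (snd z))) 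
        = (\<Sum>j\<in>{n+3..m}. \<xi> j \<bullet> (fst z - \<omega> (\<tau> j) (snd z))) + \<xi>' \<bullet> (fst z - \<omega> r (snd z))"
        unfolding set r_def by (simp add: add.commute)
      then show ?thesis unfolding E'_def E_def by (simp only: of_real_add distrib_left exp_add)
    qed
    then have "(\<integral>z. E z * D s r (fst z) (snd z) ^ Suc n * exp (\<i> * of_real (\<xi>' \<bullet> (fst z - \<omega> r (snd z)))) \<partial>N)
      = (\<integral>z. E' z * D s r (fst z) (snd z) ^ Suc n \<partial>N)" by (simp add: mult_ac)
    also have "ennreal (norm \<dots>) \<le> ennreal (Suc n) * (\<integral>\<^sup>+\<sigma>. indicator {s..<r} \<sigma> *
      ennreal (norm (\<integral>z. E' z * (D s \<sigma> (fst z) (snd z) ^ n * K (fst z - \<omega> \<sigma> (snd z))) \<partial>N)) \<partial>lborel)"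
      by (rule norm_integral_D_power_le) (auto simp: E'_def sr)
    also have "\<dots> \<le> ennreal (Suc n) * (\<integral>\<^sup>+\<sigma>. (indicator {s..<r} \<sigma> * ennreal (exp (- c * ((norm (\<eta> + \<xi>'))\<^sup>2 * \<bar>r - \<sigma>\<bar> powr (2 * H)))))
        * (ennreal G * chain_weight \<theta> c H T n (\<eta> + \<xi>')) \<partial>lborel)"
    proof (intro mult_left_mono nn_integral_mono)
      fix \<sigma> :: real
      show "indicator {s..<r} \<sigma> * ennreal (norm (\<integral>z. E' z * (D s \<sigma> (fst z) (snd z) ^ n * K (fst z - \<omega> \<sigma> (snd z))) \<partial>N))
        \<le> indicator {s..<r} \<sigma> * ennreal (exp (- c * ((norm (\<eta> + \<xi>'))\<^sup>2 * \<bar>r - \<sigma>\<bar> powr (2 * H)))) * (ennreal G * chain_weight \<theta> c H T n (\<eta> + \<xi>'))"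
      proof (cases "\<sigma> \<in> {s..<r}")
        case True
        \<comment> \<open>The new time takes slot \<open>n + 1\<close>. The new frequency takes slot
          \<open>n + 2\<close>, because it belongs to the kernel at the previously earliest
          time.\<close>
        let ?\<tau> = "\<tau>(n + 1 := \<sigma>)" and ?\<xi> = "\<xi>(n + 2 := \<xi>')"
        have "strict_mono_on {n + 1..m} ?\<tau>"
        proof (rule strict_mono_onI)
          fix i j assume ij: "i \<in> {n + 1..m}" "j \<in> {n + 1..m}" "i < j"
          have "r \<le> \<tau> j" using strict_mono_on_imp_mono_on[OF mono2] ij nm unfolding r_def by (auto simp: mono_on_def)
          then show "?\<tau> i < ?\<tau> j"
            using ij True strict_mono_onD[OF mono2, of i j] by (cases "i = n + 1") auto
        qed
        then have sm: "strict_mono_on {n + 1..m} ?\<tau>" .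
        have IH: "ennreal (norm (\<integral>z. exp (\<i> * of_real (\<Sum>j\<in>{n+2..m}. ?\<xi> j \<bullet> (fst z - \<omega> (?\<tau> j) (snd z)))) *
          (D s (?\<tau> (n + 1)) (fst z) (snd z) ^ n * K (fst z - \<omega> (?\<tau> (n + 1)) (snd z))) \<partial>N))
          \<le> ennreal (fact n * KL * lnd_decay c H m (n + 1) ?\<tau> ?\<xi>) * chain_weight \<theta> c H T n (\<Sum>j\<in>{n+2..m}. ?\<xi> j)"
        proof (rule Suc.IH)
          show "strict_mono_on {n + 1..m} ?\<tau>" by (rule sm)
          show "n + 1 \<le> m" "s \<le> ?\<tau> (n + 1)" "?\<tau> m \<le> t" using nm True Suc.prems(4) by auto
        qed
        have "(\<Sum>j\<in>{n+2..m}. ?\<xi> j \<bullet> (fst z - \<omega> (?\<tau> j) (snd z))) = (\<Sum>j\<in>{n+2..m}. ?\<xi> j \<bullet> (fst z - \<omega> (\<tau> j) (snd z)))" for z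
          by (intro sum.cong) auto
        then have "ennreal (norm (\<integral>z. E' z * (D s \<sigma> (fst z) (snd z) ^ n * K (fst z - \<omega> \<sigma> (snd z))) \<partial>N))
          \<le> ennreal (fact n * KL * lnd_decay c H m (n + 1) ?\<tau> ?\<xi>) * chain_weight \<theta> c H T n (\<eta> + \<xi>')"
          using IH unfolding sumeq E'_def by simp
        also have "fact n * KL * lnd_decay c H m (n + 1) ?\<tau> ?\<xi> = exp (- c * ((norm (\<eta> + \<xi>'))\<^sup>2 * \<bar>r - \<sigma>\<bar> powr (2 * H))) * G"
          unfolding lnd_decay_step[OF nm] G_def \<eta>_def r_def by (simp only: mult_ac)
        also have "ennreal \<dots> = ennreal (exp (- c * ((norm (\<eta> + \<xi>'))\<^sup>2 * \<bar>r - \<sigma>\<bar> powr (2 * H)))) * ennreal G"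
          by (rule ennreal_mult) (auto simp: G0)
        finally show ?thesis using True by (simp add: mult.assoc)
      qed simp
    qed auto
    also have "\<dots> = ennreal (Suc n) * ((\<integral>\<^sup>+\<sigma>. (indicator {s..<r} \<sigma> * ennreal (exp (- c * ((norm (\<eta> + \<xi>'))\<^sup>2 * \<bar>r - \<sigma>\<bar> powr (2 * H))))) \<partial>lborel)
        * (ennreal G * chain_weight \<theta> c H T n (\<eta> + \<xi>')))"
      by (subst nn_integral_multc) auto
    also have "\<dots> \<le> ennreal (Suc n) * (Theta c H T (\<eta> + \<xi>') * (ennreal G * chain_weight \<theta> c H T n (\<eta> + \<xi>')))"
      using sr rm Suc.prems(4) assms(4) by (intro mult_left_mono mult_right_mono nn_integral_reflect_Theta) auto
    finally show ?thesis by (simp only: mult_ac)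
  qed
  have "ennreal (norm (\<integral>z. (E z * D s r (fst z) (snd z) ^ Suc n) * K (fst z - \<omega> r (snd z)) \<partial>N)) \<le>
    (\<integral>\<^sup>+\<xi>'. ennreal (\<theta> \<xi>') *
      ennreal (norm (\<integral>z. E z * D s r (fst z) (snd z) ^ Suc n * exp (\<i> * of_real (\<xi>' \<bullet> (fst z - \<omega> r (snd z)))) \<partial>N)) \<partial>lborel)"
    by (rule norm_integral_fourier_le[OF int])
  also have "\<dots> \<le> (\<integral>\<^sup>+\<xi>'. ennreal (\<theta> \<xi>') * (ennreal (Suc n) * (ennreal G * (Theta c H T (\<eta> + \<xi>') * chain_weight \<theta> c H T n (\<eta> + \<xi>')))) \<partial>lborel)"
    by (intro nn_integral_mono mult_left_mono inner) auto
  also have "\<dots> = (\<integral>\<^sup>+\<xi>'. (ennreal (Suc n) * ennreal G) * (ennreal (\<theta> \<xi>') * (Theta c H T (\<eta> + \<xi>') * chain_weight \<theta> c H T n (\<eta> + \<xi>'))) \<partial>lborel)"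
    by (simp only: mult_ac)
  also have "\<dots> = (ennreal (Suc n) * ennreal G) * chain_weight \<theta> c H T (Suc n) \<eta>"
    by (subst nn_integral_cmult) auto
  also have "ennreal (Suc n) * ennreal G = ennreal (fact (Suc n) * KL * lnd_decay c H m (n + 2) \<tau> \<xi>)"
    using G0 by (subst ennreal_mult[symmetric]) (auto simp: G_def mult_ac)
  finally show ?case
    unfolding E_def \<eta>_def r_def by (simp add: mult.assoc numeral_3_eq_3 numeral_2_eq_2 del: power_Suc fact_Suc chain_weight.simps)
qed

text \<open>The latest time is released before any frequency exists: the chain starts with empty
  sums, total frequency 0 and decay factor 1. Integrating over this time contributes
  \<open>t - s\<close>.\<close>

lemma moment_chain_bound:
  assumes "a \<le> s" "s \<le> t" "t \<le> b" "t - s \<le> \<delta>" "m = Suc n"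
  shows "ennreal (norm (\<integral>z. D s t (fst z) (snd z) ^ m \<partial>N))
    \<le> ennreal (fact m * KL * (t - s)) * chain_weight \<theta> c H (t - s) n 0"
proof -
  have "ennreal (norm (\<integral>z. 1 * D s t (fst z) (snd z) ^ Suc n \<partial>N)) \<le> ennreal (Suc n) *
    (\<integral>\<^sup>+\<sigma>. indicator {s..<t} \<sigma> *
      ennreal (norm (\<integral>z. 1 * (D s \<sigma> (fst z) (snd z) ^ n * K (fst z - \<omega> \<sigma> (snd z))) \<partial>N)) \<partial>lborel)"
    by (rule norm_integral_D_power_le) (use assms in auto)
  also have "\<dots> \<le> ennreal (Suc n) * (\<integral>\<^sup>+\<sigma>. indicator {s..<t} \<sigma> * (ennreal (fact n * KL) * chain_weight \<theta> c H (t - s) n 0) \<partial>lborel)"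
  proof (rule mult_left_mono, rule nn_integral_mono)
    fix \<sigma> :: real
    show "indicator {s..<t} \<sigma> * ennreal (norm (\<integral>z. 1 * (D s \<sigma> (fst z) (snd z) ^ n * K (fst z - \<omega> \<sigma> (snd z))) \<partial>N))
      \<le> indicator {s..<t} \<sigma> * (ennreal (fact n * KL) * chain_weight \<theta> c H (t - s) n 0)"
    proof (cases "\<sigma> \<in> {s..<t}")
      case True
      then show ?thesis
        using chain_bound[of s t "t - s" n "\<lambda>_. \<sigma>" "\<lambda>_. 0"] assms
        by (auto simp: lnd_decay_def intro!: strict_mono_onI)
    qed simp
  qed auto
  also have "\<dots> = ennreal (Suc n) * (emeasure lborel {s..<t} * (ennreal (fact n * KL) * chain_weight \<theta> c H (t - s) n 0))"
    by (subst nn_integral_multc) auto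
  also have "emeasure lborel {s..<t} = ennreal (t - s)" using assms by simp
  also have "ennreal (Suc n) * (ennreal (t - s) * (ennreal (fact n * KL) * chain_weight \<theta> c H (t - s) n 0))
    = ennreal (fact m * KL * (t - s)) * chain_weight \<theta> c H (t - s) n 0"
    using assms KL_nonneg by (simp add: ennreal_mult mult_ac del: of_nat_Suc)
  finally show ?thesis using assms(5) by simp
qed

end

end

section \<open>Bounds for one gap and for the chain of frequencies\<close>

text \<open>Apply z \<le> exp z to z = y / \<kappa> and raise to the power \<kappa>. This trades the
  exponential for any chosen negative power.\<close>

lemma exp_minus_le_powr:
  fixes \<kappa> y :: real
  assumes "\<kappa> > 0" "y > 0"
  shows "exp (- y) \<le> \<kappa> powr \<kappa> * y powr (- \<kappa>)"
proof -
  have "y / \<kappa> \<le> exp (y / \<kappa>)" using exp_ge_add_one_self[of "y / \<kappa>"] by linarith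
  then have "y \<le> \<kappa> * exp (y / \<kappa>)" using assms by (simp add: field_simps)
  then have "y powr \<kappa> \<le> (\<kappa> * exp (y / \<kappa>)) powr \<kappa>" using assms by (intro powr_mono2) auto
  also have "\<dots> = \<kappa> powr \<kappa> * exp y" using assms by (simp add: powr_mult exp_powr_real)
  finally have "y powr \<kappa> * exp (- y) \<le> \<kappa> powr \<kappa>" by (simp add: exp_minus field_simps)
  then show ?thesis using assms by (simp add: powr_minus field_simps)
qed

lemma nn_integral_powr_Icc:
  assumes "v < 1" "0 \<le> T"
  shows "(\<integral>\<^sup>+u. indicator {0..T} u * ennreal (u powr (- v)) \<partial>lborel) = ennreal (T powr (1 - v) / (1 - v))"
proof -
  have "((\<lambda>u. u powr (- v)) has_integral (T powr (- v + 1) / (- v + 1))) {0..T}"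
    using assms by (intro has_integral_powr_from_0) auto
  then have "(\<integral>\<^sup>+u. ennreal (indicator {0..T} u * u powr (- v)) \<partial>lborel) = ennreal (T powr (- v + 1) / (- v + 1))"
    using nn_integral_has_integral_lebesgue[of "{0..T}" "\<lambda>u. u powr (- v)"] by simp
  moreover have "ennreal (indicator {0..T} u * u powr (- v)) = indicator {0..T} u * ennreal (u powr (- v))" for u :: real
    by (auto simp: indicator_def)
  ultimately show ?thesis by (simp add: add.commute)
qed

text \<open>The exponential is exchanged for the power \<kappa> = v / (2H) of its argument, which
  gives |\<eta>|^(-v/H) at the price of u^(-v). The latter is integrable at 0 because v < 1.\<close>

lemma Theta_le_powr:
  fixes \<eta> :: "'a::euclidean_space"
  assumes "0 < v" "v < 1" "0 < H" "0 < c" "0 \<le> T" "0 < r" "r \<le> norm \<eta>"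
  defines "\<kappa> \<equiv> v / (2 * H)"
  shows "Theta c H T \<eta> \<le> ennreal (\<kappa> powr \<kappa> * c powr (- \<kappa>) / (1 - v) * r powr (- (v / H)) * T powr (1 - v))"
proof -
  have k: "\<kappa> > 0" using assms by (simp add: \<kappa>_def)
  let ?A = "\<kappa> powr \<kappa> * c powr (- \<kappa>) * r powr (- (v / H))"
  have *: "exp (- c * ((norm \<eta>)\<^sup>2 * u powr (2 * H))) \<le> ?A * u powr (- v)" if "u > 0" for u
  proof -
    have "norm \<eta> > 0" using assms(6,7) by linarith
    then have y: "c * ((norm \<eta>)\<^sup>2 * u powr (2 * H)) > 0" using assms(4) that by (intro mult_pos_pos) auto
    have "exp (- c * ((norm \<eta>)\<^sup>2 * u powr (2 * H))) \<le> \<kappa> powr \<kappa> * (c * ((norm \<eta>)\<^sup>2 * u powr (2 * H))) powr (- \<kappa>)"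
      using exp_minus_le_powr[OF k y] by simp
    also have "(c * ((norm \<eta>)\<^sup>2 * u powr (2 * H))) powr (- \<kappa>) = c powr (- \<kappa>) * (((norm \<eta>)\<^sup>2) powr (- \<kappa>) * (u powr (2 * H)) powr (- \<kappa>))"
      using assms that by (simp add: powr_mult)
    also have "((norm \<eta>)\<^sup>2) powr (- \<kappa>) = norm \<eta> powr (- (v / H))"
      using assms by (simp add: powr_powr \<kappa>_def flip: powr_numeral)
    also have "(u powr (2 * H)) powr (- \<kappa>) = u powr (- v)"
      using assms by (simp add: powr_powr \<kappa>_def)
    also have "\<kappa> powr \<kappa> * (c powr (- \<kappa>) * (norm \<eta> powr (- (v / H)) * u powr (- v))) \<le> \<kappa> powr \<kappa> * (c powr (- \<kappa>) * (r powr (- (v / H)) * u powr (- v)))"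
      using assms by (intro mult_left_mono mult_right_mono powr_mono2') auto
    finally show ?thesis by (simp add: mult_ac)
  qed
  have "Theta c H T \<eta> \<le> (\<integral>\<^sup>+u. ennreal ?A * (indicator {0..T} u * ennreal (u powr (- v))) \<partial>lborel)"
    unfolding Theta_def
  proof (rule nn_integral_mono_AE)
    have "AE u in lborel. u \<noteq> (0::real)" by (rule AE_lborel_singleton)
    then show "AE u in lborel. indicator {0..T} u * ennreal (exp (- c * ((norm \<eta>)\<^sup>2 * u powr (2 * H))))
      \<le> ennreal ?A * (indicator {0..T} u * ennreal (u powr (- v)))"
    proof eventually_elim
      case (elim u)
      then show ?case using *[of u] by (auto simp: indicator_def ennreal_mult'[symmetric] intro!: ennreal_leI)
    qed
  qed
  also have "\<dots> = ennreal ?A * ennreal (T powr (1 - v) / (1 - v))"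
    using assms by (subst nn_integral_cmult) (auto simp: nn_integral_powr_Icc)
  also have "\<dots> = ennreal (\<kappa> powr \<kappa> * c powr (- \<kappa>) / (1 - v) * r powr (- (v / H)) * T powr (1 - v))"
    using assms by (subst ennreal_mult[symmetric]) auto
  finally show ?thesis .
qed

lemma nn_integral_gauss_finite:
  assumes "c > 0"
  shows "(\<integral>\<^sup>+\<zeta>. ennreal (exp (- c * (norm \<zeta>)\<^sup>2)) \<partial>(lborel :: 'a::euclidean_space measure)) < \<infinity>"
proof -
  \<comment> \<open>Chosen so that 1 + y^2 \<le> A(1 + c y^2): the entry 1 serves the constant term,
    1/c the quadratic one.\<close>
  define A where "A = max 1 (1 / c)"
  have A: "exp (- c * y\<^sup>2) \<le> A * inverse (1 + y\<^sup>2)" for y :: real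
  proof -
    have "1 + y\<^sup>2 \<le> A * (1 + c * y\<^sup>2)"
    proof -
      have "1 * y\<^sup>2 \<le> (A * c) * y\<^sup>2" using assms by (intro mult_right_mono) (auto simp: A_def max_def field_simps)
      then show ?thesis unfolding distrib_left by (auto simp: A_def)
    qed
    also have "\<dots> \<le> A * exp (c * y\<^sup>2)"
      using exp_ge_add_one_self[of "c * y\<^sup>2"] by (intro mult_left_mono) (auto simp: A_def)
    finally show ?thesis using add_pos_nonneg[of 1 "y\<^sup>2"] by (simp add: exp_minus field_simps)
  qed
  have "(\<integral>\<^sup>+\<zeta>. ennreal (exp (- c * (norm \<zeta>)\<^sup>2)) \<partial>(lborel :: 'a measure))
     \<le> (\<integral>\<^sup>+\<zeta>. ennreal (A ^ DIM('a)) * ennreal (\<Prod>b\<in>(Basis::'a set). inverse (1 + (\<zeta> \<bullet> b)\<^sup>2)) \<partial>lborel)"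
  proof (rule nn_integral_mono)
    fix \<zeta> :: 'a
    have "exp (- c * (norm \<zeta>)\<^sup>2) = (\<Prod>b\<in>(Basis::'a set). exp (- c * (\<zeta> \<bullet> b)\<^sup>2))"
    proof -
      have "(norm \<zeta>)\<^sup>2 = (\<Sum>b\<in>(Basis::'a set). (\<zeta> \<bullet> b)\<^sup>2)"
        unfolding power2_norm_eq_inner by (subst euclidean_inner) (simp add: power2_eq_square)
      then show ?thesis by (simp add: exp_sum[symmetric] sum_distrib_left sum_negf)
    qed
    also have "\<dots> \<le> (\<Prod>b\<in>(Basis::'a set). A * inverse (1 + (\<zeta> \<bullet> b)\<^sup>2))"
      using A by (intro prod_mono) auto
    also have "\<dots> = A ^ DIM('a) * (\<Prod>b\<in>(Basis::'a set). inverse (1 + (\<zeta> \<bullet> b)\<^sup>2))" by (simp add: prod.distrib)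
    finally show "ennreal (exp (- c * (norm \<zeta>)\<^sup>2)) \<le> ennreal (A ^ DIM('a)) * ennreal (\<Prod>b\<in>(Basis::'a set). inverse (1 + (\<zeta> \<bullet> b)\<^sup>2))"
      by (subst ennreal_mult[symmetric]) (auto simp: A_def intro!: ennreal_leI prod_nonneg)
  qed
  also have "\<dots> = ennreal (A ^ DIM('a)) * (\<integral>\<^sup>+\<zeta>. ennreal (\<Prod>b\<in>(Basis::'a set). inverse (1 + (\<zeta> \<bullet> b)\<^sup>2)) \<partial>lborel)"
    by (rule nn_integral_cmult) auto
  also have "\<dots> < \<infinity>" using nn_integral_prod_inverse_finite[where ?'a='a] by (simp add: ennreal_mult_less_top)
  finally show ?thesis .
qed

text \<open>Integrating over the frequency first and rescaling by u^(-H) turns the inner integral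
  into u^(-Hd) times a fixed Gaussian integral; Hd < 1 makes this integrable in u. No power of the
  frequency is gained, but no restriction on its range is needed either.\<close>

lemma nn_integral_Theta:
  fixes H c T :: real
  assumes "0 < H" "H * DIM('a) < 1" "0 < c" "0 \<le> T"
  shows "(\<integral>\<^sup>+\<eta>. Theta c H T \<eta> \<partial>(lborel :: 'a::euclidean_space measure)) \<le>
    ennreal (enn2real (\<integral>\<^sup>+\<zeta>. ennreal (exp (- c * (norm \<zeta>)\<^sup>2)) \<partial>(lborel :: 'a measure)) / (1 - H * DIM('a)) * T powr (1 - H * DIM('a)))"
proof -
  define I where "I = (\<integral>\<^sup>+\<zeta>. ennreal (exp (- c * (norm \<zeta>)\<^sup>2)) \<partial>(lborel :: 'a measure))"
  have eq: "indicator {0..T} u = (if 0 \<le> u \<and> u \<le> T then 1 else 0::ennreal)" for u :: real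
    by (auto simp: indicator_def)
  have "(\<integral>\<^sup>+\<eta>. Theta c H T \<eta> \<partial>(lborel :: 'a measure)) =
    (\<integral>\<^sup>+u. \<integral>\<^sup>+\<eta>. indicator {0..T} u * ennreal (exp (- c * ((norm \<eta>)\<^sup>2 * u powr (2 * H)))) \<partial>(lborel :: 'a measure) \<partial>lborel)"
    unfolding Theta_def by (rule lborel_pair.Fubini') (unfold eq, measurable)
  also have "\<dots> \<le> (\<integral>\<^sup>+u. I * (indicator {0..T} u * ennreal (u powr (- (H * DIM('a))))) \<partial>lborel)"
  proof (rule nn_integral_mono_AE)
    have "AE u in lborel. u \<noteq> (0::real)" by (rule AE_lborel_singleton)
    then show "AE u in lborel. (\<integral>\<^sup>+\<eta>. indicator {0..T} u * ennreal (exp (- c * ((norm \<eta>)\<^sup>2 * u powr (2 * H)))) \<partial>(lborel :: 'a measure))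
      \<le> I * (indicator {0..T} u * ennreal (u powr (- (H * DIM('a)))))"
    proof eventually_elim
      case (elim u)
      show ?case
      proof (cases "u \<in> {0..T}")
        case True
        with elim have u: "u > 0" by simp
        define s where "s = u powr (- H)"
        have s: "s > 0" using u by (simp add: s_def)
        have "(norm (s *\<^sub>R \<zeta>))\<^sup>2 * u powr (2 * H) = (norm \<zeta>)\<^sup>2" for \<zeta> :: 'a
        proof -
          have "s\<^sup>2 * u powr (2 * H) = 1"
            using u by (simp add: s_def powr_power powr_add[symmetric])
          then show ?thesis using s by (simp add: power_mult_distrib mult_ac)
        qed
        then have "(\<integral>\<^sup>+\<eta>. ennreal (exp (- c * ((norm \<eta>)\<^sup>2 * u powr (2 * H)))) \<partial>(lborel :: 'a measure)) = ennreal (\<bar>s\<bar> ^ DIM('a)) * I"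
          unfolding I_def using s by (subst nn_integral_scaleR[where c=s]) auto
        also have "\<bar>s\<bar> ^ DIM('a) = u powr (- (H * DIM('a)))"
          using u s unfolding s_def by (simp add: powr_power mult.commute)
        finally show ?thesis using True by (simp add: mult.commute)
      qed simp
    qed
  qed
  also have "\<dots> = I * ennreal (T powr (1 - H * DIM('a)) / (1 - H * DIM('a)))"
    using assms by (subst nn_integral_cmult) (auto simp: nn_integral_powr_Icc)
  also have "I = ennreal (enn2real I)"
    using nn_integral_gauss_finite[OF assms(3), where ?'a='a] by (simp add: I_def less_top[symmetric])
  also have "\<dots> * ennreal (T powr (1 - H * DIM('a)) / (1 - H * DIM('a))) = ennreal (enn2real I / (1 - H * DIM('a)) * T powr (1 - H * DIM('a)))"
    using assms by (subst ennreal_mult'[symmetric]) auto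
  finally show ?thesis by (simp add: I_def)
qed

text \<open>Every frequency has norm at least \<open>2r\<close>, so the step after a partial sum of norm at most \<open>r\<close> always
  gives the small factor \<open>V * A\<close>.\<close>

lemma chain_weight_le:
  fixes \<theta> :: "'a::euclidean_space \<Rightarrow> real"
  assumes [measurable]: "\<theta> \<in> borel_measurable borel"
    and \<theta>01: "\<And>\<xi>. 0 \<le> \<theta> \<xi>" "\<And>\<xi>. \<theta> \<xi> \<le> 1"
    and supp: "\<And>\<xi>. \<theta> \<xi> \<noteq> 0 \<Longrightarrow> 2 * r \<le> norm \<xi>"
    and V: "(\<integral>\<^sup>+\<xi>. ennreal (\<theta> \<xi>) \<partial>lborel) \<le> ennreal V" "0 \<le> V"
    and A: "\<And>\<eta>::'a. r \<le> norm \<eta> \<Longrightarrow> Theta c H T \<eta> \<le> ennreal A" "0 \<le> A"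
    and G: "(\<integral>\<^sup>+\<eta>. Theta c H T \<eta> \<partial>(lborel :: 'a measure)) \<le> ennreal G"
    and BG: "V * A \<le> G" and r: "0 \<le> r"
  shows "chain_weight \<theta> c H T (2 * i + 1) 0 \<le> ennreal (9 ^ i * (V * A) * (G * (V * A)) ^ i)"
proof -
  define B where "B = V * A"
  have B0: "0 \<le> B" and G0: "0 \<le> G" and BG': "B \<le> G"
    using V(2) A(2) BG by (auto simp: B_def intro: order_trans[OF mult_nonneg_nonneg])
  \<comment> \<open>The bound up to a combinatorial factor 3^n: each pair of steps earns
    \<open>G * B\<close>, a leftover step only \<open>G\<close>.\<close>
  define g where "g n = (if even n then (G * B) ^ (n div 2) else G * (G * B) ^ (n div 2))" for n :: nat
  have g0: "0 \<le> g n" for n using B0 G0 by (simp add: g_def)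
  have gSS: "g (Suc (Suc n)) = G * B * g n" for n by (simp add: g_def)
  have gS: "B * g (Suc n) \<le> G * B * g n" for n
  proof (cases "even n")
    case True
    then show ?thesis by (simp add: g_def mult_ac)
  next
    case False
    then obtain j where j: "n = 2 * j + 1" by (elim oddE)
    have "B * (B * (G * (G * B) ^ j)) \<le> G * (B * (G * (G * B) ^ j))"
      using B0 G0 BG' by (intro mult_right_mono) auto
    then show ?thesis by (simp add: g_def j mult_ac)
  qed
  let ?W = "chain_weight \<theta> c H T"
  \<comment> \<open>A partial sum of norm at most \<open>r\<close> plus a frequency of norm at least
    \<open>2 * r\<close> has norm at least \<open>r\<close>, so the next step is good whatever the
    frequency.\<close>
  have big: "(\<integral>\<^sup>+\<xi>. ennreal (\<theta> \<xi>) * (Theta c H T (\<eta> + \<xi>) * ?W n (\<eta> + \<xi>)) \<partial>lborel) \<le> ennreal (B * f)"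
    if "norm \<eta> \<le> r" "\<And>\<eta>. ?W n \<eta> \<le> ennreal f" "0 \<le> f" for \<eta> n f
  proof -
    have "(\<integral>\<^sup>+\<xi>. ennreal (\<theta> \<xi>) * (Theta c H T (\<eta> + \<xi>) * ?W n (\<eta> + \<xi>)) \<partial>lborel) 
      \<le> (\<integral>\<^sup>+\<xi>. ennreal (\<theta> \<xi>) * (ennreal A * ennreal f) \<partial>lborel)"
    proof (rule nn_integral_mono)
      fix \<xi>
      show "ennreal (\<theta> \<xi>) * (Theta c H T (\<eta> + \<xi>) * ?W n (\<eta> + \<xi>)) \<le> ennreal (\<theta> \<xi>) * (ennreal A * ennreal f)"
      proof (cases "\<theta> \<xi> = 0")
        case False
        then have "r \<le> norm (\<eta> + \<xi>)" using supp[OF False] that(1) norm_diff_ineq[of \<xi> \<eta>] by (simp add: add.commute)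
        then show ?thesis by (intro mult_left_mono mult_mono A(1) that(2)) auto
      qed simp
    qed
    also have "\<dots> = (\<integral>\<^sup>+\<xi>. ennreal (\<theta> \<xi>) \<partial>lborel) * (ennreal A * ennreal f)"
      by (rule nn_integral_multc) auto
    also have "\<dots> \<le> ennreal V * (ennreal A * ennreal f)"
      by (intro mult_right_mono V) auto
    also have "\<dots> = ennreal (B * f)"
      using V A that(3) by (simp add: B_def ennreal_mult mult_ac)
    finally show ?thesis .
  qed
  \<comment> \<open>From an arbitrary partial sum the next one is either large, with factor
    \<open>B\<close>, or small. In the small case \<open>Theta\<close> is integrated freely and
    gives \<open>G\<close>, but the rest of the chain then satisfies the better bound
    \<open>f2\<close>.\<close>
  have gen: "(\<integral>\<^sup>+\<xi>. ennreal (\<theta> \<xi>) * (Theta c H T (\<eta> + \<xi>) * ?W n (\<eta> + \<xi>)) \<partial>lborel) \<le> ennreal (B * f1 + G * f2)"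
    if f: "\<And>\<eta>. ?W n \<eta> \<le> ennreal f1" "\<And>\<eta>. norm \<eta> \<le> r \<Longrightarrow> ?W n \<eta> \<le> ennreal f2" "0 \<le> f1" "0 \<le> f2" for \<eta> n f1 f2
  proof -
    have "(\<integral>\<^sup>+\<xi>. ennreal (\<theta> \<xi>) * (Theta c H T (\<eta> + \<xi>) * ?W n (\<eta> + \<xi>)) \<partial>lborel) 
      \<le> (\<integral>\<^sup>+\<xi>. ennreal (\<theta> \<xi>) * (ennreal A * ennreal f1) + Theta c H T (\<eta> + \<xi>) * ennreal f2 \<partial>lborel)"
    proof (rule nn_integral_mono)
      fix \<xi>
      show "ennreal (\<theta> \<xi>) * (Theta c H T (\<eta> + \<xi>) * ?W n (\<eta> + \<xi>)) 
        \<le> ennreal (\<theta> \<xi>) * (ennreal A * ennreal f1) + Theta c H T (\<eta> + \<xi>) * ennreal f2"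
      proof (cases "r \<le> norm (\<eta> + \<xi>)")
        case True
        have "ennreal (\<theta> \<xi>) * (Theta c H T (\<eta> + \<xi>) * ?W n (\<eta> + \<xi>)) \<le> ennreal (\<theta> \<xi>) * (ennreal A * ennreal f1)"
          using True by (intro mult_left_mono mult_mono A(1) f) auto
        then show ?thesis by (rule add_increasing2[rotated]) simp
      next
        case False
        have "ennreal (\<theta> \<xi>) * (Theta c H T (\<eta> + \<xi>) * ?W n (\<eta> + \<xi>)) \<le> 1 * (Theta c H T (\<eta> + \<xi>) * ennreal f2)"
          using False \<theta>01[of \<xi>] by (intro mult_mono f) (auto simp: ennreal_le_1)
        then show ?thesis by (intro add_increasing) auto
      qed
    qed
    also have "\<dots> = (\<integral>\<^sup>+\<xi>. ennreal (\<theta> \<xi>) \<partial>lborel) * (ennreal A * ennreal f1) + (\<integral>\<^sup>+\<xi>. Theta c H T (\<eta> + \<xi>) \<partial>lborel) * ennreal f2"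
      by (simp add: nn_integral_add nn_integral_multc)
    also have "(\<integral>\<^sup>+\<xi>. Theta c H T (\<eta> + \<xi>) \<partial>lborel) = (\<integral>\<^sup>+\<xi>. Theta c H T \<xi> \<partial>(lborel :: 'a measure))"
      using nn_integral_shift[of "Theta c H T" \<eta>] by (simp add: add.commute)
    also have "(\<integral>\<^sup>+\<xi>. ennreal (\<theta> \<xi>) \<partial>lborel) * (ennreal A * ennreal f1) + (\<integral>\<^sup>+\<xi>. Theta c H T \<xi> \<partial>(lborel :: 'a measure)) * ennreal f2
      \<le> ennreal V * (ennreal A * ennreal f1) + ennreal G * ennreal f2"
      by (intro add_mono mult_right_mono V G) auto
    also have "\<dots> = ennreal (B * f1 + G * f2)"
      using V A G0 f B0 by (simp add: B_def ennreal_mult mult_ac)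
    finally show ?thesis .
  qed
  have small: "?W (Suc n) \<eta> \<le> ennreal (B * (3 ^ n * g n))" if "norm \<eta> \<le> r" "\<And>\<eta>. ?W n \<eta> \<le> ennreal (3 ^ n * g n)" for n \<eta>
    using big[OF that] g0[of n] by simp
  have all: "?W n \<eta> \<le> ennreal (3 ^ n * g n)" for n \<eta>
  proof (induction n arbitrary: \<eta> rule: less_induct)
    case (less n)
    consider "n = 0" | "n = 1" | k where "n = Suc (Suc k)" by (metis One_nat_def not0_implies_Suc)
    then show ?case
    proof cases
      case 1 then show ?thesis by (simp add: g_def)
    next
      case 2
      have "?W 1 \<eta> \<le> ennreal (B * 1 + G * 1)" using gen[of 0 1 1 \<eta>] by simp
      also have "\<dots> \<le> ennreal (3 * G)" using BG' G0 by (intro ennreal_leI) simp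
      finally show ?thesis using 2 by (simp add: g_def)
    next
      case 3
      have "?W n \<eta> \<le> ennreal (B * (3 ^ Suc k * g (Suc k)) + G * (B * (3 ^ k * g k)))"
        unfolding 3 using gen[of "Suc k" "3 ^ Suc k * g (Suc k)" "B * (3 ^ k * g k)" \<eta>] less.IH[of "Suc k"] small[of _ k] less.IH[of k] 3 g0 B0
        by (simp del: power_Suc)
      also have "\<dots> \<le> ennreal (3 ^ n * g n)"
      proof (rule ennreal_leI)
        have "3 ^ Suc k * (B * g (Suc k)) \<le> 3 ^ Suc k * (G * B * g k)" by (intro mult_left_mono gS) auto
        moreover have "0 \<le> 3 ^ k * (G * B * g k)" using G0 B0 g0 by simp
        ultimately show "B * (3 ^ Suc k * g (Suc k)) + G * (B * (3 ^ k * g k)) \<le> 3 ^ n * g n"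
          unfolding 3 gSS by (simp add: algebra_simps)
      qed
      finally show ?thesis .
    qed
  qed
  \<comment> \<open>The chain starts at 0, which is small. So among \<open>2 * i + 1\<close> steps
    the bound contains \<open>i + 1\<close> factors \<open>B\<close> and only \<open>i\<close>
    factors \<open>G\<close>.\<close>
  have "?W (Suc (2 * i)) 0 \<le> ennreal (B * (3 ^ (2 * i) * g (2 * i)))"
    by (rule small[OF _ all]) (use r in simp)
  moreover have "3 ^ (2 * i) = (9::real) ^ i" by (simp add: power_mult)
  ultimately show ?thesis by (simp add: g_def B_def mult_ac del: chain_weight.simps)
qed

section \<open>Moments of the Littlewood--Paley blocks\<close>

lemma (in kernel_process) D_real: 
  assumes "w \<in> space M" shows "Im (D s r x w) = 0"
proof -
  have "Im (D s r x w) = (\<integral>\<tau>. Im (indicator {s..r} \<tau> *\<^sub>R K (x - \<omega> \<tau> w)) \<partial>lborel)"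
    unfolding smoothed_occupation_def by (rule Bochner_Integration.integral_Im[symmetric, OF D_integrand_integrable[OF assms]])
  then show ?thesis by (simp add: K_real)
qed

text \<open>\<open>D\<close> is real valued, so an even power equals the power of the norm. This
  puts moments into the oscillatory form that peeling can handle.\<close>

lemma (in kernel_process) nn_integral_norm_D_even_power:
  assumes "s \<le> r" "even m" "0 < m"
  shows "(\<integral>\<^sup>+z. ennreal (norm (D s r (fst z) (snd z)) ^ m) \<partial>N) = ennreal (norm (\<integral>z. D s r (fst z) (snd z) ^ m \<partial>N))"
proof -
  obtain n where m: "m = Suc n" using assms(3) gr0_implies_Suc by blast
  have int: "integrable N (\<lambda>z. D s r (fst z) (snd z) ^ m)" unfolding m by (rule integrable_D_power[OF assms(1)])
  have int2: "integrable N (\<lambda>z. norm (D s r (fst z) (snd z)) ^ m)"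
    using integrable_norm[OF int] by (simp only: norm_power)
  have eq: "D s r (fst z) (snd z) ^ m = of_real (norm (D s r (fst z) (snd z)) ^ m)" if "z \<in> space N" for z
  proof -
    have "snd z \<in> space M" using that by (auto simp: space_pair_measure)
    from D_real[OF this] have "D s r (fst z) (snd z) = of_real (Re (D s r (fst z) (snd z)))"
      by (simp add: complex_eq_iff)
    then obtain y where y: "D s r (fst z) (snd z) = of_real y" by blast
    show ?thesis unfolding y using assms(2) by (simp add: power_even_abs)
  qed
  have "(\<integral>z. D s r (fst z) (snd z) ^ m \<partial>N) = (\<integral>z. complex_of_real (norm (D s r (fst z) (snd z)) ^ m) \<partial>N)"
    by (rule Bochner_Integration.integral_cong[OF refl eq])
  also have "\<dots> = of_real (\<integral>z. norm (D s r (fst z) (snd z)) ^ m \<partial>N)" by (rule integral_of_real[OF int2])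
  finally have "norm (\<integral>z. D s r (fst z) (snd z) ^ m \<partial>N) = (\<integral>z. norm (D s r (fst z) (snd z)) ^ m \<partial>N)"
    by simp
  moreover have "(\<integral>\<^sup>+z. ennreal (norm (D s r (fst z) (snd z)) ^ m) \<partial>N) = ennreal (\<integral>z. norm (D s r (fst z) (snd z)) ^ m \<partial>N)"
    
    by (rule nn_integral_eq_integral[OF int2]) simp
  ultimately show ?thesis by simp
qed

text \<open>One factor in \<open>L^1\<close>, the others by their supremum. It is used where the
  time interval is too short for oscillation to help.\<close>

lemma (in kernel_process) nn_integral_norm_D_power_trivial:
  assumes "s \<le> r" "0 < m"
  shows "(\<integral>\<^sup>+z. ennreal (norm (D s r (fst z) (snd z)) ^ m) \<partial>N) \<le> ennreal ((KB * (r - s)) ^ (m - 1) * (KL * (r - s)))"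
proof -
  obtain n where m: "m = Suc n" using assms(2) gr0_implies_Suc by blast
  have "(\<integral>\<^sup>+z. ennreal (norm (D s r (fst z) (snd z)) ^ m) \<partial>N)
    \<le> (\<integral>\<^sup>+z. ennreal ((KB * (r - s)) ^ n) * ennreal (norm (D s r (fst z) (snd z))) \<partial>N)"
  proof (intro nn_integral_mono)
    fix z assume "z \<in> space N"
    then have "snd z \<in> space M" by (auto simp: space_pair_measure)
    from D_bound[OF this assms(1), of "fst z"]
    show "ennreal (norm (D s r (fst z) (snd z)) ^ m) \<le> ennreal ((KB * (r - s)) ^ n) * ennreal (norm (D s r (fst z) (snd z)))"
      using KB_nonneg assms unfolding m
      by (subst ennreal_mult[symmetric])
         (auto simp: mult.commute[of "norm _"] intro!: ennreal_leI mult_right_mono power_mono)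
  qed
  also have "\<dots> = ennreal ((KB * (r - s)) ^ n) * (\<integral>\<^sup>+z. ennreal (norm (D s r (fst z) (snd z))) \<partial>N)"
    by (intro nn_integral_cmult) auto
  also have "\<dots> \<le> ennreal ((KB * (r - s)) ^ n) * ennreal (KL * (r - s))"
    by (intro mult_left_mono nn_integral_D_N assms) auto
  also have "\<dots> = ennreal ((KB * (r - s)) ^ (m - 1) * (KL * (r - s)))"
    using KB_nonneg assms KL_nonneg unfolding m by (subst ennreal_mult[symmetric]) auto
  finally show ?thesis .
qed

locale lnd_process = prob_space M for M :: "'w measure" +
  fixes \<omega> :: "real \<Rightarrow> 'w \<Rightarrow> 'a::euclidean_space" and a b H :: real
    and \<psi> \<phi> :: "'a \<Rightarrow> real"
  assumes path_measurable [measurable]: "\<And>t. \<omega> t \<in> borel_measurable M"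
    and path_continuous: "\<And>w. w \<in> space M \<Longrightarrow> continuous_on UNIV (\<lambda>t. \<omega> t w)"
    and gaussian: "gaussian_process M {a..b} \<omega>"
    and lnd: "locally_nondeterministic M a b H \<omega>"
    and H_pos: "0 < H" and H_dim: "H * DIM('a) < 1"
    and dy: "dyadic_partition \<psi> \<phi>"
begin

abbreviation occ :: "nat \<Rightarrow> real \<Rightarrow> real \<Rightarrow> 'a \<Rightarrow> 'w \<Rightarrow> complex" where
  "occ k s t x w \<equiv> smoothed_occupation (lp_kernel \<psi> \<phi> k) (\<lambda>\<tau>. \<omega> \<tau> w) s t x"

text \<open>The order of quantifiers is the point: one \<open>KL\<close> serves all blocks, so that
  later constants do not depend on \<open>k\<close>.\<close>

lemma kernel_process_lp:
  "\<exists>KL>0. \<forall>k. kernel_process M \<omega> (lp_kernel \<psi> \<phi> k) (lp_symbol \<psi> \<phi> k) (1 / (2 * pi) ^ DIM('a))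
     (symbol_vol DIM('a) * 2 ^ (k * DIM('a))) KL"
proof -
  obtain KL where KL: "KL > 0" "\<And>k. (\<integral>\<^sup>+x. ennreal (norm (lp_kernel \<psi> \<phi> k x)) \<partial>lborel) \<le> ennreal KL"
    using lp_kernel_L1[OF dy] by blast
  have "kernel_process M \<omega> (lp_kernel \<psi> \<phi> k) (lp_symbol \<psi> \<phi> k) (1 / (2 * pi) ^ DIM('a))
     (symbol_vol DIM('a) * 2 ^ (k * DIM('a))) KL" for k
  proof unfold_locales
    show "lp_kernel \<psi> \<phi> k x = of_real (1 / (2 * pi) ^ DIM('a)) * (\<integral>\<xi>. exp (\<i> * of_real (\<xi> \<bullet> x)) * of_real (lp_symbol \<psi> \<phi> k \<xi>) \<partial>lborel)" for x
      by (simp add: lp_kernel_def inv_fourier_def)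
    show "integrable lborel (lp_symbol \<psi> \<phi> k)"
      by (rule integrable_compact_support[OF lp_symbol_continuous[OF dy] lp_symbol_support[OF dy]])
    show "norm (complex_of_real (1 / (2 * pi) ^ DIM('a))) \<le> 1" by (rule fourier_prefactor_le)
  qed (use KL path_continuous in \<open>auto intro: lp_kernel_continuous[OF dy] lp_kernel_real[OF dy] lp_kernel_bound[OF dy]
      lp_symbol_bounds[OF dy]\<close>)
  with KL(1) show ?thesis by blast
qed

text \<open>Write R = 2^k and T = t - s. The chain contributes \<open>i + 1\<close> good factors of
  order R^(-2\<beta>) T^(1-v) and \<open>i\<close> free ones of order T^(1-Hd). Since m = 2(i + 1),
  the powers of R add up to R^(-\<beta>m). Only short intervals are covered because local
  nondeterminism holds up to some length depending on \<open>m\<close>.\<close>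

lemma moment_even_local:
  fixes \<beta> :: real and m i :: nat
  assumes m: "m = 2 * i + 2" and \<beta>: "0 \<le> \<beta>" "(2 * \<beta> + DIM('a)) * H < 1"
  shows "\<exists>C>0. \<exists>\<delta>>0. \<forall>k s t. a \<le> s \<longrightarrow> s < t \<longrightarrow> t \<le> b \<longrightarrow> t - s \<le> \<delta> \<longrightarrow>
    (\<integral>\<^sup>+z. ennreal (norm (occ k s t (fst z) (snd z)) ^ m) \<partial>(lborel \<Otimes>\<^sub>M M))
      \<le> ennreal (C * (2 ^ k) powr (- \<beta> * m) * (t - s) powr (H * DIM('a) + m * (1 - H * DIM('a) - \<beta> * H)))"
proof -
  let ?d = "real DIM('a)"
  define V where "V = symbol_vol DIM('a)"
  have V: "V > 0" unfolding V_def by (rule symbol_vol_pos)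
  obtain KL where KL: "KL > 0" and kp: "\<And>k. kernel_process M \<omega> (lp_kernel \<psi> \<phi> k) (lp_symbol \<psi> \<phi> k) (1 / (2 * pi) ^ DIM('a))
     (V * 2 ^ (k * DIM('a))) KL"
    unfolding V_def using kernel_process_lp by blast
  have "2 \<le> m" using m by simp
  then obtain c \<delta>0 where c: "c > 0" and \<delta>0: "\<delta>0 > 0" and L: "\<forall>s x. strict_mono_on {1..m} s \<and> a \<le> s 1 \<and> s m \<le> b \<and> \<bar>s m - s 1\<bar> \<le> \<delta>0 \<longrightarrow>
      variance (\<lambda>w. \<Sum>k=1..m-1. x k \<bullet> (\<omega> (s (k + 1)) w - \<omega> (s k) w))
        \<ge> 2 * c * (\<Sum>k=1..m-1. (norm (x k))\<^sup>2 * \<bar>s (k + 1) - s k\<bar> powr (2 * H))"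
    using lnd unfolding locally_nondeterministic_def by blast
  have lnd_m: "\<And>s x. strict_mono_on {1..m} s \<Longrightarrow> a \<le> s 1 \<Longrightarrow> s m \<le> b \<Longrightarrow> \<bar>s m - s 1\<bar> \<le> \<delta>0 \<Longrightarrow>
      variance (\<lambda>w. \<Sum>k=1..m-1. x k \<bullet> (\<omega> (s (k + 1)) w - \<omega> (s k) w))
        \<ge> 2 * c * (\<Sum>k=1..m-1. (norm (x k))\<^sup>2 * \<bar>s (k + 1) - s k\<bar> powr (2 * H))"
    for s x using L by blast
  define \<delta> where "\<delta> = min \<delta>0 1"
  \<comment> \<open>With this choice \<open>v / H\<close> is \<open>2 * \<beta> + ?d\<close>: the
    part d cancels the volume of the frequency support, and 2\<beta> remains for each good
    step.\<close>
  define v where "v = (2 * \<beta> + ?d) * H"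
  have v: "0 < v" "v < 1" using \<beta> H_pos by (auto simp: v_def intro!: mult_pos_pos add_nonneg_pos)
  have vH: "v / H = 2 * \<beta> + ?d" using H_pos by (simp add: v_def)
  define a0 where "a0 = (v / (2 * H)) powr (v / (2 * H)) * c powr (- (v / (2 * H))) / (1 - v)"
  have a0: "a0 > 0" unfolding a0_def using v c H_pos by auto
  define b0 where "b0 = V * a0 * (3/16) powr (- (2 * \<beta> + ?d))"
  have b0: "b0 > 0" unfolding b0_def using V a0 by auto
  define gc where "gc = enn2real (\<integral>\<^sup>+\<zeta>. ennreal (exp (- c * (norm \<zeta>)\<^sup>2)) \<partial>(lborel :: 'a measure)) / (1 - H * DIM('a))"
  \<comment> \<open>Including \<open>b0\<close> in the maximum guarantees that a good step is never
    worse than a free one, as \<open>chain_weight_le\<close> demands.\<close>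
  define g0 where "g0 = max gc b0"
  have g0: "g0 > 0" "b0 \<le> g0" "gc \<le> g0" using b0 unfolding g0_def by auto
  define C1 where "C1 = V ^ (m - 1) * KL"
  define C2 where "C2 = fact m * KL * (9 ^ i * b0 ^ (i + 1) * g0 ^ i)"
  have C12: "C1 > 0" "C2 > 0" unfolding C1_def C2_def using V KL b0 g0 by auto
  let ?e = "H * ?d + m * (1 - H * ?d - \<beta> * H)"
  have main: "(\<integral>\<^sup>+z. ennreal (norm (occ k s t (fst z) (snd z)) ^ m) \<partial>(lborel \<Otimes>\<^sub>M M))
      \<le> ennreal ((C1 + C2) * (2 ^ k) powr (- \<beta> * m) * (t - s) powr ?e)"
    if st: "a \<le> s" "s < t" "t \<le> b" "t - s \<le> \<delta>" for k s t
  proof -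
    interpret kernel_process M \<omega> "lp_kernel \<psi> \<phi> k" "lp_symbol \<psi> \<phi> k" "1 / (2 * pi) ^ DIM('a)" "V * 2 ^ (k * DIM('a))" KL
      by (rule kp)
    define T where "T = t - s"
    define R where "R = (2::real) ^ k"
    have T: "0 < T" "T \<le> 1" "T \<le> \<delta>0" using st by (auto simp: T_def \<delta>_def)
    have R: "R \<ge> 1" by (simp add: R_def)
    have Rk: "2 ^ (k * DIM('a)) = R powr ?d" by (simp add: R_def power_mult powr_realpow)
    define P where "P = R powr (- \<beta> * m) * T powr ?e"
    have P: "P \<ge> 0" by (simp add: P_def)
    \<comment> \<open>If the path moves less than the wave length \<open>1 / R\<close> during time \<open>T\<close>, there is nothing to gain.\<close>
    have "(\<integral>\<^sup>+z. ennreal (norm (occ k s t (fst z) (snd z)) ^ m) \<partial>N) \<le> ennreal ((C1 + C2) * P)"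
    proof (cases "R * T powr H \<le> 1")
      case True
      have "(\<integral>\<^sup>+z. ennreal (norm (occ k s t (fst z) (snd z)) ^ m) \<partial>N) \<le> ennreal ((V * 2 ^ (k * DIM('a)) * (t - s)) ^ (m - 1) * (KL * (t - s)))"
        by (rule nn_integral_norm_D_power_trivial) (use st m in auto)
      also have "\<dots> \<le> ennreal ((C1 + C2) * P)"
      proof (rule ennreal_leI)
      have "(V * 2 ^ (k * DIM('a)) * (t - s)) ^ (m - 1) * (KL * (t - s)) = C1 * (R powr (?d * (m - 1)) * T powr m)"
      proof -
        have "(R powr ?d) ^ (m - 1) = R powr (?d * (m - 1))" using R by (simp add: powr_power mult.commute)
        moreover have "T ^ (m - 1) * T = T powr m" using power_minus_mult[of m T] powr_realpow[OF T(1), of m] \<open>2 \<le> m\<close> by simp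
        ultimately show ?thesis unfolding Rk T_def[symmetric] C1_def by (simp add: power_mult_distrib mult_ac)
      qed
      also have "\<dots> \<le> C1 * P"
      proof (rule mult_left_mono)
        have RT: "R \<le> T powr (- H)" using True T by (simp add: powr_minus field_simps)
        \<comment> \<open>The excess of the trivial power R^(d(m-1)) over the desired R^(-\<beta>m).
          As R \<le> T^(-H), it converts into the power T^(-H\<gamma>), and the exponents of T then
          match exactly.\<close>
        define \<gamma> where "\<gamma> = ?d * (m - 1) + \<beta> * m"
        have g: "\<gamma> \<ge> 0" using \<beta> by (simp add: \<gamma>_def)
        have "R powr \<gamma> \<le> (T powr (- H)) powr \<gamma>" using RT R g by (intro powr_mono2) auto
        also have "\<dots> = T powr (- H * \<gamma>)" by (simp add: powr_powr)
        finally have *: "R powr \<gamma> \<le> T powr (- H * \<gamma>)" .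
        have "R powr (?d * (m - 1)) * T powr m = (R powr (- \<beta> * m) * R powr \<gamma>) * T powr m"
          by (simp add: \<gamma>_def powr_add[symmetric])
        also have "\<dots> \<le> (R powr (- \<beta> * m) * T powr (- H * \<gamma>)) * T powr m"
          by (intro mult_right_mono mult_left_mono *) auto
        also have "\<dots> = R powr (- \<beta> * m) * T powr (- H * \<gamma> + m)" by (simp only: powr_add mult.assoc)
        also have "- H * \<gamma> + m = ?e"
          using m by (simp add: \<gamma>_def of_nat_diff algebra_simps)
        finally show "R powr (?d * (m - 1)) * T powr m \<le> P" by (simp add: P_def)
      qed (use C12 in simp)
      also have "\<dots> \<le> (C1 + C2) * P" using C12 P by (intro mult_right_mono) auto
      finally show "(V * 2 ^ (k * DIM('a)) * (t - s)) ^ (m - 1) * (KL * (t - s)) \<le> (C1 + C2) * P" .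
      qed
      finally show ?thesis .
    next
      case False
      then have RT: "1 < R * T powr H" by simp
      \<comment> \<open>With T \<le> 1 the case assumption forces R > 1 and hence k > 0, so the
        symbol lives on an annulus and frequencies are bounded from below.\<close>
      have "T powr H \<le> 1" using T H_pos by (simp add: powr_le1)
      then have "R > 1" using RT R by (cases "R = 1") auto
      then obtain j where k: "k = Suc j" unfolding R_def by (cases k) auto
      \<comment> \<open>Half of the inner radius 3/8 * 2^k of the annulus.\<close>
      define r where "r = 3/16 * R"
      have r: "r > 0" using R by (simp add: r_def)
      define A where "A = a0 * r powr (- (v / H)) * T powr (1 - v)"
      have A0: "A \<ge> 0" unfolding A_def using a0 by auto
      define V' where "V' = V * R powr ?d"
      have V'0: "V' \<ge> 0" unfolding V'_def using V by auto
      define G where "G = g0 * T powr (1 - H * ?d)"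
      have VA: "V' * A = b0 * (R powr (- 2 * \<beta>) * T powr (1 - v))"
      proof -
        have "r powr (- (v / H)) = (3/16) powr (- (2 * \<beta> + ?d)) * R powr (- (2 * \<beta> + ?d))"
          unfolding r_def vH using R by (subst powr_mult) auto
        moreover have "R powr ?d * R powr (- (2 * \<beta> + ?d)) = R powr (- 2 * \<beta>)"
          by (simp add: powr_add[symmetric])
        ultimately show ?thesis unfolding V'_def A_def b0_def by (simp add: mult_ac)
      qed
      \<comment> \<open>The quotient of the two sides is at most a constant times (R
        T^H)^(-2\<beta>), and R T^H > 1 in this case.\<close>
      have VAG: "V' * A \<le> G"
      proof -
        have "R powr (- 2 * \<beta>) * T powr (1 - v) = (R powr (- 2 * \<beta>) * (T powr H) powr (- 2 * \<beta>)) * T powr (1 - H * ?d)"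
        proof -
          have "(T powr H) powr (- 2 * \<beta>) * T powr (1 - H * ?d) = T powr (1 - v)"
            by (simp add: powr_powr powr_add[symmetric] v_def algebra_simps)
          then show ?thesis by (simp add: mult.assoc)
        qed
        also have "R powr (- 2 * \<beta>) * (T powr H) powr (- 2 * \<beta>) = (R * T powr H) powr (- 2 * \<beta>)"
          using R T by (subst powr_mult) auto
        also have "\<dots> \<le> 1 powr (- 2 * \<beta>)" using RT \<beta> by (intro powr_mono2') auto
        finally have "R powr (- 2 * \<beta>) * T powr (1 - v) \<le> T powr (1 - H * ?d)" by (simp add: mult_right_mono)
        then show ?thesis unfolding VA G_def using b0 g0 by (intro mult_mono) auto
      qed
      have "(\<integral>\<^sup>+z. ennreal (norm (occ k s t (fst z) (snd z)) ^ m) \<partial>N) = ennreal (norm (\<integral>z. occ k s t (fst z) (snd z) ^ m \<partial>N))"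
        by (rule nn_integral_norm_D_even_power) (use st m in auto)
      also have "\<dots> \<le> ennreal (fact m * KL * (t - s)) * chain_weight (lp_symbol \<psi> \<phi> k) c H (t - s) (2 * i + 1) 0"
        by (rule moment_chain_bound[where \<delta> = \<delta>0, OF gaussian \<open>2 \<le> m\<close> lnd_m]) (use st m T in \<open>auto simp: T_def\<close>)
      also have "chain_weight (lp_symbol \<psi> \<phi> k) c H (t - s) (2 * i + 1) 0 \<le> ennreal (9 ^ i * (V' * A) * (G * (V' * A)) ^ i)"
      proof (rule chain_weight_le[where r = r])
        show "lp_symbol \<psi> \<phi> k \<xi> \<noteq> 0 \<Longrightarrow> 2 * r \<le> norm \<xi>" for \<xi>
          using lp_symbol_support_lower[OF dy, of j \<xi>] unfolding k r_def R_def by simp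
        show "(\<integral>\<^sup>+\<xi>. ennreal (lp_symbol \<psi> \<phi> k \<xi>) \<partial>lborel) \<le> ennreal V'"
          using nn_integral_lp_symbol_le[OF dy, of k] unfolding V'_def V_def symbol_vol_def Rk[symmetric] .
        show "r \<le> norm \<eta> \<Longrightarrow> Theta c H (t - s) \<eta> \<le> ennreal A" for \<eta> :: 'a
          unfolding A_def a0_def using Theta_le_powr[of v H c "t - s" r \<eta>] v H_pos c T r by (simp add: T_def)
        have "(\<integral>\<^sup>+\<eta>. Theta c H (t - s) \<eta> \<partial>(lborel :: 'a measure)) \<le> ennreal (gc * T powr (1 - H * ?d))"
          unfolding gc_def T_def using st by (intro nn_integral_Theta H_pos H_dim c) auto
        also have "\<dots> \<le> ennreal G" unfolding G_def using g0 by (intro ennreal_leI mult_right_mono) auto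
        finally show "(\<integral>\<^sup>+\<eta>. Theta c H (t - s) \<eta> \<partial>(lborel :: 'a measure)) \<le> ennreal G" .
      qed (use lp_symbol_bounds[OF dy] A0 V'0 VAG r in \<open>auto intro: lp_symbol_measurable[OF dy]\<close>)
      also have "ennreal (fact m * KL * (t - s)) * ennreal (9 ^ i * (V' * A) * (G * (V' * A)) ^ i)
        = ennreal (C2 * P)"
      proof -
        have "fact m * KL * (t - s) * (9 ^ i * (V' * A) * (G * (V' * A)) ^ i) 
          = C2 * (T * (T powr (1 - H * ?d)) ^ i * (R powr (- 2 * \<beta>) * T powr (1 - v)) ^ (i + 1))"
          unfolding VA G_def C2_def T_def[symmetric] by (simp add: power_mult_distrib mult_ac)
        also have "T * (T powr (1 - H * ?d)) ^ i * (R powr (- 2 * \<beta>) * T powr (1 - v)) ^ (i + 1) = P"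
        proof -
          have "(R powr (- 2 * \<beta>)) ^ (i + 1) = R powr (- \<beta> * m)"
            using R m by (subst powr_power) (auto simp: algebra_simps)
          moreover have "T * (T powr (1 - H * ?d)) ^ i * (T powr (1 - v)) ^ (i + 1) = T powr ?e"
          proof -
            have "T * (T powr (1 - H * ?d)) ^ i * (T powr (1 - v)) ^ (i + 1) = T powr (1 + (1 - H * ?d) * i + (1 - v) * (i + 1))"
            proof -
              have "(T powr (1 - H * ?d)) ^ i = T powr ((1 - H * ?d) * i)" "(T powr (1 - v)) ^ (i + 1) = T powr ((1 - v) * (i + 1))"
                using T by (simp_all only: powr_realpow[symmetric] powr_gt_zero powr_powr)
              then show ?thesis using T by (simp only: powr_add) simp
            qed
            also have "1 + (1 - H * ?d) * i + (1 - v) * (i + 1) = ?e"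
              unfolding v_def m by (simp add: algebra_simps)
            finally show ?thesis .
          qed
          ultimately show ?thesis unfolding P_def power_mult_distrib by (simp add: mult_ac)
        qed
        finally show ?thesis using KL st A0 V'0 g0 by (subst ennreal_mult'[symmetric]) (auto intro!: mult_nonneg_nonneg)
      qed
      also have "\<dots> \<le> ennreal ((C1 + C2) * P)" using C12 P by (intro ennreal_leI mult_right_mono) auto
      finally show ?thesis by (simp add: mult_left_mono)
    qed
    then show ?thesis by (simp add: P_def R_def T_def mult.assoc)
  qed
  show ?thesis
    by (rule exI[of _ "C1 + C2"], intro conjI, use C12 in simp, rule exI[of _ \<delta>])
       (use main \<delta>0 in \<open>auto simp: \<delta>_def\<close>)
qed

end

section \<open>From even moments to all exponents, including the supremum\<close>

lemma sum_power_le: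
  fixes y :: "'i \<Rightarrow> real"
  assumes "finite A" "\<And>i. i \<in> A \<Longrightarrow> 0 \<le> y i" "0 < m"
  shows "(\<Sum>i\<in>A. y i) ^ m \<le> real (card A) ^ m * (\<Sum>i\<in>A. y i ^ m)"
proof (cases "A = {}")
  case False
  define z where "z = Max (y ` A)"
  have "z \<in> y ` A" unfolding z_def using assms False by (intro Max_in) auto
  then obtain j where j: "j \<in> A" "z = y j" by auto
  have "(\<Sum>i\<in>A. y i) \<le> (\<Sum>i\<in>A. z)" unfolding z_def using assms by (intro sum_mono Max_ge) auto
  then have "(\<Sum>i\<in>A. y i) ^ m \<le> (real (card A) * z) ^ m" using assms by (intro power_mono sum_nonneg) auto
  also have "\<dots> = real (card A) ^ m * y j ^ m" by (simp add: power_mult_distrib j)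
  also have "\<dots> \<le> real (card A) ^ m * (\<Sum>i\<in>A. y i ^ m)"
    using assms j by (intro mult_left_mono member_le_sum) auto
  finally show ?thesis .
qed (use assms in \<open>auto simp: power_0_left\<close>)

text \<open>Below the threshold \<open>l\<close> the lower exponent dominates, above it the upper
  one. Integrated with a well chosen \<open>l\<close>, this does the work of Hoelder interpolation
  between moments.\<close>

lemma powr_interpolate:
  fixes y l :: real
  assumes "0 \<le> y" "0 < l" "0 < i" "i \<le> Q" "Q \<le> m"
  shows "y powr Q \<le> l powr (Q - i) * y powr i + l powr (Q - m) * y powr m"
proof (cases "y = 0")
  case False
  then have y: "y > 0" using assms by simp
  show ?thesis
  proof (cases "y \<le> l")
    case True
    have "y powr Q = y powr (Q - i) * y powr i" by (simp add: powr_add[symmetric])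
    also have "\<dots> \<le> l powr (Q - i) * y powr i" using True y assms by (intro mult_right_mono powr_mono2) auto
    finally show ?thesis by (simp add: add_increasing2)
  next
    case False
    have "y powr Q = y powr (Q - m) * y powr m" by (simp add: powr_add[symmetric])
    also have "\<dots> \<le> l powr (Q - m) * y powr m" using False y assms by (intro mult_right_mono powr_mono2') auto
    finally show ?thesis by (simp add: add_increasing)
  qed
qed (use assms in auto)

text \<open>\<open>f\<close> keeps half of its size on the ball of radius \<open>norm (f x) / (2 * \<Lambda>)\<close> around \<open>x\<close>.\<close>

lemma lipschitz_power_le_integral:
  fixes f :: "'a::euclidean_space \<Rightarrow> complex"
  assumes lip: "\<And>x y. norm (f x - f y) \<le> \<Lambda> * norm (x - y)" and \<Lambda>: "0 < \<Lambda>"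
    and [measurable]: "f \<in> borel_measurable borel"
  shows "ennreal (norm (f x) ^ (m + DIM('a))) \<le>
    ennreal (2 ^ (m + DIM('a)) * \<Lambda> ^ DIM('a) / unit_ball_vol (real DIM('a))) * (\<integral>\<^sup>+x. ennreal (norm (f x) ^ m) \<partial>lborel)"
proof (cases "f x = 0")
  case False
  define y where "y = norm (f x)"
  have y: "y > 0" using False by (simp add: y_def)
  define r where "r = y / (2 * \<Lambda>)"
  have r: "r > 0" using y \<Lambda> by (simp add: r_def)
  have v: "unit_ball_vol (real DIM('a)) > 0" by simp
  then have v': "unit_ball_vol (real DIM('a)) \<noteq> 0" by (rule less_imp_neq[symmetric])
  have "ennreal ((y / 2) ^ m) * ennreal (unit_ball_vol (real DIM('a)) * r ^ DIM('a)) = ennreal ((y / 2) ^ m) * emeasure lborel (ball x r)"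
    using r by (subst emeasure_ball) auto
  also have "\<dots> = (\<integral>\<^sup>+z. ennreal ((y / 2) ^ m) * indicator (ball x r) z \<partial>lborel)"
    by (subst nn_integral_cmult_indicator) auto
  also have "\<dots> \<le> (\<integral>\<^sup>+z. ennreal (norm (f z) ^ m) \<partial>lborel)"
  proof (rule nn_integral_mono)
    fix z
    show "ennreal ((y / 2) ^ m) * indicator (ball x r) z \<le> ennreal (norm (f z) ^ m)"
    proof (cases "z \<in> ball x r")
      case True
      have "y \<le> norm (f z) + norm (f x - f z)" unfolding y_def using norm_triangle_ineq2[of "f x" "f z"] by linarith
      also have "norm (f x - f z) \<le> \<Lambda> * norm (x - z)" by (rule lip)
      also have "\<dots> \<le> \<Lambda> * r" using True \<Lambda> by (intro mult_left_mono) (auto simp: dist_norm)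
      also have "\<dots> = y / 2" using \<Lambda> by (simp add: r_def)
      finally have "y / 2 \<le> norm (f z)" by simp
      then show ?thesis using True y by (auto intro!: ennreal_leI power_mono)
    qed simp
  qed
  finally have *: "ennreal ((y / 2) ^ m) * ennreal (unit_ball_vol (real DIM('a)) * r ^ DIM('a)) \<le> (\<integral>\<^sup>+z. ennreal (norm (f z) ^ m) \<partial>lborel)" .
  have "norm (f x) ^ (m + DIM('a)) = (2 ^ (m + DIM('a)) * \<Lambda> ^ DIM('a) / unit_ball_vol (real DIM('a))) * ((y / 2) ^ m * (unit_ball_vol (real DIM('a)) * r ^ DIM('a)))"
    using v \<Lambda> unfolding y_def[symmetric] r_def by (simp add: power_add power_divide power_mult_distrib v')
  then have "ennreal (norm (f x) ^ (m + DIM('a))) = ennreal (2 ^ (m + DIM('a)) * \<Lambda> ^ DIM('a) / unit_ball_vol (real DIM('a))) * (ennreal ((y / 2) ^ m) * ennreal (unit_ball_vol (real DIM('a)) * r ^ DIM('a)))"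
    using y r \<Lambda> v v' by (simp add: ennreal_mult[symmetric])
  also have "\<dots> \<le> ennreal (2 ^ (m + DIM('a)) * \<Lambda> ^ DIM('a) / unit_ball_vol (real DIM('a))) * (\<integral>\<^sup>+x. ennreal (norm (f x) ^ m) \<partial>lborel)"
    by (intro mult_left_mono *) auto
  finally show ?thesis .
qed (simp add: power_0_left)

context lnd_process begin

lemma occ_additive:
  assumes "w \<in> space M" "s \<le> r" "r \<le> t"
  shows "occ k s t x w = occ k s r x w + occ k r t x w"
proof -
  obtain KL where "kernel_process M \<omega> (lp_kernel \<psi> \<phi> k) (lp_symbol \<psi> \<phi> k) (1 / (2 * pi) ^ DIM('a)) (symbol_vol DIM('a) * 2 ^ (k * DIM('a))) KL"
    using kernel_process_lp by blast
  then show ?thesis by (rule kernel_process.D_additive[OF _ assms])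
qed

lemma occ_bound:
  assumes "w \<in> space M" "s \<le> t"
  shows "norm (occ k s t x w) \<le> symbol_vol DIM('a) * 2 ^ (k * DIM('a)) * (t - s)"
proof -
  obtain KL where "kernel_process M \<omega> (lp_kernel \<psi> \<phi> k) (lp_symbol \<psi> \<phi> k) (1 / (2 * pi) ^ DIM('a)) (symbol_vol DIM('a) * 2 ^ (k * DIM('a))) KL"
    using kernel_process_lp by blast
  then show ?thesis by (rule kernel_process.D_bound[OF _ assms])
qed

lemma occ_self [simp]: "occ k s s x w = 0"
proof -
  obtain KL where "kernel_process M \<omega> (lp_kernel \<psi> \<phi> k) (lp_symbol \<psi> \<phi> k) (1 / (2 * pi) ^ DIM('a)) (symbol_vol DIM('a) * 2 ^ (k * DIM('a))) KL"
    using kernel_process_lp by blast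
  then show ?thesis by (rule kernel_process.D_self)
qed

lemma occ_measurable [measurable]:
  "(\<lambda>z. occ k s t (fst z) (snd z)) \<in> borel_measurable (lborel \<Otimes>\<^sub>M M)"
proof -
  obtain KL where "kernel_process M \<omega> (lp_kernel \<psi> \<phi> k) (lp_symbol \<psi> \<phi> k) (1 / (2 * pi) ^ DIM('a)) (symbol_vol DIM('a) * 2 ^ (k * DIM('a))) KL"
    using kernel_process_lp by blast
  then show ?thesis by (rule kernel_process.D_measurable) measurable
qed

lemma occ_measurable_x [measurable]:
  assumes w: "w \<in> space M" shows "(\<lambda>x. occ k s t x w) \<in> borel_measurable borel"
proof -
  have "(\<lambda>x. (x, w)) \<in> borel \<rightarrow>\<^sub>M lborel \<Otimes>\<^sub>M M" using w by measurable
  from measurable_compose[OF this occ_measurable] show ?thesis by simp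
qed

lemma occ_lipschitz:
  assumes w: "w \<in> space M" and st: "s \<le> t"
  shows "norm (occ k s t x w - occ k s t y w) \<le> 4/3 * symbol_vol DIM('a) * 2 ^ (k * (DIM('a) + 1)) * (t - s) * norm (x - y)"
proof -
  obtain KL where "kernel_process M \<omega> (lp_kernel \<psi> \<phi> k) (lp_symbol \<psi> \<phi> k) (1 / (2 * pi) ^ DIM('a)) (symbol_vol DIM('a) * 2 ^ (k * DIM('a))) KL"
    using kernel_process_lp by blast
  then interpret kernel_process M \<omega> "lp_kernel \<psi> \<phi> k" "lp_symbol \<psi> \<phi> k" "1 / (2 * pi) ^ DIM('a)" "symbol_vol DIM('a) * 2 ^ (k * DIM('a))" KL .
  let ?L = "4/3 * symbol_vol DIM('a) * 2 ^ (k * (DIM('a) + 1)) * norm (x - y)"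
  have c: "continuous_on {s..t} (\<lambda>\<tau>. lp_kernel \<psi> \<phi> k (x - \<omega> \<tau> w))" for x
    by (rule continuous_on_subset[OF D_integrand_continuous[OF w]]) simp
  have "occ k s t x w - occ k s t y w = integral {s..t} (\<lambda>\<tau>. lp_kernel \<psi> \<phi> k (x - \<omega> \<tau> w) - lp_kernel \<psi> \<phi> k (y - \<omega> \<tau> w))"
    unfolding D_eq_integral[OF w]
    by (rule Henstock_Kurzweil_Integration.integral_diff[symmetric]) (intro integrable_continuous_real c)+
  also have "norm \<dots> \<le> ?L * (t - s)"
  proof (rule integral_bound[OF st])
    show "continuous_on {s..t} (\<lambda>\<tau>. lp_kernel \<psi> \<phi> k (x - \<omega> \<tau> w) - lp_kernel \<psi> \<phi> k (y - \<omega> \<tau> w))"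
      by (intro continuous_intros c)
    show "norm (lp_kernel \<psi> \<phi> k (x - \<omega> \<tau> w) - lp_kernel \<psi> \<phi> k (y - \<omega> \<tau> w)) \<le> ?L" for \<tau>
      using lp_kernel_lipschitz[OF dy, of k "x - \<omega> \<tau> w" "y - \<omega> \<tau> w"] by simp
  qed
  finally show ?thesis by (simp add: mult_ac)
qed

lemma occ_sum:
  assumes w: "w \<in> space M" and h: "0 \<le> h"
  shows "occ k s (s + real n * h) x w = (\<Sum>i<n. occ k (s + real i * h) (s + real (Suc i) * h) x w)"
proof (induction n)
  case (Suc n)
  have "occ k s (s + real (Suc n) * h) x w = occ k s (s + real n * h) x w + occ k (s + real n * h) (s + real (Suc n) * h) x w"
    by (rule occ_additive[OF w]) (use h in \<open>auto simp: algebra_simps\<close>)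
  then show ?case using Suc by simp
qed simp

text \<open>Removes the length restriction: the interval is cut into a fixed number \<open>n\<close>
  of equal pieces shorter than \<delta>, and the power of the sum costs \<open>n ^ m\<close>. As
  \<open>n\<close> depends only on b - a and \<delta>, the form of the bound persists.\<close>

lemma moment_even:
  fixes \<beta> :: real and m i :: nat
  assumes m: "m = 2 * i + 2" and \<beta>: "0 \<le> \<beta>" "(2 * \<beta> + DIM('a)) * H < 1"
  shows "\<exists>C>0. \<forall>k s t. a \<le> s \<longrightarrow> s < t \<longrightarrow> t \<le> b \<longrightarrow>
    (\<integral>\<^sup>+z. ennreal (norm (occ k s t (fst z) (snd z)) ^ m) \<partial>(lborel \<Otimes>\<^sub>M M))
      \<le> ennreal (C * (2 ^ k) powr (- \<beta> * m) * (t - s) powr (H * DIM('a) + m * (1 - H * DIM('a) - \<beta> * H)))"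
proof -
  let ?e = "H * DIM('a) + m * (1 - H * DIM('a) - \<beta> * H)"
  obtain C \<delta> where C: "C > 0" and \<delta>: "\<delta> > 0" and bound: "\<And>k s t. a \<le> s \<Longrightarrow> s < t \<Longrightarrow> t \<le> b \<Longrightarrow> t - s \<le> \<delta> \<Longrightarrow>
    (\<integral>\<^sup>+z. ennreal (norm (occ k s t (fst z) (snd z)) ^ m) \<partial>(lborel \<Otimes>\<^sub>M M))
      \<le> ennreal (C * (2 ^ k) powr (- \<beta> * m) * (t - s) powr ?e)"
    using moment_even_local[OF m \<beta>] by blast
  obtain n0 :: nat where n0: "(b - a) / \<delta> < n0" using reals_Archimedean2 by blast
  define n where "n = Suc n0"
  have n: "0 < n" "(b - a) / n \<le> \<delta>"
    using n0 \<delta> unfolding n_def by (auto simp: field_simps)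
  define C' where "C' = real n ^ m * n * (C * (1 / n) powr ?e)"
  have "(\<integral>\<^sup>+z. ennreal (norm (occ k s t (fst z) (snd z)) ^ m) \<partial>(lborel \<Otimes>\<^sub>M M))
      \<le> ennreal (C' * (2 ^ k) powr (- \<beta> * m) * (t - s) powr ?e)" if st: "a \<le> s" "s < t" "t \<le> b" for k s t
  proof -
    define h where "h = (t - s) / n"
    have h: "h > 0" "h \<le> \<delta>" using st n divide_right_mono[of "t - s" "b - a" "real n"] by (auto simp: h_def)
    have tn: "t = s + real n * h" using n by (simp add: h_def)
    let ?f = "\<lambda>i z. occ k (s + real i * h) (s + real (Suc i) * h) (fst z) (snd z)"
    have "(\<integral>\<^sup>+z. ennreal (norm (occ k s t (fst z) (snd z)) ^ m) \<partial>(lborel \<Otimes>\<^sub>M M))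
      \<le> (\<integral>\<^sup>+z. ennreal (real n ^ m) * (\<Sum>i<n. ennreal (norm (?f i z) ^ m)) \<partial>(lborel \<Otimes>\<^sub>M M))"
    proof (rule nn_integral_mono)
      fix z :: "'a \<times> 'w" assume "z \<in> space (lborel \<Otimes>\<^sub>M M)"
      then have w: "snd z \<in> space M" by (auto simp: space_pair_measure)
      have "norm (occ k s t (fst z) (snd z)) \<le> (\<Sum>i<n. norm (?f i z))"
        unfolding tn using h by (subst occ_sum[OF w]) (auto intro: norm_sum)
      then have "norm (occ k s t (fst z) (snd z)) ^ m \<le> (\<Sum>i<n. norm (?f i z)) ^ m" by (intro power_mono) auto
      also have "\<dots> \<le> real n ^ m * (\<Sum>i<n. norm (?f i z) ^ m)"
        using sum_power_le[of "{..<n}" "\<lambda>i. norm (?f i z)" m] m by simp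
      finally have "ennreal (norm (occ k s t (fst z) (snd z)) ^ m) \<le> ennreal (real n ^ m * (\<Sum>i<n. norm (?f i z) ^ m))"
        by (rule ennreal_leI)
      then show "ennreal (norm (occ k s t (fst z) (snd z)) ^ m) \<le> ennreal (real n ^ m) * (\<Sum>i<n. ennreal (norm (?f i z) ^ m))"
        by (subst sum_ennreal) (auto simp: ennreal_mult' sum_nonneg)
    qed
    also have "\<dots> = ennreal (real n ^ m) * (\<Sum>i<n. \<integral>\<^sup>+z. ennreal (norm (?f i z) ^ m) \<partial>(lborel \<Otimes>\<^sub>M M))"
      by (subst nn_integral_cmult, measurable) (subst nn_integral_sum, auto)
    also have "\<dots> \<le> ennreal (real n ^ m) * (\<Sum>i<n. ennreal (C * (2 ^ k) powr (- \<beta> * m) * h powr ?e))"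
    proof (intro mult_left_mono sum_mono)
      fix i assume i: "i \<in> {..<n}"
      have "real (Suc i) * h \<le> real n * h" using i h by (intro mult_right_mono) auto
      then have "s + real (Suc i) * h \<le> b" using st tn by linarith
      moreover have "a \<le> s + real i * h" using st h by (simp add: add_increasing2)
      moreover have "s + real (Suc i) * h - (s + real i * h) = h" by (simp add: algebra_simps)
      ultimately show "(\<integral>\<^sup>+z. ennreal (norm (?f i z) ^ m) \<partial>(lborel \<Otimes>\<^sub>M M)) \<le> ennreal (C * (2 ^ k) powr (- \<beta> * m) * h powr ?e)"
        using bound[of "s + real i * h" "s + real (Suc i) * h" k] h by simp
    qed auto
    also have "\<dots> = ennreal (real n ^ m * (n * (C * (2 ^ k) powr (- \<beta> * m) * h powr ?e)))"
      using C by (simp add: ennreal_mult' ennreal_of_nat_eq_real_of_nat)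
    also have "h powr ?e = (1 / n) powr ?e * (t - s) powr ?e"
      using st n by (simp add: h_def powr_mult[symmetric])
    finally show ?thesis by (simp add: C'_def mult_ac)
  qed
  moreover have "C' > 0" unfolding C'_def using C n by auto
  ultimately show ?thesis by blast
qed

text \<open>No decay in \<open>k\<close>: this is the endpoint of the interpolation for exponents
  below 2.\<close>

lemma moment_first:
  "\<exists>C>0. \<forall>k s t. s \<le> t \<longrightarrow>
    (\<integral>\<^sup>+z. ennreal (norm (occ k s t (fst z) (snd z))) \<partial>(lborel \<Otimes>\<^sub>M M)) \<le> ennreal (C * (t - s))"
proof -
  obtain KL where KL: "KL > 0" and kp: "\<And>k. kernel_process M \<omega> (lp_kernel \<psi> \<phi> k) (lp_symbol \<psi> \<phi> k) (1 / (2 * pi) ^ DIM('a)) (symbol_vol DIM('a) * 2 ^ (k * DIM('a))) KL"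
    using kernel_process_lp by blast
  show ?thesis using KL kernel_process.nn_integral_D_N[OF kp] by blast
qed

end

text \<open>For finite \<open>q\<close> it is used with \<open>Q = enn2real q\<close> and is the
  \<open>Q\<close>-th power of the \<open>L^q\<close> norm. For \<open>q = \<infinity>\<close> the
  exponent \<open>Q\<close> is auxiliary: it is the order at which the supremum is shown to have
  moments.\<close>

definition block_size :: "ennreal \<Rightarrow> real \<Rightarrow> ('a::euclidean_space \<Rightarrow> complex) \<Rightarrow> ennreal" where
  "block_size q Q f = (if q = \<infinity> then SUP x. ennreal (norm (f x) powr Q)
     else \<integral>\<^sup>+x. ennreal (norm (f x) powr Q) \<partial>lborel)"

context lnd_process begin

lemma occ_measurable_raw [measurable (raw)]:
  assumes [measurable]: "f \<in> borel_measurable L" "h \<in> measurable L M"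
  shows "(\<lambda>z. occ k s t (f z) (h z)) \<in> borel_measurable L"
proof -
  have "(\<lambda>z. (f z, h z)) \<in> L \<rightarrow>\<^sub>M lborel \<Otimes>\<^sub>M M" by measurable
  from measurable_compose[OF this occ_measurable] show ?thesis by simp
qed

lemma nn_integral_occ_swap:
  assumes [measurable]: "g \<in> borel_measurable borel"
  shows "(\<integral>\<^sup>+w. \<integral>\<^sup>+x. g (occ k s t x w) \<partial>lborel \<partial>M) = (\<integral>\<^sup>+z. g (occ k s t (fst z) (snd z)) \<partial>(lborel \<Otimes>\<^sub>M M))"
proof -
  interpret XM: pair_sigma_finite "lborel :: 'a measure" M
    by (intro pair_sigma_finite.intro sigma_finite_measure_axioms sigma_finite_lborel)
  show ?thesis by (subst XM.nn_integral_snd[symmetric]) auto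
qed

lemma moment_interpolate:
  assumes "0 < l" "0 < i" "i \<le> Q" "Q \<le> m" "0 \<le> A1" "0 \<le> A2"
    and "(\<integral>\<^sup>+z. ennreal (norm (occ k s t (fst z) (snd z)) powr i) \<partial>(lborel \<Otimes>\<^sub>M M)) \<le> ennreal A1"
    and "(\<integral>\<^sup>+z. ennreal (norm (occ k s t (fst z) (snd z)) powr m) \<partial>(lborel \<Otimes>\<^sub>M M)) \<le> ennreal A2"
  shows "(\<integral>\<^sup>+z. ennreal (norm (occ k s t (fst z) (snd z)) powr Q) \<partial>(lborel \<Otimes>\<^sub>M M))
    \<le> ennreal (l powr (Q - i) * A1 + l powr (Q - m) * A2)"
proof -
  let ?f = "\<lambda>r z. ennreal (norm (occ k s t (fst z) (snd z)) powr r)"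
  have "(\<integral>\<^sup>+z. ?f Q z \<partial>(lborel \<Otimes>\<^sub>M M)) \<le> (\<integral>\<^sup>+z. ennreal (l powr (Q - i)) * ?f i z + ennreal (l powr (Q - m)) * ?f m z \<partial>(lborel \<Otimes>\<^sub>M M))"
    using powr_interpolate[OF _ assms(1-4)]
    by (intro nn_integral_mono) (auto simp: ennreal_mult'[symmetric] ennreal_plus[symmetric] simp del: ennreal_plus intro!: ennreal_leI)
  also have "\<dots> = ennreal (l powr (Q - i)) * (\<integral>\<^sup>+z. ?f i z \<partial>(lborel \<Otimes>\<^sub>M M)) + ennreal (l powr (Q - m)) * (\<integral>\<^sup>+z. ?f m z \<partial>(lborel \<Otimes>\<^sub>M M))"
    by (subst nn_integral_add) (auto simp: nn_integral_cmult)
  also have "\<dots> \<le> ennreal (l powr (Q - i)) * ennreal A1 + ennreal (l powr (Q - m)) * ennreal A2"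
    by (intro add_mono mult_left_mono assms) auto
  also have "\<dots> = ennreal (l powr (Q - i) * A1 + l powr (Q - m) * A2)"
    using assms by (simp add: ennreal_mult'[symmetric] ennreal_plus[symmetric] del: ennreal_plus)
  finally show ?thesis .
qed

text \<open>Regroups the bound as T^(Hd) times the power \<open>2 * i + 2\<close> of a size that
  does not depend on \<open>i\<close>, the form in which two even moments interpolate without
  loss.\<close>

lemma moment_even_powr:
  fixes \<beta> :: real and i :: nat
  assumes \<beta>: "0 \<le> \<beta>" "(2 * \<beta> + DIM('a)) * H < 1"
  shows "\<exists>C>0. \<forall>k s t. a \<le> s \<longrightarrow> s < t \<longrightarrow> t \<le> b \<longrightarrow>
    (\<integral>\<^sup>+z. ennreal (norm (occ k s t (fst z) (snd z)) powr (2 * i + 2)) \<partial>(lborel \<Otimes>\<^sub>M M))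
      \<le> ennreal (C * ((t - s) powr (H * DIM('a)) * ((2 ^ k) powr (- \<beta>) * (t - s) powr (1 - H * DIM('a) - \<beta> * H)) powr (2 * i + 2)))"
proof -
  define m where "m = 2 * i + 2"
  have m: "real m = 2 * i + 2" "m \<noteq> 0" by (auto simp: m_def)
  obtain C where C: "C > 0" "\<And>k s t. a \<le> s \<Longrightarrow> s < t \<Longrightarrow> t \<le> b \<Longrightarrow>
    (\<integral>\<^sup>+z. ennreal (norm (occ k s t (fst z) (snd z)) ^ m) \<partial>(lborel \<Otimes>\<^sub>M M))
      \<le> ennreal (C * (2 ^ k) powr (- \<beta> * m) * (t - s) powr (H * DIM('a) + m * (1 - H * DIM('a) - \<beta> * H)))"
    using moment_even[OF m_def \<beta>] by blast
  have eq: "C * (2 ^ k) powr (- \<beta> * m) * T powr (H * DIM('a) + m * (1 - H * DIM('a) - \<beta> * H))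
    = C * (T powr (H * DIM('a)) * ((2 ^ k) powr (- \<beta>) * T powr (1 - H * DIM('a) - \<beta> * H)) powr (2 * i + 2))"
    if "T > 0" for T :: real and k
    unfolding m(1)[symmetric] using that by (simp add: powr_mult powr_powr powr_add mult_ac)
  have n: "norm (occ k s t x w) powr (2 * i + 2) = norm (occ k s t x w) ^ m" for k s t x w
    unfolding m(1)[symmetric] using m(2) by (simp add: powr_realpow')
  show ?thesis unfolding n
  proof (intro exI[of _ C] conjI allI impI)
    fix k s t assume st: "a \<le> s" "s < t" "t \<le> b"
    then have "0 < t - s" by simp
    from C(2)[OF st, of k, unfolded eq[OF this]]
    show "(\<integral>\<^sup>+z. ennreal (norm (occ k s t (fst z) (snd z)) ^ m) \<partial>(lborel \<Otimes>\<^sub>M M))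
      \<le> ennreal (C * ((t - s) powr (H * DIM('a)) * ((2 ^ k) powr (- \<beta>) * (t - s) powr (1 - H * DIM('a) - \<beta> * H)) powr (2 * i + 2)))" .
  qed (rule C(1))
qed

text \<open>For Q \<ge> 2 the two neighbours are even moments with the same \<beta>. For Q < 2 the
  lower neighbour is the first moment, which has no decay, so the second moment must supply more
  than \<beta>; this produces the factor 1 - 1/Q in the hypothesis.\<close>

lemma moment_real:
  fixes \<beta> Q :: real
  assumes Q: "1 < Q" and \<beta>: "0 \<le> \<beta>" "\<beta> * H < (1 - H * DIM('a)) * min (1/2) (1 - 1 / Q)"
  shows "\<exists>C>0. \<forall>k s t. a \<le> s \<longrightarrow> s < t \<longrightarrow> t \<le> b \<longrightarrow>
    (\<integral>\<^sup>+z. ennreal (norm (occ k s t (fst z) (snd z)) powr Q) \<partial>(lborel \<Otimes>\<^sub>M M))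
      \<le> ennreal (C * (2 ^ k) powr (- \<beta> * Q) * (t - s) powr (H * DIM('a) + Q * (1 - H * DIM('a) - \<beta> * H)))"
proof (cases "2 \<le> Q")
  case True
  let ?d = "real DIM('a)"
  have "(1 - H * ?d) * min (1/2) (1 - 1 / Q) \<le> (1 - H * ?d) * (1/2)"
    using H_dim by (intro mult_left_mono[OF min.cobounded1]) simp
  with \<beta>(2) have "\<beta> * H < (1 - H * ?d) * (1/2)" by linarith
  then have \<beta>2: "(2 * \<beta> + ?d) * H < 1" by (simp add: algebra_simps)
  obtain i :: nat where i: "Q \<le> i" using real_arch_simple by blast
  obtain C1 where C1: "C1 > 0" "\<And>k s t. a \<le> s \<Longrightarrow> s < t \<Longrightarrow> t \<le> b \<Longrightarrow>
    (\<integral>\<^sup>+z. ennreal (norm (occ k s t (fst z) (snd z)) powr 2) \<partial>(lborel \<Otimes>\<^sub>M M))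
      \<le> ennreal (C1 * ((t - s) powr (H * DIM('a)) * ((2 ^ k) powr (- \<beta>) * (t - s) powr (1 - H * DIM('a) - \<beta> * H)) powr 2))"
    using moment_even_powr[OF \<beta>(1) \<beta>2, of 0] by auto
  obtain C2 where C2: "C2 > 0" "\<And>k s t. a \<le> s \<Longrightarrow> s < t \<Longrightarrow> t \<le> b \<Longrightarrow>
    (\<integral>\<^sup>+z. ennreal (norm (occ k s t (fst z) (snd z)) powr (2 * i + 2)) \<partial>(lborel \<Otimes>\<^sub>M M))
      \<le> ennreal (C2 * ((t - s) powr (H * DIM('a)) * ((2 ^ k) powr (- \<beta>) * (t - s) powr (1 - H * DIM('a) - \<beta> * H)) powr (2 * i + 2)))"
    using moment_even_powr[OF \<beta>(1) \<beta>2, of i] by auto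
  have "(\<integral>\<^sup>+z. ennreal (norm (occ k s t (fst z) (snd z)) powr Q) \<partial>(lborel \<Otimes>\<^sub>M M))
      \<le> ennreal ((C1 + C2) * (2 ^ k) powr (- \<beta> * Q) * (t - s) powr (H * ?d + Q * (1 - H * ?d - \<beta> * H)))"
    if st: "a \<le> s" "s < t" "t \<le> b" for k s t
  proof -
    define T where "T = t - s"
    have T: "T > 0" using st by (simp add: T_def)
    \<comment> \<open>The common size of both even moments; with this threshold each of the two
      terms becomes T^(Hd) l^Q.\<close>
    define l where "l = (2 ^ k) powr (- \<beta>) * T powr (1 - H * ?d - \<beta> * H)"
    have l: "l > 0" using T by (simp add: l_def)
    have "(\<integral>\<^sup>+z. ennreal (norm (occ k s t (fst z) (snd z)) powr Q) \<partial>(lborel \<Otimes>\<^sub>M M))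
      \<le> ennreal (l powr (Q - 2) * (C1 * (T powr (H * ?d) * l powr 2)) + l powr (Q - (2 * i + 2)) * (C2 * (T powr (H * ?d) * l powr (2 * i + 2))))"
      using C1(2)[OF st, of k] C2(2)[OF st, of k] C1(1) C2(1) i True l unfolding T_def[symmetric] l_def[symmetric]
      by (intro moment_interpolate) auto
    also have "l powr (Q - 2) * (C1 * (T powr (H * ?d) * l powr 2)) = C1 * T powr (H * ?d) * (l powr (Q - 2) * l powr 2)" by simp
    also have "l powr (Q - 2) * l powr 2 = l powr Q" by (simp only: powr_add[symmetric]) simp
    also have "l powr (Q - (2 * i + 2)) * (C2 * (T powr (H * ?d) * l powr (2 * i + 2))) = C2 * T powr (H * ?d) * (l powr (Q - (2 * i + 2)) * l powr (2 * i + 2))" by simp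
    also have "l powr (Q - (2 * i + 2)) * l powr (2 * i + 2) = l powr Q" by (simp only: powr_add[symmetric]) simp
    also have "C1 * T powr (H * ?d) * l powr Q + C2 * T powr (H * ?d) * l powr Q = (C1 + C2) * (T powr (H * ?d) * l powr Q)"
      by (simp add: algebra_simps)
    also have "T powr (H * ?d) * l powr Q = (2 ^ k) powr (- \<beta> * Q) * T powr (H * ?d + Q * (1 - H * ?d - \<beta> * H))"
      using T unfolding l_def by (simp add: powr_mult powr_powr powr_add mult_ac)
    finally show ?thesis by (simp add: T_def mult.assoc)
  qed
  then show ?thesis using C1(1) C2(1) by (intro exI[of _ "C1 + C2"]) auto
next
  case False
  let ?d = "real DIM('a)"
  \<comment> \<open>The decay needed from the second moment: interpolation keeps the fraction 2(Q -
    1)/Q of it, and that must be \<beta>. The admissibility condition for \<beta>' is then the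
    hypothesis with 1 - 1/Q.\<close>
  define \<beta>' where "\<beta>' = \<beta> * Q / (2 * (Q - 1))"
  have b': "0 \<le> \<beta>'" using Q \<beta> by (simp add: \<beta>'_def)
  have bb: "2 * \<beta>' * (Q - 1) = \<beta> * Q"
  proof -
    have "Q - 1 \<noteq> 0" using Q by simp
    then show ?thesis unfolding \<beta>'_def by (simp add: divide_simps del: right_diff_distrib_numeral)
  qed
  have "(1 - H * ?d) * min (1/2) (1 - 1 / Q) \<le> (1 - H * ?d) * (1 - 1 / Q)"
    using H_dim by (intro mult_left_mono[OF min.cobounded2]) simp
  with \<beta>(2) have "\<beta> * H < (1 - H * ?d) * (1 - 1 / Q)" by linarith
  then have "\<beta> * H * Q < (1 - H * ?d) * (1 - 1 / Q) * Q" using Q by (intro mult_strict_right_mono) auto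
  also have "\<dots> = (1 - H * ?d) * (Q - 1)" using Q by (simp add: field_simps)
  finally have "(2 * \<beta>' * H) * (Q - 1) < (1 - H * ?d) * (Q - 1)" using bb by (metis mult.assoc mult.commute)
  then have "2 * \<beta>' * H < 1 - H * ?d" using Q by (simp add: mult_less_cancel_right)
  then have \<beta>2: "(2 * \<beta>' + ?d) * H < 1" by (simp add: algebra_simps)
  obtain C1 where C1: "C1 > 0" "\<And>k s t. s \<le> t \<Longrightarrow>
    (\<integral>\<^sup>+z. ennreal (norm (occ k s t (fst z) (snd z))) \<partial>(lborel \<Otimes>\<^sub>M M)) \<le> ennreal (C1 * (t - s))"
    using moment_first by blast
  obtain C2 where C2: "C2 > 0" "\<And>k s t. a \<le> s \<Longrightarrow> s < t \<Longrightarrow> t \<le> b \<Longrightarrow>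
    (\<integral>\<^sup>+z. ennreal (norm (occ k s t (fst z) (snd z)) powr 2) \<partial>(lborel \<Otimes>\<^sub>M M))
      \<le> ennreal (C2 * ((t - s) powr (H * DIM('a)) * ((2 ^ k) powr (- \<beta>') * (t - s) powr (1 - H * DIM('a) - \<beta>' * H)) powr 2))"
    using moment_even_powr[OF b' \<beta>2, of 0] by auto
  have "(\<integral>\<^sup>+z. ennreal (norm (occ k s t (fst z) (snd z)) powr Q) \<partial>(lborel \<Otimes>\<^sub>M M))
      \<le> ennreal ((C1 + C2) * (2 ^ k) powr (- \<beta> * Q) * (t - s) powr (H * ?d + Q * (1 - H * ?d - \<beta> * H)))"
    if st: "a \<le> s" "s < t" "t \<le> b" for k s t
  proof -
    define T where "T = t - s"
    have T: "T > 0" using st by (simp add: T_def)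
    \<comment> \<open>The ratio of the bounds for the second and the first moment, at which the two
      terms balance.\<close>
    define l where "l = (2 ^ k) powr (- 2 * \<beta>') * T powr (1 - H * ?d - 2 * \<beta>' * H)"
    have l: "l > 0" using T by (simp add: l_def)
    have l2: "T powr (H * DIM('a)) * ((2 ^ k) powr (- \<beta>') * T powr (1 - H * DIM('a) - \<beta>' * H)) powr 2 = T * l"
    proof -
      have "T powr (H * DIM('a)) * ((2 ^ k) powr (- \<beta>') * T powr (1 - H * DIM('a) - \<beta>' * H)) powr 2
        = (2 ^ k) powr (- 2 * \<beta>') * T powr (1 + (1 - H * ?d - 2 * \<beta>' * H))"
        using T by (subst powr_mult) (auto simp: powr_powr powr_add[symmetric] algebra_simps simp del: powr_power)
      then show ?thesis using T by (simp only: powr_add l_def) simp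
    qed
    have "(\<integral>\<^sup>+z. ennreal (norm (occ k s t (fst z) (snd z)) powr Q) \<partial>(lborel \<Otimes>\<^sub>M M))
      \<le> ennreal (l powr (Q - 1) * (C1 * T) + l powr (Q - 2) * (C2 * (T * l)))"
      using C1(2)[of s t k] C2(2)[OF st, of k] C1(1) C2(1) False Q l T st unfolding l2[symmetric] T_def[symmetric]
      by (intro moment_interpolate) auto
    also have "l powr (Q - 2) * (C2 * (T * l)) = C2 * (T * (l powr (Q - 2) * l powr 1))" using l by simp
    also have "l powr (Q - 2) * l powr 1 = l powr (Q - 1)" by (simp only: powr_add[symmetric]) simp
    also have "l powr (Q - 1) * (C1 * T) + C2 * (T * l powr (Q - 1)) = (C1 + C2) * (T * l powr (Q - 1))"
      by (simp add: algebra_simps)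
    also have "T * l powr (Q - 1) = (2 ^ k) powr (- \<beta> * Q) * T powr (H * ?d + Q * (1 - H * ?d - \<beta> * H))"
    proof -
      have "l powr (Q - 1) = (2 ^ k) powr (- (2 * \<beta>' * (Q - 1))) * T powr ((1 - H * ?d) * (Q - 1) - 2 * \<beta>' * (Q - 1) * H)"
        unfolding l_def using T by (subst powr_mult) (auto simp: powr_powr algebra_simps)
      also have "T * \<dots> = (2 ^ k) powr (- \<beta> * Q) * T powr (1 + ((1 - H * ?d) * (Q - 1) - \<beta> * Q * H))"
        unfolding bb using T by (simp only: powr_add) simp
      also have "1 + ((1 - H * ?d) * (Q - 1) - \<beta> * Q * H) = H * ?d + Q * (1 - H * ?d - \<beta> * H)"
        by (simp add: algebra_simps)
      finally show ?thesis .
    qed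
    finally show ?thesis by (simp add: T_def mult.assoc)
  qed
  then show ?thesis using C1(1) C2(1) by (intro exI[of _ "C1 + C2"]) auto
qed

text \<open>The majorant \<open>Bd\<close> avoids the measurability of the uncountable supremum in \<open>block_size \<infinity>\<close>.\<close>

definition block_moments :: "ennreal \<Rightarrow> real \<Rightarrow> real \<Rightarrow> real \<Rightarrow> real \<Rightarrow> (nat \<Rightarrow> real \<Rightarrow> real \<Rightarrow> 'w \<Rightarrow> ennreal) \<Rightarrow> bool" where
  "block_moments q Q \<beta> \<gamma> C Bd \<longleftrightarrow>
     (\<forall>k s t. Bd k s t \<in> borel_measurable M) \<and>
     (\<forall>k s t. a \<le> s \<longrightarrow> s < t \<longrightarrow> t \<le> b \<longrightarrow>
        (\<forall>w\<in>space M. block_size q Q (\<lambda>x. occ k s t x w) \<le> Bd k s t w) \<and>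
        (\<integral>\<^sup>+w. Bd k s t w \<partial>M) \<le> ennreal (C * (2 ^ k) powr (- \<beta> * Q) * (t - s) powr (\<gamma> * Q)))"

lemma block_moments_finite:
  fixes \<beta> Q :: real
  assumes Q: "1 < Q" "q \<noteq> \<infinity>" and \<beta>: "0 \<le> \<beta>" "\<beta> * H < (1 - H * DIM('a)) * min (1/2) (1 - 1 / Q)"
  shows "\<exists>C>0. \<exists>Bd. block_moments q Q \<beta> (1 - H * DIM('a) - \<beta> * H + H * DIM('a) / Q) C Bd"
proof -
  obtain C where C: "C > 0" "\<And>k s t. a \<le> s \<Longrightarrow> s < t \<Longrightarrow> t \<le> b \<Longrightarrow>
    (\<integral>\<^sup>+z. ennreal (norm (occ k s t (fst z) (snd z)) powr Q) \<partial>(lborel \<Otimes>\<^sub>M M))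
      \<le> ennreal (C * (2 ^ k) powr (- \<beta> * Q) * (t - s) powr (H * DIM('a) + Q * (1 - H * DIM('a) - \<beta> * H)))"
    using moment_real[OF Q(1) \<beta>] by blast
  have e: "H * DIM('a) + Q * (1 - H * DIM('a) - \<beta> * H) = (1 - H * DIM('a) - \<beta> * H + H * DIM('a) / Q) * Q"
    using Q by (simp add: field_simps)
  have "block_moments q Q \<beta> (1 - H * DIM('a) - \<beta> * H + H * DIM('a) / Q) C
    (\<lambda>k s t w. \<integral>\<^sup>+x. ennreal (norm (occ k s t x w) powr Q) \<partial>lborel)"
    unfolding block_moments_def block_size_def
    using C(2) Q nn_integral_occ_swap[of "\<lambda>y. ennreal (norm y powr Q)"] by (auto simp: e)
  with C(1) show ?thesis by blast
qed

text \<open>The Lipschitz constant of a block is of order 2^(k(d+1)) T and enters with power d,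
  which costs 2^(kd(d+1)) and gains T^d. After normalisation by Q = m + d the exponents tend to
  \<beta> and 1 - Hd - \<beta>H as m grows.\<close>

lemma block_moments_sup:
  fixes \<beta> :: real and m i :: nat
  assumes m: "m = 2 * i + 2" and \<beta>: "0 \<le> \<beta>" "(2 * \<beta> + DIM('a)) * H < 1"
  defines "Q \<equiv> real m + DIM('a)"
  shows "\<exists>C>0. \<exists>Bd. block_moments \<infinity> Q ((\<beta> * m - DIM('a) * (DIM('a) + 1)) / Q)
    ((DIM('a) + H * DIM('a) + m * (1 - H * DIM('a) - \<beta> * H)) / Q) C Bd"
proof -
  let ?d = "DIM('a)"
  obtain C where C: "C > 0" "\<And>k s t. a \<le> s \<Longrightarrow> s < t \<Longrightarrow> t \<le> b \<Longrightarrow>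
    (\<integral>\<^sup>+z. ennreal (norm (occ k s t (fst z) (snd z)) ^ m) \<partial>(lborel \<Otimes>\<^sub>M M))
      \<le> ennreal (C * (2 ^ k) powr (- \<beta> * m) * (t - s) powr (H * DIM('a) + m * (1 - H * DIM('a) - \<beta> * H)))"
    using moment_even[OF m \<beta>] by blast
  define L where "L k T = 4/3 * symbol_vol ?d * 2 ^ (k * (?d + 1)) * T" for k :: nat and T :: real
  define c where "c T k = 2 ^ (m + ?d) * L k T ^ ?d / unit_ball_vol (real ?d)" for T k
  define Bd where "Bd k s t w = ennreal (c (t - s) k) * (\<integral>\<^sup>+x. ennreal (norm (occ k s t x w) ^ m) \<partial>lborel)" for k s t w
  define C' where "C' = 2 ^ (m + ?d) * (4/3 * symbol_vol ?d) ^ ?d / unit_ball_vol (real ?d) * C"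
  have vpos: "unit_ball_vol (real ?d) > 0" by simp
  have C': "C' > 0" unfolding C'_def using C(1) symbol_vol_pos[of ?d] vpos by (auto simp del: unit_ball_vol_pos intro!: mult_pos_pos divide_pos_pos)
  have Q: "Q > 0" by (simp add: Q_def m)
  have "block_moments \<infinity> Q ((\<beta> * m - ?d * (?d + 1)) / Q) ((?d + H * ?d + m * (1 - H * ?d - \<beta> * H)) / Q) C' Bd"
    unfolding block_moments_def
  proof (intro conjI allI impI ballI)
    show "Bd k s t \<in> borel_measurable M" for k s t unfolding Bd_def[abs_def] by measurable
    fix k s t assume st: "a \<le> s" "s < t" "t \<le> b"
    define T where "T = t - s"
    have T: "T > 0" using st by (simp add: T_def)
    have Lpos: "L k T > 0" unfolding L_def using T symbol_vol_pos[of ?d] by auto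
    { fix w assume w: "w \<in> space M"
      show "block_size \<infinity> Q (\<lambda>x. occ k s t x w) \<le> Bd k s t w"
        unfolding block_size_def
      proof (simp, rule SUP_least)
        fix x :: 'a
        have "norm (occ k s t x w) powr Q = norm (occ k s t x w) ^ (m + ?d)"
          using powr_realpow'[of "norm (occ k s t x w)" "m + ?d"] by (simp add: Q_def)
        moreover have "ennreal (norm (occ k s t x w) ^ (m + ?d)) \<le> Bd k s t w"
          unfolding Bd_def c_def T_def[symmetric]
          by (rule lipschitz_power_le_integral[OF _ Lpos])
             (use occ_lipschitz[OF w less_imp_le[OF st(2)], of k] w in \<open>auto simp: L_def T_def\<close>)
        ultimately show "ennreal (norm (occ k s t x w) powr Q) \<le> Bd k s t w" by simp
      qed }
    have cpos: "c T k \<ge> 0" unfolding c_def using Lpos vpos by (auto simp del: unit_ball_vol_pos)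
    have "(\<integral>\<^sup>+w. Bd k s t w \<partial>M) = ennreal (c T k) * (\<integral>\<^sup>+z. ennreal (norm (occ k s t (fst z) (snd z)) ^ m) \<partial>(lborel \<Otimes>\<^sub>M M))"
      unfolding Bd_def T_def[symmetric] using nn_integral_occ_swap[of "\<lambda>y. ennreal (norm y ^ m)"]
      by (subst nn_integral_cmult) auto
    also have "\<dots> \<le> ennreal (c T k) * ennreal (C * (2 ^ k) powr (- \<beta> * m) * T powr (H * ?d + m * (1 - H * ?d - \<beta> * H)))"
      unfolding T_def by (intro mult_left_mono C(2) st) auto
    also have "\<dots> = ennreal (c T k * (C * (2 ^ k) powr (- \<beta> * m) * T powr (H * ?d + m * (1 - H * ?d - \<beta> * H))))"
      using cpos C(1) by (intro ennreal_mult[symmetric]) auto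
    also have "c T k * (C * (2 ^ k) powr (- \<beta> * m) * T powr (H * ?d + m * (1 - H * ?d - \<beta> * H)))
      = C' * ((2 ^ k) powr (?d * (?d + 1)) * (2 ^ k) powr (- \<beta> * m)) * (T powr ?d * T powr (H * ?d + m * (1 - H * ?d - \<beta> * H)))"
    proof -
      have "(2 ^ (k * (?d + 1))) ^ ?d = ((2::real) ^ k) powr (?d * (?d + 1))"
      proof -
        have "((2::real) ^ k) powr (?d * (?d + 1)) = (2 ^ k) ^ (?d * (?d + 1))" by (subst powr_realpow) auto
        also have "\<dots> = (2 ^ (k * (?d + 1))) ^ ?d" unfolding power_mult[symmetric] by (simp only: mult_ac)
        finally show ?thesis by (rule sym)
      qed
      moreover have "T ^ ?d = T powr ?d" using T by (simp add: powr_realpow)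
      ultimately show ?thesis unfolding c_def C'_def L_def power_mult_distrib by simp
    qed
    also have "(2 ^ k) powr (?d * (?d + 1)) * (2 ^ k) powr (- \<beta> * m) = (2 ^ k) powr (- ((\<beta> * m - ?d * (?d + 1)) / Q) * Q)"
      using Q by (simp add: powr_add[symmetric])
    also have "T powr ?d * T powr (H * ?d + m * (1 - H * ?d - \<beta> * H)) = T powr ((?d + H * ?d + m * (1 - H * ?d - \<beta> * H)) / Q * Q)"
      using Q by (simp add: powr_add[symmetric] add.assoc)
    finally show "(\<integral>\<^sup>+w. Bd k s t w \<partial>M) \<le> ennreal (C' * (2 ^ k) powr (- ((\<beta> * m - ?d * (?d + 1)) / Q) * Q) *
      (t - s) powr ((?d + H * ?d + m * (1 - H * ?d - \<beta> * H)) / Q * Q))"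
      by (simp only: T_def)
  qed
  with C' show ?thesis by blast
qed

end

section \<open>Choice of the exponents\<close>

lemma enn2real_one_divide:
  assumes "1 \<le> (q::ennreal)" "q \<noteq> \<infinity>"
  shows "enn2real (1 / q) = 1 / enn2real q" "1 \<le> enn2real q"
proof -
  obtain r where r: "q = ennreal r" "0 \<le> r" using assms(2) by (cases q) auto
  have "1 \<le> r" using assms(1) r by (simp flip: ennreal_1)
  then show "enn2real (1 / q) = 1 / enn2real q" "1 \<le> enn2real q"
    using r by (simp_all add: divide_ennreal flip: ennreal_1)
qed

lemma exists_even_nat_mult_greater:
  fixes x1 x2 x3 e1 e2 :: real
  assumes "e1 > 0" "e2 > 0"
  shows "\<exists>i::nat. x1 < e1 * real (2 * i + 2) \<and> x2 < e2 * real (2 * i + 2) \<and> x3 < real (2 * i + 2)"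
proof -
  obtain i :: nat where i: "max (max (x1 / e1) (x2 / e2)) x3 < i" using reals_Archimedean2 by blast
  then have "x1 / e1 < real (2 * i + 2)" "x2 / e2 < real (2 * i + 2)" "x3 < real (2 * i + 2)" by auto
  then show ?thesis using assms by (auto simp: field_simps)
qed

context lnd_process begin

text \<open>\<alpha> < \<beta> will give summability over the blocks, 1 < \<gamma>P summability over
  the dyadic cells, and P \<le> Q subadditivity of the power P/Q. Both strict hypotheses leave room
  for \<beta>; for \<open>q = \<infinity>\<close> the room also pays for the loss in the supremum
  bound.\<close>

lemma block_moments_exist:
  fixes p q :: ennreal and \<alpha> :: real
  assumes \<alpha>: "0 \<le> \<alpha>" and pq: "1 \<le> p" "p \<le> q"
    and h1: "enn2real (1 / p) + (\<alpha> - DIM('a) * enn2real (1 / q)) * H < 1 - DIM('a) * H"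
    and h2: "\<alpha> < (1 / H - DIM('a)) * min (1 / 2) (1 - enn2real (1 / q))"
  shows "\<exists>Q P \<beta> \<gamma> C Bd. 1 \<le> P \<and> P \<le> Q \<and> \<alpha> < \<beta> \<and> 1 < \<gamma> * P \<and> (p \<noteq> \<infinity> \<longrightarrow> P = enn2real p)
    \<and> (q \<noteq> \<infinity> \<longrightarrow> Q = enn2real q) \<and> 0 < C \<and> block_moments q Q \<beta> \<gamma> C Bd"
proof (cases "q = \<infinity>")
  case False
  let ?d = "real DIM('a)"
  have q1: "1 \<le> q" using pq by (rule order_trans)
  have pf: "p \<noteq> \<infinity>" using pq False by (auto simp: top_unique)
  define Q where "Q = enn2real q"
  define P where "P = enn2real p"
  have iq: "enn2real (1 / q) = 1 / Q" "1 \<le> Q" using enn2real_one_divide[OF q1 False] by (auto simp: Q_def)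
  have ip: "enn2real (1 / p) = 1 / P" "1 \<le> P" using enn2real_one_divide[OF pq(1) pf] by (auto simp: P_def)
  have PQ: "P \<le> Q" unfolding P_def Q_def using pq(2) False by (intro enn2real_mono) (auto simp: less_top)
  \<comment> \<open>For \<open>q = 1\<close> the second hypothesis would read \<alpha> < 0.\<close>
  have "Q \<noteq> 1" using h2 \<alpha> unfolding iq by auto
  then have Q1: "1 < Q" using iq(2) by simp
  \<comment> \<open>\<open>u\<close> is the slack of the first hypothesis divided by H,
    \<open>v\<close> below that of the second; \<beta> exceeds \<alpha> by half of the smaller
    one.\<close>
  define u where "u = (1 - ?d * H - 1 / P) / H + ?d / Q - \<alpha>"
  have u: "u > 0" using h1 H_pos unfolding iq ip u_def by (simp add: field_simps)
  define v where "v = (1 / H - ?d) * min (1 / 2) (1 - 1 / Q) - \<alpha>"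
  have v: "v > 0" using h2 unfolding iq v_def by simp
  define \<beta> where "\<beta> = \<alpha> + min u v / 2"
  have b: "\<alpha> < \<beta>" "\<beta> < \<alpha> + u" "\<beta> < \<alpha> + v" using u v by (auto simp: \<beta>_def min_def)
  have "\<beta> * H < (\<alpha> + v) * H" using b H_pos by simp
  also have "\<dots> = (1 - H * ?d) * min (1 / 2) (1 - 1 / Q)" using H_pos by (simp add: v_def field_simps)
  finally have bv: "\<beta> * H < (1 - H * ?d) * min (1 / 2) (1 - 1 / Q)" .
  have b0: "0 \<le> \<beta>" using b \<alpha> by simp
  obtain C Bd where C: "C > 0" "block_moments q Q \<beta> (1 - H * ?d - \<beta> * H + H * ?d / Q) C Bd"
    using block_moments_finite[OF Q1 False b0 bv] by blast
  define \<gamma> where "\<gamma> = 1 - H * ?d - \<beta> * H + H * ?d / Q"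
  have "\<beta> * H < (\<alpha> + u) * H" using b H_pos by simp
  also have "(\<alpha> + u) * H = 1 - ?d * H - 1 / P + ?d / Q * H" using H_pos by (simp add: u_def field_simps)
  finally have "1 / P < \<gamma>" by (simp add: \<gamma>_def mult.commute)
  then have "1 < \<gamma> * P" using ip(2) by (simp add: field_simps)
  moreover have "block_moments q Q \<beta> \<gamma> C Bd" unfolding \<gamma>_def by (rule C(2))
  moreover note C(1) b(1) PQ ip(2) P_def Q_def
  ultimately show ?thesis by blast
next
  case True
  let ?d = "real DIM('a)"
  have iq: "enn2real (1 / q) = 0" using True by simp
  have h1': "enn2real (1 / p) + \<alpha> * H < 1 - ?d * H" using h1 unfolding iq by simp
  have h2': "\<alpha> < (1 / H - ?d) / 2" using h2 unfolding iq by simp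
  have "\<exists>P\<ge>1. (p \<noteq> \<infinity> \<longrightarrow> P = enn2real p) \<and> 1 / P + \<alpha> * H < 1 - ?d * H"
  proof (cases "p = \<infinity>")
    case False
    then show ?thesis using enn2real_one_divide[OF pq(1) False] h1' by (intro exI[of _ "enn2real p"]) auto
  next
    case True
    define w where "w = 1 - ?d * H - \<alpha> * H"
    have w: "w > 0" using h1' True by (simp add: w_def)
    \<comment> \<open>For \<open>p = \<infinity>\<close> the exponent is free, and any finite one
      with 1/P < w will do: it bounds every single increment.\<close>
    define P where "P = max 1 (2 / w)"
    have P: "P \<ge> 1" "P \<ge> 2 / w" by (auto simp: P_def)
    then have "2 / P \<le> w" using w by (simp add: field_simps)
    moreover have "1 / P < 2 / P" using P by (simp add: divide_strict_right_mono)
    ultimately have "1 / P + \<alpha> * H < 1 - ?d * H" unfolding w_def by linarith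
    then show ?thesis using P True by blast
  qed
  then obtain P where P: "1 \<le> P" "p \<noteq> \<infinity> \<longrightarrow> P = enn2real p" "1 / P + \<alpha> * H < 1 - ?d * H" by blast
  define u where "u = (1 - ?d * H - 1 / P) / H - \<alpha>"
  have u: "u > 0" using P(3) H_pos unfolding u_def by (simp add: field_simps)
  define v where "v = (1 / H - ?d) / 2 - \<alpha>"
  have v: "v > 0" using h2' unfolding v_def by simp
  define \<beta> where "\<beta> = \<alpha> + min u v / 2"
  have b: "\<alpha> < \<beta>" "\<beta> < \<alpha> + u" "\<beta> < \<alpha> + v" using u v by (auto simp: \<beta>_def min_def)
  have b0: "0 \<le> \<beta>" using b \<alpha> by simp
  have "\<beta> * H < (\<alpha> + v) * H" using b H_pos by simp
  also have "(\<alpha> + v) * H = (1 - ?d * H) / 2" using H_pos by (simp add: v_def field_simps)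
  finally have bv: "(2 * \<beta> + ?d) * H < 1" by (simp add: algebra_simps)
  define g where "g = 1 - H * ?d - \<beta> * H"
  have "\<beta> * H < (\<alpha> + u) * H" using b H_pos by simp
  also have "(\<alpha> + u) * H = 1 - ?d * H - 1 / P" using H_pos by (simp add: u_def field_simps)
  finally have g: "1 / P < g" by (simp add: g_def mult.commute)
  \<comment> \<open>In this order: the exponent of 2^k stays above \<alpha> after the loss d(d + 1),
    the time exponent times P stays above 1, and P \<le> Q.\<close>
  obtain i :: nat where i: "?d * (?d + 1) + \<alpha> * ?d < (\<beta> - \<alpha>) * real (2 * i + 2)" "?d / P < (g - 1 / P) * real (2 * i + 2)"
    "P < real (2 * i + 2)"
    using exists_even_nat_mult_greater[of "\<beta> - \<alpha>" "g - 1 / P"] b g by (metis diff_gt_0_iff_gt)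
  define m where "m = 2 * i + 2"
  define Q where "Q = real m + ?d"
  have Q: "Q > 0" by (simp add: Q_def m_def)
  obtain C Bd where C: "C > 0" "block_moments \<infinity> Q ((\<beta> * m - ?d * (?d + 1)) / Q) ((?d + H * ?d + m * (1 - H * ?d - \<beta> * H)) / Q) C Bd"
    using block_moments_sup[OF m_def b0 bv] unfolding Q_def by (simp only: of_nat_mult of_nat_add of_nat_1) blast
  have "P \<le> Q" using i(3) unfolding Q_def m_def by simp
  moreover have "\<alpha> < (\<beta> * m - ?d * (?d + 1)) / Q"
    using i(1) Q unfolding m_def[symmetric] by (simp add: Q_def pos_less_divide_eq algebra_simps)
  moreover have "1 < ((?d + H * ?d + m * (1 - H * ?d - \<beta> * H)) / Q) * P"
  proof -
    have "Q / P < m * g + 0" using i(2) unfolding m_def[symmetric] Q_def by (simp add: algebra_simps add_divide_distrib)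
    also have "\<dots> \<le> ?d + H * ?d + m * g" using H_pos by simp
    finally have "Q < (?d + H * ?d + m * g) * P" using P(1) by (simp add: pos_divide_less_eq)
    then show ?thesis using Q unfolding g_def[symmetric] by (simp add: field_simps)
  qed
  ultimately show ?thesis using C P(1,2) True by blast
qed

end

section \<open>Dyadic chaining\<close>

lemma ennreal_powr_ennreal: "0 \<le> x \<Longrightarrow> ennreal_powr (ennreal x) r = ennreal (x powr r)"
  by (simp add: ennreal_powr_def)

lemma ennreal_powr_top [simp]: "ennreal_powr \<top> r = \<top>"
  by (simp add: ennreal_powr_def)

lemma ennreal_powr_zero [simp]: "ennreal_powr 0 r = 0"
  by (simp add: ennreal_powr_def)

lemma ennreal_powr_mono:
  assumes "x \<le> y" "0 \<le> r"
  shows "ennreal_powr x r \<le> ennreal_powr y r"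
  using assms by (cases x; cases y)
    (auto simp: ennreal_powr_ennreal top_unique intro!: ennreal_leI powr_mono2)

lemma ennreal_powr_powr: "ennreal_powr (ennreal_powr x r) s = ennreal_powr x (r * s)"
  by (cases x) (auto simp: ennreal_powr_ennreal powr_powr)

lemma ennreal_powr_one: "ennreal_powr x 1 = x"
  by (cases x) (auto simp: ennreal_powr_ennreal)

lemma ennreal_powr_cmult:
  assumes "0 \<le> c" "0 < r"
  shows "ennreal_powr (ennreal c * x) r = ennreal (c powr r) * ennreal_powr x r"
proof (cases x)
  case (real y)
  then show ?thesis using assms by (simp add: ennreal_powr_ennreal ennreal_mult'[symmetric] powr_mult)
next
  case top
  then show ?thesis using assms
    by (cases "c = 0") (auto simp: ennreal_mult_top)
qed

text \<open>Normalise to x + y = 1: numbers in [0,1] are at most their power with exponent r \<le>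
  1.\<close>

lemma powr_add_le:
  fixes x y r :: real
  assumes "0 \<le> x" "0 \<le> y" "0 < r" "r \<le> 1"
  shows "(x + y) powr r \<le> x powr r + y powr r"
proof (cases "x + y = 0")
  case True
  then show ?thesis using assms by (simp add: add_nonneg_eq_0_iff)
next
  case False
  then have xy: "x + y > 0" using assms by simp
  have *: "z / (x + y) \<le> (z / (x + y)) powr r" if "0 \<le> z" "z \<le> x + y" for z
  proof (cases "z = 0")
    case False
    then have "(z / (x + y)) powr 1 \<le> (z / (x + y)) powr r"
      using that xy assms by (intro powr_mono') auto
    then show ?thesis using that False xy by simp
  qed simp
  have "1 = x / (x + y) + y / (x + y)" using xy by (simp add: add_divide_distrib[symmetric])
  also have "\<dots> \<le> (x / (x + y)) powr r + (y / (x + y)) powr r" using * assms by (intro add_mono) auto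
  also have "\<dots> = (x powr r + y powr r) / (x + y) powr r" using assms xy by (simp add: powr_divide add_divide_distrib)
  finally show ?thesis using xy by (simp add: field_simps)
qed

lemma ennreal_powr_add_le:
  assumes "0 < r" "r \<le> 1"
  shows "ennreal_powr (x + y) r \<le> ennreal_powr x r + ennreal_powr y r"
  using powr_add_le[OF _ _ assms]
  by (cases x; cases y)
     (auto simp: ennreal_powr_ennreal ennreal_plus[symmetric] simp del: ennreal_plus intro!: ennreal_leI)

lemma ennreal_powr_sum_le:
  assumes "0 < r" "r \<le> 1"
  shows "ennreal_powr (\<Sum>i\<in>A. f i) r \<le> (\<Sum>i\<in>A. ennreal_powr (f i) r)"
proof (induction A rule: infinite_finite_induct)
  case (insert i A)
  then show ?case
    using order_trans[OF ennreal_powr_add_le[OF assms] add_left_mono] by simp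
qed auto

lemma le_ennreal_powr_iff:
  assumes "0 < r"
  shows "ennreal_powr x r \<le> y \<longleftrightarrow> x \<le> ennreal_powr y (1 / r)"
proof
  assume "ennreal_powr x r \<le> y"
  from ennreal_powr_mono[OF this, of "1 / r"] assms show "x \<le> ennreal_powr y (1 / r)"
    by (simp add: ennreal_powr_powr ennreal_powr_one)
next
  assume "x \<le> ennreal_powr y (1 / r)"
  from ennreal_powr_mono[OF this, of r] assms show "ennreal_powr x r \<le> y"
    by (simp add: ennreal_powr_powr ennreal_powr_one)
qed

text \<open>Moving the power to the other side as a root reduces the claim to partial sums, so no
  continuity of the power is involved.\<close>

lemma ennreal_powr_suminf_le:
  assumes "0 < r" "r \<le> 1"
  shows "ennreal_powr (\<Sum>n. f n) r \<le> (\<Sum>n. ennreal_powr (f n) r)"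
  unfolding le_ennreal_powr_iff[OF assms(1)]
proof (rule suminf_le_const)
  show "summable f" by simp
  fix n
  have "ennreal_powr (\<Sum>i<n. f i) r \<le> (\<Sum>i<n. ennreal_powr (f i) r)" by (rule ennreal_powr_sum_le[OF assms])
  also have "\<dots> \<le> (\<Sum>n. ennreal_powr (f n) r)" by (rule sum_le_suminf) auto
  finally show "(\<Sum>i<n. f i) \<le> ennreal_powr (\<Sum>n. ennreal_powr (f n) r) (1 / r)"
    unfolding le_ennreal_powr_iff[OF assms(1)] .
qed

lemma ennreal_powr_measurable [measurable]: "(\<lambda>x. ennreal_powr x r) \<in> borel_measurable borel"
  unfolding ennreal_powr_def[abs_def] by measurable

section \<open>Dyadic cells and the chaining inequality\<close>

definition grid :: "real \<Rightarrow> real \<Rightarrow> nat \<Rightarrow> nat \<Rightarrow> real" where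
  "grid a b n i = a + (b - a) * (real i / 2 ^ n)"

definition cells :: "real \<Rightarrow> real \<Rightarrow> nat \<Rightarrow> real \<Rightarrow> real \<Rightarrow> nat set" where
  "cells a b n u v = {i. i < 2 ^ n \<and> u \<le> grid a b n i \<and> grid a b n (Suc i) \<le> v}"

lemma grid_diff: "grid a b n (Suc i) - grid a b n i = (b - a) / 2 ^ n"
  by (simp add: grid_def field_simps)

lemma grid_in: "a \<le> b \<Longrightarrow> i \<le> 2 ^ n \<Longrightarrow> grid a b n i \<in> {a..b}"
proof -
  assume "a \<le> b" "i \<le> 2 ^ n"
  then have "real i \<le> real (2 ^ n)" by (simp only: of_nat_le_iff)
  then have "real i / 2 ^ n \<le> 1" by (simp add: divide_le_eq_1)
  then have "(b - a) * (real i / 2 ^ n) \<le> (b - a) * 1" using \<open>a \<le> b\<close> by (intro mult_left_mono) auto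
  then show ?thesis using \<open>a \<le> b\<close> by (auto simp: grid_def)
qed

lemma finite_cells [simp]: "finite (cells a b n u v)"
  by (rule finite_subset[of _ "{..<2 ^ n}"]) (auto simp: cells_def)

text \<open>Seen on the grid: passing to the next level moves the last grid point below
  \<open>v\<close> by at most one fine cell. \<open>ceiling_double\<close> says the same for the
  first grid point above \<open>u\<close>.\<close>

lemma floor_double: "\<lfloor>2 * z\<rfloor> = 2 * \<lfloor>z\<rfloor> \<or> \<lfloor>2 * z\<rfloor> = 2 * \<lfloor>z\<rfloor> + 1" for z :: real
  by linarith

lemma ceiling_double: "\<lceil>2 * z\<rceil> = 2 * \<lceil>z\<rceil> \<or> \<lceil>2 * z\<rceil> = 2 * \<lceil>z\<rceil> - 1" for z :: real
  by linarith

lemma powr_sum_two_le: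
  fixes y y1 y2 S Q :: real
  assumes "0 \<le> y" "y \<le> y1 + y2" "0 \<le> y1" "0 \<le> y2" "y1 powr Q \<le> S" "y2 powr Q \<le> S" "0 < Q"
  shows "y powr Q \<le> 2 powr Q * S"
proof -
  have "y powr Q \<le> (2 * max y1 y2) powr Q" using assms by (intro powr_mono2) auto
  also have "\<dots> = 2 powr Q * max y1 y2 powr Q" using assms by (simp add: powr_mult)
  also have "\<dots> \<le> 2 powr Q * S" using assms by (intro mult_left_mono) (auto simp: max_def)
  finally show ?thesis .
qed

text \<open>The increments over the covered parts converge to \<open>F v - F u\<close>, and each
  refinement adds at most one cell at either end. The weights \<rho>^(nQ) force the correction at
  level n to be at most 2 \<rho>^(-n) times the \<open>Q\<close>-th root of the sum; the factor 2
  counts the ends and the geometric series gives the constant.\<close>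

lemma dyadic_chaining:
  fixes F :: "real \<Rightarrow> 'b::real_normed_vector" and Q \<rho> :: real
  assumes ab: "a < b" and cont: "continuous_on {a..b} F" and uv: "a \<le> u" "u \<le> v" "v \<le> b"
    and Q: "0 < Q" and \<rho>: "1 < \<rho>"
  shows "ennreal (norm (F v - F u) powr Q) \<le> ennreal ((2 / (1 - 1 / \<rho>)) powr Q) *
    (\<Sum>n. ennreal (\<rho> powr (n * Q)) *
      (\<Sum>i\<in>cells a b n u v. ennreal (norm (F (grid a b n (Suc i)) - F (grid a b n i)) powr Q)))"
proof (cases "u = v")
  case True
  then show ?thesis using Q by simp
next
  case False
  define K where "K = 2 / (1 - 1 / \<rho>)"
  have K: "K > 0" using \<rho> by (simp add: K_def)
  define S where "S n = (\<Sum>i\<in>cells a b n u v. norm (F (grid a b n (Suc i)) - F (grid a b n i)) powr Q)" for n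
  have S0: "S n \<ge> 0" for n unfolding S_def by (intro sum_nonneg) auto
  define \<delta> where "\<delta> = b - a"
  have \<delta>: "\<delta> > 0" using ab by (simp add: \<delta>_def)
  \<comment> \<open>\<open>lo n\<close> and \<open>hi n\<close> index the first and the last grid
    point of level \<open>n\<close> inside \<open>[u,v]\<close>. On coarse levels there may be none,
    and then \<open>hi n < lo n\<close>.\<close>
  define lo where "lo n = \<lceil>(u - a) / \<delta> * 2 ^ n\<rceil>" for n :: nat
  define hi where "hi n = \<lfloor>(v - a) / \<delta> * 2 ^ n\<rfloor>" for n :: nat
  have lo0: "lo n \<ge> 0" and hi0: "hi n \<ge> 0" for n 
  proof -
    have "0 \<le> (u - a) / \<delta> * 2 ^ n" "0 \<le> (v - a) / \<delta> * 2 ^ n" using uv \<delta> by auto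
    then show "lo n \<ge> 0" "hi n \<ge> 0" unfolding lo_def hi_def by linarith+
  qed
  define G where "G n j = grid a b n (nat j)" for n j
  have Gval: "G n j = a + \<delta> * (real_of_int j / 2 ^ n)" if "j \<ge> 0" for n j
    using that by (simp add: G_def grid_def \<delta>_def)
  have Gdouble: "G (Suc n) (2 * j) = G n j" if "j \<ge> 0" for n j using that by (simp add: Gval)
  have lo_iff: "u \<le> G n j \<longleftrightarrow> lo n \<le> j" if "j \<ge> 0" for n j
    unfolding Gval[OF that] lo_def ceiling_le_iff using \<delta> by (simp add: field_simps)
  have hi_iff: "G n j \<le> v \<longleftrightarrow> j \<le> hi n" if "j \<ge> 0" for n j
    unfolding Gval[OF that] hi_def le_floor_iff using \<delta> by (simp add: field_simps)
  have cellI: "norm (F (G n (j + 1)) - F (G n j)) powr Q \<le> S n" if "lo n \<le> j" "j + 1 \<le> hi n" for n j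
  proof -
    have j0: "j \<ge> 0" using that lo0[of n] by linarith
    have e: "G n (j + 1) = grid a b n (Suc (nat j))" "G n j = grid a b n (nat j)"
      using j0 by (auto simp: G_def nat_add_distrib)
    have "real_of_int (hi n) \<le> (v - a) / \<delta> * 2 ^ n" unfolding hi_def by linarith
    also have "\<dots> \<le> 1 * 2 ^ n" using uv \<delta> by (intro mult_right_mono) (auto simp: \<delta>_def divide_le_eq_1)
    finally have "real_of_int (hi n) \<le> real_of_int (2 ^ n)" by simp
    then have "hi n \<le> 2 ^ n" by (simp only: of_int_le_iff)
    then have "j + 1 \<le> 2 ^ n" using that by linarith
    then have "nat j < 2 ^ n" using j0 by (simp add: nat_less_iff)
    then have "nat j \<in> cells a b n u v"
      using that lo_iff[OF j0, of n] hi_iff[of "j + 1" n] j0 unfolding cells_def by (simp flip: e)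
    then show ?thesis unfolding S_def e by (intro member_le_sum[where f="\<lambda>i. norm (F (grid a b n (Suc i)) - F (grid a b n i)) powr Q"]) auto
  qed
  \<comment> \<open>the increment of \<open>F\<close> over the part of \<open>[u,v]\<close> that is covered by cells of level \<open>n\<close>\<close>
  define X where "X n = (if lo n \<le> hi n then F (G n (hi n)) - F (G n (lo n)) else 0)" for n
  have X0: "norm (X 0) powr Q \<le> 2 powr Q * S 0"
  proof (rule powr_sum_two_le[of _ "norm (X 0)" 0])
    \<comment> \<open>Level 0 has only the grid points \<open>a\<close> and \<open>b\<close>, so at
      most one cell is covered.\<close>
    have "hi 0 \<le> 1" unfolding hi_def using uv \<delta> by (simp add: floor_le_iff \<delta>_def divide_less_eq)
    then have "\<not> lo 0 \<le> hi 0 \<or> lo 0 = hi 0 \<or> (lo 0 = 0 \<and> hi 0 = 1)" using lo0[of 0] hi0[of 0] by linarith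
    then have "X 0 = 0 \<or> (lo 0 = 0 \<and> hi 0 = 1)" unfolding X_def by auto
    then show "norm (X 0) powr Q \<le> S 0" using cellI[of 0 0] S0 Q by (auto simp: X_def)
  qed (use Q S0 in auto)
  have Xstep: "norm (X (Suc n) - X n) powr Q \<le> 2 powr Q * S (Suc n)" for n
  proof -
    have h: "hi (Suc n) = 2 * hi n \<or> hi (Suc n) = 2 * hi n + 1"
      using floor_double[of "(v - a) / \<delta> * 2 ^ n"] by (simp add: hi_def mult_ac)
    have l: "lo (Suc n) = 2 * lo n \<or> lo (Suc n) = 2 * lo n - 1"
      using ceiling_double[of "(u - a) / \<delta> * 2 ^ n"] by (simp add: lo_def mult_ac)
    show ?thesis
    proof (cases "lo n \<le> hi n")
      case True
      then have le: "lo (Suc n) \<le> hi (Suc n)" using h l by linarith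
      define y1 where "y1 = norm (F (G (Suc n) (hi (Suc n))) - F (G (Suc n) (2 * hi n)))"
      define y2 where "y2 = norm (F (G (Suc n) (2 * lo n)) - F (G (Suc n) (lo (Suc n))))"
      have e: "X (Suc n) - X n = (F (G (Suc n) (hi (Suc n))) - F (G (Suc n) (2 * hi n))) + (F (G (Suc n) (2 * lo n)) - F (G (Suc n) (lo (Suc n))))"
        unfolding X_def using True le by (simp add: Gdouble lo0 hi0)
      have "norm (X (Suc n) - X n) \<le> y1 + y2" unfolding e y1_def y2_def by (rule norm_triangle_ineq)
      moreover have "y1 powr Q \<le> S (Suc n)"
        using h
      proof
        assume "hi (Suc n) = 2 * hi n + 1"
        then show ?thesis unfolding y1_def using cellI[of "Suc n" "2 * hi n"] True l by auto
      qed (use Q S0 in \<open>simp add: y1_def\<close>)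
      moreover have "y2 powr Q \<le> S (Suc n)"
        using l
      proof
        assume "lo (Suc n) = 2 * lo n - 1"
        then show ?thesis unfolding y2_def using cellI[of "Suc n" "2 * lo n - 1"] True h by auto
      qed (use Q S0 in \<open>simp add: y2_def\<close>)
      ultimately show ?thesis using Q by (intro powr_sum_two_le[of _ y1 y2]) (auto simp: y1_def y2_def)
    next
      case False
      \<comment> \<open>If level \<open>n\<close> has no grid point in \<open>[u,v]\<close>, the
        next level has at most one there, and one point spans no increment.\<close>
      then have "\<not> lo (Suc n) \<le> hi (Suc n) \<or> lo (Suc n) = hi (Suc n)" using h l by linarith
      then have "X (Suc n) = 0" unfolding X_def by auto
      then show ?thesis using False Q S0 by (simp add: X_def)
    qed
  qed
  have Glim_hi: "(\<lambda>n. G n (hi n)) \<longlonglongrightarrow> v"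
  proof (rule real_tendsto_sandwich)
    show "\<forall>\<^sub>F n in sequentially. v - \<delta> * (1/2) ^ n \<le> G n (hi n)"
    proof (rule always_eventually, rule allI)
      fix n :: nat
      have "(v - a) / \<delta> * 2 ^ n - 1 \<le> real_of_int (hi n)" unfolding hi_def by linarith
      then have "\<delta> * (((v - a) / \<delta> * 2 ^ n - 1) / 2 ^ n) \<le> \<delta> * (real_of_int (hi n) / 2 ^ n)"
        using \<delta> by (intro mult_left_mono divide_right_mono) auto
      moreover have "\<delta> * (((v - a) / \<delta> * 2 ^ n - 1) / 2 ^ n) = (v - a) - \<delta> * (1/2) ^ n"
        using \<delta> by (simp add: field_simps power_one_over)
      ultimately show "v - \<delta> * (1/2) ^ n \<le> G n (hi n)" unfolding Gval[OF hi0] by linarith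
    qed
    show "\<forall>\<^sub>F n in sequentially. G n (hi n) \<le> v" using hi_iff[OF hi0] by simp
    have "(\<lambda>n. v - \<delta> * (1/2) ^ n) \<longlonglongrightarrow> v - \<delta> * 0" by (intro tendsto_intros LIMSEQ_power_zero) auto
    then show "(\<lambda>n. v - \<delta> * (1/2) ^ n) \<longlonglongrightarrow> v" by simp
  qed simp
  have Glim_lo: "(\<lambda>n. G n (lo n)) \<longlonglongrightarrow> u"
  proof (rule real_tendsto_sandwich)
    show "\<forall>\<^sub>F n in sequentially. G n (lo n) \<le> u + \<delta> * (1/2) ^ n"
    proof (rule always_eventually, rule allI)
      fix n :: nat
      have "real_of_int (lo n) \<le> (u - a) / \<delta> * 2 ^ n + 1" unfolding lo_def by linarith
      then have "\<delta> * (real_of_int (lo n) / 2 ^ n) \<le> \<delta> * (((u - a) / \<delta> * 2 ^ n + 1) / 2 ^ n)"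
        using \<delta> by (intro mult_left_mono divide_right_mono) auto
      moreover have "\<delta> * (((u - a) / \<delta> * 2 ^ n + 1) / 2 ^ n) = (u - a) + \<delta> * (1/2) ^ n"
        using \<delta> by (simp add: field_simps power_one_over)
      ultimately show "G n (lo n) \<le> u + \<delta> * (1/2) ^ n" unfolding Gval[OF lo0] by linarith
    qed
    show "\<forall>\<^sub>F n in sequentially. u \<le> G n (lo n)" using lo_iff[OF lo0] by simp
    have "(\<lambda>n. u + \<delta> * (1/2) ^ n) \<longlonglongrightarrow> u + \<delta> * 0" by (intro tendsto_intros LIMSEQ_power_zero) auto
    then show "(\<lambda>n. u + \<delta> * (1/2) ^ n) \<longlonglongrightarrow> u" by simp
  qed simp
  have "\<forall>\<^sub>F n in sequentially. G n (lo n) < (u + v) / 2"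
    using order_tendstoD(2)[OF Glim_lo, of "(u + v) / 2"] False uv by simp
  moreover have "\<forall>\<^sub>F n in sequentially. (u + v) / 2 < G n (hi n)"
    using order_tendstoD(1)[OF Glim_hi, of "(u + v) / 2"] False uv by simp
  ultimately have ev: "\<forall>\<^sub>F n in sequentially. lo n \<le> hi n"
  proof eventually_elim
    case (elim n)
    have "(u + v) / 2 \<le> v" using uv by simp
    with elim(1) have "G n (lo n) \<le> v" by (rule order.trans[OF less_imp_le])
    then show ?case using hi_iff[OF lo0] by simp
  qed
  have conv: "(\<lambda>n. F (H n)) \<longlonglongrightarrow> F z" if "H \<longlonglongrightarrow> z" "z \<in> {a..b}" "\<forall>\<^sub>F n in sequentially. H n \<in> {a..b}" for H z
    using continuous_on_tendsto_compose[OF cont that] .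
  have "(\<lambda>n. F (G n (hi n)) - F (G n (lo n))) \<longlonglongrightarrow> F v - F u"
  proof (intro tendsto_diff conv Glim_hi Glim_lo)
    show "\<forall>\<^sub>F n in sequentially. G n (hi n) \<in> {a..b}"
      using hi_iff[OF hi0] uv hi0 \<delta> by (intro always_eventually allI) (auto simp: Gval intro: order_trans[of _ v])
    show "\<forall>\<^sub>F n in sequentially. G n (lo n) \<in> {a..b}"
      using ev
    proof eventually_elim
      case (elim n)
      then have "G n (lo n) \<le> v" using hi_iff[OF lo0] by simp
      moreover have "u \<le> G n (lo n)" using lo_iff[OF lo0] by simp
      ultimately show ?case using uv by auto
    qed
  qed (use uv in auto)
  then have Xlim: "X \<longlonglongrightarrow> F v - F u"
    by (rule Lim_transform_eventually) (use ev in \<open>eventually_elim, simp add: X_def\<close>)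
  define Z where "Z = (\<Sum>n. ennreal (\<rho> powr (n * Q)) * ennreal (S n))"
  have ZS: "Z = (\<Sum>n. ennreal (\<rho> powr (n * Q)) *
      (\<Sum>i\<in>cells a b n u v. ennreal (norm (F (grid a b n (Suc i)) - F (grid a b n i)) powr Q)))"
    unfolding Z_def S_def by (subst sum_ennreal) auto
  have "ennreal (norm (F v - F u) powr Q) \<le> ennreal (K powr Q) * Z"
  proof (cases Z)
    case top
    then show ?thesis using K by (simp add: ennreal_mult_top)
  next
    case (real z)
    \<comment> \<open>A single term of the series is at most its sum \<open>z\<close>, which turns a
      bound by the level sum \<open>S n\<close> into geometric decay in \<open>n\<close>.\<close>
    have yb: "y \<le> 2 * z powr (1 / Q) * (1 / \<rho>) ^ n" if "y powr Q \<le> 2 powr Q * S n" "0 \<le> y" for y n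
    proof -
      have "ennreal (\<rho> powr (n * Q)) * ennreal (S n) \<le> Z"
        unfolding Z_def using sum_le_suminf[of "\<lambda>n. ennreal (\<rho> powr (n * Q)) * ennreal (S n)" "{n}"] by simp
      then have "\<rho> powr (n * Q) * S n \<le> z"
        using real S0 by (simp add: ennreal_mult'[symmetric])
      then have "S n \<le> z * \<rho> powr (- (n * Q))" using \<rho> by (simp add: powr_minus field_simps)
      with that have "y powr Q \<le> 2 powr Q * (z * \<rho> powr (- (n * Q)))" by (meson mult_left_mono order_trans powr_ge_zero)
      then have "(y powr Q) powr (1 / Q) \<le> (2 powr Q * (z * \<rho> powr (- (n * Q)))) powr (1 / Q)"
        using Q by (intro powr_mono2) auto
      also have "\<dots> = 2 * (z powr (1 / Q) * \<rho> powr (- n))"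
        using Q real by (simp add: powr_mult powr_powr)
      also have "\<rho> powr (- n) = (1 / \<rho>) ^ n" using \<rho> by (simp add: powr_minus powr_realpow power_one_over field_simps)
      finally show ?thesis using that Q by (simp add: powr_powr mult.assoc)
    qed
    have bound: "norm (X n) \<le> K * z powr (1 / Q)" for n
    proof -
      have "norm (X n) \<le> 2 * z powr (1 / Q) * (\<Sum>j\<le>n. (1 / \<rho>) ^ j)"
      proof (induction n)
        case 0
        show ?case using yb[OF X0] by simp
      next
        case (Suc n)
        have "norm (X (Suc n)) \<le> norm (X n) + norm (X (Suc n) - X n)" using norm_triangle_sub by blast
        also have "\<dots> \<le> 2 * z powr (1 / Q) * (\<Sum>j\<le>n. (1 / \<rho>) ^ j) + 2 * z powr (1 / Q) * (1 / \<rho>) ^ Suc n"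
          by (intro add_mono Suc yb Xstep) auto
        finally show ?case by (simp add: distrib_left)
      qed
      also have "(\<Sum>j\<le>n. (1 / \<rho>) ^ j) \<le> (\<Sum>j. (1 / \<rho>) ^ j)"
        using \<rho> by (intro sum_le_suminf summable_geometric) auto
      also have "\<dots> = 1 / (1 - 1 / \<rho>)" using \<rho> by (intro suminf_geometric) auto
      finally show ?thesis by (simp add: K_def mult_left_mono)
    qed
    have "norm (F v - F u) \<le> K * z powr (1 / Q)"
      by (rule tendsto_upperbound[OF tendsto_norm[OF Xlim]]) (use bound in auto)
    then have "norm (F v - F u) powr Q \<le> (K * z powr (1 / Q)) powr Q" using Q by (intro powr_mono2) auto
    also have "\<dots> = K powr Q * z" using K Q real by (simp add: powr_mult powr_powr)
    finally show ?thesis using real by (simp add: ennreal_mult'[symmetric] ennreal_leI)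
  qed
  then show ?thesis unfolding ZS K_def .
qed

lemma grid_less: "a < b \<Longrightarrow> grid a b n i < grid a b n (Suc i)"
proof -
  assume "a < b"
  then have "0 < (b - a) / 2 ^ n" by simp
  then show ?thesis using grid_diff[of a b n i] by linarith
qed

section \<open>From single blocks to Besov norms of increments\<close>

lemma suminf_swap_ennreal:
  fixes f :: "nat \<Rightarrow> nat \<Rightarrow> ennreal"
  shows "(\<Sum>k. \<Sum>n. f k n) = (\<Sum>n. \<Sum>k. f k n)"
  using nn_integral_suminf[of "\<lambda>n k. f k n" "count_space UNIV"] by (simp add: nn_integral_count_space_nat)

text \<open>For finite \<open>q\<close> the two sides agree. For \<open>q = \<infinity>\<close> the
  essential supremum is bounded by the supremum, which needs no null sets in the chaining.\<close>

lemma Lp_norm_le_block_size: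
  fixes f :: "'a::euclidean_space \<Rightarrow> complex"
  assumes [measurable]: "f \<in> borel_measurable borel" and Q: "0 < Q" and q: "1 \<le> q" "q \<noteq> \<infinity> \<longrightarrow> Q = enn2real q"
  shows "Lp_norm lborel q (\<lambda>x. ennreal (norm (f x))) \<le> ennreal_powr (block_size q Q f) (1 / Q)"
proof (cases "q = \<infinity>")
  case True
  have "ennreal (norm (f x)) \<le> ennreal_powr (SUP x. ennreal (norm (f x) powr Q)) (1 / Q)" for x
  proof -
    have "ennreal_powr (ennreal (norm (f x))) Q = ennreal (norm (f x) powr Q)" by (simp add: ennreal_powr_ennreal)
    also have "\<dots> \<le> (SUP x. ennreal (norm (f x) powr Q))" by (rule SUP_upper) simp
    finally show ?thesis using le_ennreal_powr_iff[OF Q] by blast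
  qed
  then have "esssup lborel (\<lambda>x. ennreal (norm (f x))) \<le> ennreal_powr (SUP x. ennreal (norm (f x) powr Q)) (1 / Q)"
    by (intro esssup_I) auto
  then show ?thesis using True by (simp add: Lp_norm_def block_size_def)
next
  case False
  then show ?thesis using q Q enn2real_one_divide(1)[OF q(1) False]
    by (simp add: Lp_norm_def block_size_def ennreal_powr_ennreal)
qed

text \<open>The supremum over the blocks is replaced by a sum of \<open>P\<close>-th powers, which
  can be integrated term by term. The shift from \<open>k - 1\<close> to \<open>k\<close> in the
  weight is harmless because \<alpha> \<ge> 0.\<close>

lemma besov_norm_powr_le:
  fixes T :: "('a::euclidean_space \<Rightarrow> complex) \<Rightarrow> complex"
  assumes meas: "\<And>k. lp_block \<psi> \<phi> k T \<in> borel_measurable borel" and Q: "0 < Q" and q: "1 \<le> q" "q \<noteq> \<infinity> \<longrightarrow> Q = enn2real q"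
    and \<alpha>: "0 \<le> \<alpha>" and P: "0 < P"
  shows "ennreal_powr (besov_norm \<psi> \<phi> \<alpha> q \<infinity> T) P \<le>
    (\<Sum>k. ennreal ((2 ^ k) powr (\<alpha> * P)) * ennreal_powr (block_size q Q (lp_block \<psi> \<phi> k T)) (P / Q))"
  unfolding le_ennreal_powr_iff[OF P]
proof -
  let ?S = "\<Sum>k. ennreal ((2 ^ k) powr (\<alpha> * P)) * ennreal_powr (block_size q Q (lp_block \<psi> \<phi> k T)) (P / Q)"
  have "ennreal (2 powr (\<alpha> * (real k - 1))) * Lp_norm lborel q (\<lambda>x. ennreal (norm (lp_block \<psi> \<phi> k T x))) \<le> ennreal_powr ?S (1 / P)" for k
  proof -
    have "2 powr (\<alpha> * (real k - 1)) \<le> 2 powr (real k * \<alpha>)"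
      using \<alpha> by (intro powr_mono) (auto simp: algebra_simps)
    also have "\<dots> = (2 ^ k) powr \<alpha>" by (simp add: powr_powr[symmetric] powr_realpow)
    finally have "ennreal (2 powr (\<alpha> * (real k - 1))) * Lp_norm lborel q (\<lambda>x. ennreal (norm (lp_block \<psi> \<phi> k T x)))
      \<le> ennreal ((2 ^ k) powr \<alpha>) * ennreal_powr (block_size q Q (lp_block \<psi> \<phi> k T)) (1 / Q)"
      by (intro mult_mono ennreal_leI Lp_norm_le_block_size meas Q q) auto
    also have "\<dots> \<le> ennreal_powr ?S (1 / P)"
      unfolding le_ennreal_powr_iff[OF P, symmetric]
    proof -
      have "ennreal_powr (ennreal ((2 ^ k) powr \<alpha>) * ennreal_powr (block_size q Q (lp_block \<psi> \<phi> k T)) (1 / Q)) P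
        = ennreal ((2 ^ k) powr (\<alpha> * P)) * ennreal_powr (block_size q Q (lp_block \<psi> \<phi> k T)) (P / Q)"
        using P by (subst ennreal_powr_cmult) (auto simp: powr_powr ennreal_powr_powr)
      also have "\<dots> \<le> ?S"
        using sum_le_suminf[of "\<lambda>k. ennreal ((2 ^ k) powr (\<alpha> * P)) * ennreal_powr (block_size q Q (lp_block \<psi> \<phi> k T)) (P / Q)" "{k}"] by simp
      finally show "ennreal_powr (ennreal ((2 ^ k) powr \<alpha>) * ennreal_powr (block_size q Q (lp_block \<psi> \<phi> k T)) (1 / Q)) P \<le> ?S" .
    qed
    finally show ?thesis .
  qed
  then show "besov_norm \<psi> \<phi> \<alpha> q \<infinity> T \<le> ennreal_powr ?S (1 / P)"
    unfolding besov_norm_def Lp_norm_def[of "count_space UNIV"] by (simp, intro esssup_I) auto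
qed

text \<open>Taking expectations with \<open>\<epsilon>\<close> of the order of the mean of \<open>y\<close> replaces Jensen's inequality.\<close>

lemma ennreal_powr_le_interpolate:
  assumes "0 < \<epsilon>" "0 < r" "r \<le> 1"
  shows "ennreal_powr y r \<le> ennreal (\<epsilon> powr r) + ennreal (\<epsilon> powr (r - 1)) * y"
proof (cases y)
  case (real z)
  have "z powr r \<le> \<epsilon> powr r + \<epsilon> powr (r - 1) * z"
  proof (cases "z \<le> \<epsilon>")
    case True
    then have "z powr r \<le> \<epsilon> powr r" using real assms by (intro powr_mono2) auto
    then show ?thesis using real by (simp add: add_increasing2)
  next
    case False
    then have z: "z > 0" using assms by simp
    have "z powr r = z powr (r - 1) * z powr 1" by (simp only: powr_add[symmetric]) simp
    also have "\<dots> \<le> \<epsilon> powr (r - 1) * z powr 1" using False assms by (intro mult_right_mono powr_mono2') auto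
    finally show ?thesis using z by (simp add: add_increasing)
  qed
  then show ?thesis using real
    by (simp add: ennreal_powr_ennreal ennreal_mult'[symmetric] ennreal_plus[symmetric] ennreal_leI del: ennreal_plus)
next
  case top
  then show ?thesis using assms by (simp add: ennreal_mult_top)
qed

lemma nn_integral_ennreal_powr_le:
  assumes [measurable]: "X \<in> borel_measurable M" and "0 < \<epsilon>" "0 < r" "r \<le> 1" "0 \<le> C"
    and X: "(\<integral>\<^sup>+w. X w \<partial>M) \<le> ennreal (C * \<epsilon>)" and M: "emeasure M (space M) = 1"
  shows "(\<integral>\<^sup>+w. ennreal_powr (X w) r \<partial>M) \<le> ennreal ((1 + C) * \<epsilon> powr r)"
proof -
  have "(\<integral>\<^sup>+w. ennreal_powr (X w) r \<partial>M) \<le> (\<integral>\<^sup>+w. ennreal (\<epsilon> powr r) + ennreal (\<epsilon> powr (r - 1)) * X w \<partial>M)"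
    by (intro nn_integral_mono ennreal_powr_le_interpolate assms)
  also have "\<dots> = ennreal (\<epsilon> powr r) + ennreal (\<epsilon> powr (r - 1)) * (\<integral>\<^sup>+w. X w \<partial>M)"
    by (simp add: nn_integral_add nn_integral_cmult M)
  also have "\<dots> \<le> ennreal (\<epsilon> powr r) + ennreal (\<epsilon> powr (r - 1)) * ennreal (C * \<epsilon>)"
    by (intro add_left_mono mult_left_mono X) auto
  also have "\<dots> = ennreal ((1 + C) * \<epsilon> powr r)"
  proof -
    have "\<epsilon> powr (r - 1) * (C * \<epsilon>) = C * (\<epsilon> powr (r - 1) * \<epsilon> powr 1)" using assms by simp
    also have "\<epsilon> powr (r - 1) * \<epsilon> powr 1 = \<epsilon> powr r" by (simp only: powr_add[symmetric]) simp
    finally show ?thesis using assms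
      by (simp add: ennreal_mult'[symmetric] ennreal_plus[symmetric] distrib_right del: ennreal_plus)
  qed
  finally show ?thesis .
qed

context lnd_process begin

text \<open>Chaining is applied for each fixed \<open>x\<close>, where the block is Lipschitz in
  time. Integrating over \<open>x\<close> commutes with the sums, and a supremum over
  \<open>x\<close> may be taken in each summand.\<close>

lemma block_size_chaining:
  fixes u v Q \<rho> :: real
  assumes w: "w \<in> space M" and ab: "a < b" and uv: "a \<le> u" "u \<le> v" "v \<le> b"
    and Q: "0 < Q" and \<rho>: "1 < \<rho>"
  shows "block_size q Q (\<lambda>x. occ k u v x w) \<le> ennreal ((2 / (1 - 1 / \<rho>)) powr Q) *
    (\<Sum>n. ennreal (\<rho> powr (n * Q)) *
      (\<Sum>i\<in>cells a b n u v. block_size q Q (\<lambda>x. occ k (grid a b n i) (grid a b n (Suc i)) x w)))"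
proof -
  let ?K = "ennreal ((2 / (1 - 1 / \<rho>)) powr Q)"
  let ?f = "\<lambda>n i x. ennreal (norm (occ k (grid a b n i) (grid a b n (Suc i)) x w) powr Q)"
  have [measurable]: "(\<lambda>x. occ k s t x w) \<in> borel_measurable borel" for s t by (rule occ_measurable_x[OF w])
  have pw: "ennreal (norm (occ k u v x w) powr Q) \<le> ?K * (\<Sum>n. ennreal (\<rho> powr (n * Q)) * (\<Sum>i\<in>cells a b n u v. ?f n i x))" for x
  proof -
    have diff: "occ k a t x w - occ k a s x w = occ k s t x w" if "a \<le> s" "s \<le> t" for s t
      using occ_additive[OF w that, of k x] by simp
    have "continuous_on {a..b} (\<lambda>t. occ k a t x w)"
    proof (rule lipschitz_on_continuous_on[OF lipschitz_onI])
      let ?L = "symbol_vol DIM('a) * 2 ^ (k * DIM('a))"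
      show "0 \<le> ?L" using symbol_vol_pos[of "DIM('a)"] by simp
      fix s t assume "s \<in> {a..b}" "t \<in> {a..b}"
      then show "dist (occ k a s x w) (occ k a t x w) \<le> ?L * dist s t"
      proof (induction s t rule: linorder_wlog)
        case (le s t)
        then show ?case using diff[of s t] occ_bound[OF w, of s t k x]
          by (simp add: dist_norm norm_minus_commute[of "occ k a s x w"])
      qed (simp add: dist_commute)
    qed
    from dyadic_chaining[OF ab this uv Q \<rho>]
    have h: "ennreal (norm (occ k u v x w) powr Q) \<le> ?K * (\<Sum>n. ennreal (\<rho> powr (n * Q)) *
      (\<Sum>i\<in>cells a b n u v. ennreal (norm (occ k a (grid a b n (Suc i)) x w - occ k a (grid a b n i) x w) powr Q)))"
      unfolding diff[OF uv(1,2)] .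
    have "(\<Sum>i\<in>cells a b n u v. ennreal (norm (occ k a (grid a b n (Suc i)) x w - occ k a (grid a b n i) x w) powr Q))
      = (\<Sum>i\<in>cells a b n u v. ?f n i x)" for n
    proof (rule sum.cong[OF refl])
      fix i assume "i \<in> cells a b n u v"
      then have "a \<le> grid a b n i" using uv by (simp add: cells_def)
      moreover have "grid a b n i \<le> grid a b n (Suc i)" using grid_less[OF ab] by (rule less_imp_le)
      ultimately show "ennreal (norm (occ k a (grid a b n (Suc i)) x w - occ k a (grid a b n i) x w) powr Q) = ?f n i x"
        by (simp add: diff)
    qed
    then show ?thesis using h by simp
  qed
  show ?thesis
  proof (cases "q = \<infinity>")
    case True
    show ?thesis unfolding block_size_def if_P[OF True]
    proof (rule SUP_least)
      fix x :: 'a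
      note pw[of x]
      also have "?K * (\<Sum>n. ennreal (\<rho> powr (n * Q)) * (\<Sum>i\<in>cells a b n u v. ?f n i x))
        \<le> ?K * (\<Sum>n. ennreal (\<rho> powr (n * Q)) * (\<Sum>i\<in>cells a b n u v. SUP x. ?f n i x))"
        by (intro mult_left_mono suminf_le sum_mono SUP_upper) auto
      finally show "ennreal (norm (occ k u v x w) powr Q) \<le> ?K * (\<Sum>n. ennreal (\<rho> powr (n * Q)) * (\<Sum>i\<in>cells a b n u v. SUP x. ?f n i x))" .
    qed
  next
    case False
    have "(\<integral>\<^sup>+x. ennreal (norm (occ k u v x w) powr Q) \<partial>lborel)
      \<le> (\<integral>\<^sup>+x. ?K * (\<Sum>n. ennreal (\<rho> powr (n * Q)) * (\<Sum>i\<in>cells a b n u v. ?f n i x)) \<partial>lborel)"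
      by (intro nn_integral_mono pw)
    also have "\<dots> = ?K * (\<Sum>n. ennreal (\<rho> powr (n * Q)) * (\<Sum>i\<in>cells a b n u v. \<integral>\<^sup>+x. ?f n i x \<partial>lborel))"
      by (simp add: nn_integral_cmult nn_integral_suminf nn_integral_sum del: sum_ennreal)
    finally show ?thesis using False by (simp add: block_size_def)
  qed
qed

context
  fixes q :: ennreal and P Q \<alpha> \<beta> \<gamma> C :: real and Bd :: "nat \<Rightarrow> real \<Rightarrow> real \<Rightarrow> 'w \<Rightarrow> ennreal"
  assumes PQ: "1 \<le> P" "P \<le> Q" and q: "1 \<le> q" "q \<noteq> \<infinity> \<longrightarrow> Q = enn2real q"
    and \<alpha>: "0 \<le> \<alpha>" "\<alpha> < \<beta>" and \<gamma>: "1 < \<gamma> * P" and C: "0 < C" and Bd: "block_moments q Q \<beta> \<gamma> C Bd" and ab: "a < b"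
begin

text \<open>The chaining ratio \<rho>. It satisfies rate^(nP) = 2^(n(\<gamma>P - 1)/2), so it uses
  half of the surplus \<gamma>P - 1 and leaves the other half for summing over the levels.\<close>

definition rate :: real where "rate = 2 powr ((\<gamma> * P - 1) / (2 * P))"

text \<open>A measurable majorant for the \<open>P\<close>-th power of the Besov norm of the
  increment over one cell, as it results from \<open>besov_norm_powr_le\<close>.\<close>

definition cell_weight :: "nat \<Rightarrow> nat \<Rightarrow> 'w \<Rightarrow> ennreal" where
  "cell_weight n i w = (\<Sum>k. ennreal ((2 ^ k) powr (\<alpha> * P)) *
     ennreal_powr (Bd k (grid a b n i) (grid a b n (Suc i)) w) (P / Q))"

definition total_weight :: "'w \<Rightarrow> ennreal" where
  "total_weight w = (\<Sum>n. ennreal (rate powr (n * P)) * (\<Sum>i<2 ^ n. cell_weight n i w))"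

lemma rate_gt_1: "1 < rate"
  unfolding rate_def using \<gamma> PQ by (simp add: less_powr_iff)

lemma Bd_measurable [measurable]: "Bd k s t \<in> borel_measurable M"
  using Bd by (simp add: block_moments_def)

lemma cell_weight_measurable [measurable]: "cell_weight n i \<in> borel_measurable M"
  unfolding cell_weight_def[abs_def]
  by (intro borel_measurable_suminf_order borel_measurable_times_ennreal measurable_compose[OF Bd_measurable ennreal_powr_measurable]) auto

lemma nn_integral_cell_weight:
  assumes i: "i < 2 ^ n"
  shows "(\<integral>\<^sup>+w. cell_weight n i w \<partial>M) \<le>
    ennreal ((1 + C) * ((b - a) / 2 ^ n) powr (\<gamma> * P) / (1 - 2 powr (- ((\<beta> - \<alpha>) * P))))"
proof -
  define h where "h = (b - a) / 2 ^ n"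
  have h: "h > 0" using ab by (simp add: h_def)
  \<comment> \<open>Ratio of the geometric series over the blocks; it is below 1 because \<beta> >
    \<alpha>.\<close>
  define x where "x = 2 powr (- ((\<beta> - \<alpha>) * P))"
  have x: "0 < x" "x < 1" using \<alpha> PQ by (auto simp: x_def powr_less_one)
  let ?B = "\<lambda>k. Bd k (grid a b n i) (grid a b n (Suc i))"
  have each: "(\<integral>\<^sup>+w. ennreal_powr (?B k w) (P / Q) \<partial>M) \<le> ennreal ((1 + C) * ((2 ^ k) powr (- \<beta> * P) * h powr (\<gamma> * P)))" for k
  proof -
    \<comment> \<open>The mean of the block bound is at most \<open>C\<close> times this number,
      which is therefore the scale at which the power P/Q is replaced by an affine bound.\<close>
    let ?\<epsilon> = "(2 ^ k) powr (- \<beta> * Q) * h powr (\<gamma> * Q)"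
    have gi: "a \<le> grid a b n i" "grid a b n (Suc i) \<le> b" "grid a b n i < grid a b n (Suc i)" "grid a b n (Suc i) - grid a b n i = h"
      using grid_in[of a b i n] grid_in[of a b "Suc i" n] grid_diff[of a b n i] grid_less[OF ab, of n i] i ab by (auto simp: h_def)
    have "(\<integral>\<^sup>+w. ?B k w \<partial>M) \<le> ennreal (C * ?\<epsilon>)"
      using Bd gi unfolding block_moments_def by (metis mult.assoc)
    then have "(\<integral>\<^sup>+w. ennreal_powr (?B k w) (P / Q) \<partial>M) \<le> ennreal ((1 + C) * ?\<epsilon> powr (P / Q))"
      using PQ C h by (intro nn_integral_ennreal_powr_le) (auto simp: emeasure_space_1)
    also have "?\<epsilon> powr (P / Q) = (2 ^ k) powr (- \<beta> * P) * h powr (\<gamma> * P)"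
      using PQ by (simp add: powr_mult powr_powr)
    finally show ?thesis .
  qed
  have "(\<integral>\<^sup>+w. cell_weight n i w \<partial>M) = (\<Sum>k. ennreal ((2 ^ k) powr (\<alpha> * P)) * (\<integral>\<^sup>+w. ennreal_powr (?B k w) (P / Q) \<partial>M))"
    unfolding cell_weight_def by (simp add: nn_integral_suminf nn_integral_cmult)
  also have "\<dots> \<le> (\<Sum>k. ennreal ((2 ^ k) powr (\<alpha> * P)) * ennreal ((1 + C) * ((2 ^ k) powr (- \<beta> * P) * h powr (\<gamma> * P))))"
    by (intro suminf_le mult_left_mono each) auto
  also have "\<dots> = (\<Sum>k. ennreal ((1 + C) * h powr (\<gamma> * P) * x ^ k))"
  proof (rule suminf_cong)
    fix k
    have "(2 ^ k) powr (\<alpha> * P) * (2 ^ k) powr (- \<beta> * P) = x ^ k"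
    proof -
      have "(2 ^ k) powr (\<alpha> * P) * (2 ^ k) powr (- \<beta> * P) = (2 powr k) powr (- ((\<beta> - \<alpha>) * P))"
        by (simp add: powr_add[symmetric] powr_realpow algebra_simps)
      also have "\<dots> = (2 powr (- ((\<beta> - \<alpha>) * P))) powr k" by (simp add: powr_powr mult.commute)
      also have "\<dots> = x ^ k" unfolding x_def by (subst powr_realpow) auto
      finally show ?thesis .
    qed
    then have E: "(2 ^ k) powr (\<alpha> * P) * ((1 + C) * ((2 ^ k) powr (- \<beta> * P) * h powr (\<gamma> * P))) = (1 + C) * h powr (\<gamma> * P) * x ^ k"
      by (simp add: mult_ac)
    then show "ennreal ((2 ^ k) powr (\<alpha> * P)) * ennreal ((1 + C) * ((2 ^ k) powr (- \<beta> * P) * h powr (\<gamma> * P))) = ennreal ((1 + C) * h powr (\<gamma> * P) * x ^ k)"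
      unfolding E[symmetric] using C by (intro ennreal_mult'[symmetric]) auto
  qed
  also have "\<dots> = ennreal ((1 + C) * h powr (\<gamma> * P) * (1 / (1 - x)))"
  proof (rule suminf_ennreal_eq)
    show "(\<lambda>k. (1 + C) * h powr (\<gamma> * P) * x ^ k) sums ((1 + C) * h powr (\<gamma> * P) * (1 / (1 - x)))"
      using x by (intro sums_mult geometric_sums) auto
  qed (use C x in auto)
  finally show ?thesis by (simp add: h_def x_def)
qed

lemma total_weight_finite: "AE w in M. total_weight w < \<infinity>"
proof -
  define D where "D = (1 + C) * (b - a) powr (\<gamma> * P) / (1 - 2 powr (- ((\<beta> - \<alpha>) * P)))"
  have "2 powr (- ((\<beta> - \<alpha>) * P)) < 1" using \<alpha> PQ by (simp add: powr_less_one)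
  then have D0: "D \<ge> 0" unfolding D_def using C by simp
  \<comment> \<open>Ratio of the series over the levels: 2^n cells, the weight rate^(nP) and the
    mean 2^(-n\<gamma>P) of a cell multiply to 2^(-n(\<gamma>P - 1)/2).\<close>
  define y where "y = 2 powr (- (\<gamma> * P - 1) / 2)"
  have y: "0 < y" "y < 1" using \<gamma> by (auto simp: y_def powr_less_one)
  have [measurable]: "total_weight \<in> borel_measurable M" unfolding total_weight_def[abs_def] by measurable
  have "(\<integral>\<^sup>+w. total_weight w \<partial>M) = (\<Sum>n. ennreal (rate powr (n * P)) * (\<Sum>i<2 ^ n. \<integral>\<^sup>+w. cell_weight n i w \<partial>M))"
    unfolding total_weight_def by (simp add: nn_integral_suminf nn_integral_cmult nn_integral_sum)
  also have "\<dots> \<le> (\<Sum>n. ennreal (rate powr (n * P)) * (\<Sum>i<(2::nat) ^ n. ennreal (D * 2 powr (- (n * (\<gamma> * P))))))"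
  proof (intro suminf_le mult_left_mono sum_mono)
    fix n i :: nat assume "i \<in> {..<2 ^ n}"
    then have "(\<integral>\<^sup>+w. cell_weight n i w \<partial>M) \<le> ennreal ((1 + C) * ((b - a) / 2 ^ n) powr (\<gamma> * P) / (1 - 2 powr (- ((\<beta> - \<alpha>) * P))))"
      by (intro nn_integral_cell_weight) simp
    also have "((b - a) / 2 ^ n) powr (\<gamma> * P) = (b - a) powr (\<gamma> * P) * 2 powr (- (n * (\<gamma> * P)))"
    proof -
      have "(2 ^ n) powr (\<gamma> * P) = 2 powr (n * (\<gamma> * P))" by (simp add: powr_powr[symmetric] powr_realpow)
      then show ?thesis using ab by (simp add: powr_divide powr_minus_divide)
    qed
    finally show "(\<integral>\<^sup>+w. cell_weight n i w \<partial>M) \<le> ennreal (D * 2 powr (- (n * (\<gamma> * P))))"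
      by (simp add: D_def mult_ac)
  qed auto
  also have "\<dots> = (\<Sum>n. ennreal (D * y ^ n))"
  proof (rule suminf_cong)
    fix n :: nat
    have "rate powr (n * P) * (2 ^ n * 2 powr (- (n * (\<gamma> * P)))) = y ^ n"
    proof -
      have "rate powr (n * P) = 2 powr (n * ((\<gamma> * P - 1) / 2))" unfolding rate_def using PQ by (simp add: powr_powr mult.commute)
      moreover have "(2::real) ^ n = 2 powr n" by (simp add: powr_realpow)
      moreover have "y ^ n = 2 powr (n * (- (\<gamma> * P - 1) / 2))" unfolding y_def by (subst powr_realpow[symmetric]) (auto simp: powr_powr mult.commute)
      moreover have "n * ((\<gamma> * P - 1) / 2) + (n + - (n * (\<gamma> * P))) = n * (- (\<gamma> * P - 1) / 2)" by (simp add: field_simps)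
      ultimately show ?thesis by (simp only: powr_add[symmetric])
    qed
    then have E: "rate powr (n * P) * (2 ^ n * (D * 2 powr (- (n * (\<gamma> * P))))) = D * y ^ n"
      by (metis (no_types, opaque_lifting) mult.assoc mult.left_commute)
    have "(\<Sum>i<(2::nat) ^ n. ennreal (D * 2 powr (- (n * (\<gamma> * P))))) = ennreal (\<Sum>i<(2::nat) ^ n. D * 2 powr (- (n * (\<gamma> * P))))"
      using D0 by (intro sum_ennreal) auto
    also have "(\<Sum>i<(2::nat) ^ n. D * 2 powr (- (n * (\<gamma> * P)))) = 2 ^ n * (D * 2 powr (- (n * (\<gamma> * P))))" by simp
    finally show "ennreal (rate powr (n * P)) * (\<Sum>i<(2::nat) ^ n. ennreal (D * 2 powr (- (n * (\<gamma> * P))))) = ennreal (D * y ^ n)"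
      using D0 unfolding E[symmetric] by (simp only: ennreal_mult'[symmetric] powr_ge_zero)
  qed
  also have "\<dots> = ennreal (D * (1 / (1 - y)))"
  proof (rule suminf_ennreal_eq)
    show "(\<lambda>n. D * y ^ n) sums (D * (1 / (1 - y)))" using y by (intro sums_mult geometric_sums) auto
  qed (use D0 y in auto)
  also have "\<dots> < \<infinity>" by simp
  finally have "(\<integral>\<^sup>+w. total_weight w \<partial>M) \<noteq> \<infinity>" by simp
  then have "AE w in M. total_weight w \<noteq> \<infinity>" by (intro nn_integral_noteq_infinite) auto
  then show ?thesis by eventually_elim (simp add: less_top)
qed

text \<open>Chaining holds for \<open>Q\<close>-th powers, while the variation needs
  \<open>P\<close>-th powers. The power P/Q is at most 1, hence subadditive, and passes through both
  sums; exchanging levels and blocks then assembles the cell weights.\<close>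

lemma besov_norm_increment_le:
  assumes w: "w \<in> space M" and uv: "a \<le> u" "u \<le> v" "v \<le> b"
    and T: "\<And>k x. lp_block \<psi> \<phi> k T x = occ k u v x w"
  shows "ennreal_powr (besov_norm \<psi> \<phi> \<alpha> q \<infinity> T) P \<le> ennreal ((2 / (1 - 1 / rate)) powr P) *
    (\<Sum>n. ennreal (rate powr (n * P)) * (\<Sum>i\<in>cells a b n u v. cell_weight n i w))"
proof -
  let ?r = "P / Q" and ?K = "2 / (1 - 1 / rate)"
  have r: "0 < ?r" "?r \<le> 1" and Q: "0 < Q" and P: "0 < P" using PQ by auto
  have K: "?K > 0" using rate_gt_1 by simp
  let ?B = "\<lambda>k n i. Bd k (grid a b n i) (grid a b n (Suc i)) w"
  have T': "lp_block \<psi> \<phi> k T = (\<lambda>x. occ k u v x w)" for k using T by (rule ext)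
  have blk: "ennreal_powr (block_size q Q (\<lambda>x. occ k u v x w)) ?r \<le>
    ennreal (?K powr P) * (\<Sum>n. ennreal (rate powr (n * P)) * (\<Sum>i\<in>cells a b n u v. ennreal_powr (?B k n i) ?r))" for k
  proof -
    have "block_size q Q (\<lambda>x. occ k u v x w) \<le> ennreal (?K powr Q) * (\<Sum>n. ennreal (rate powr (n * Q)) * (\<Sum>i\<in>cells a b n u v. block_size q Q (\<lambda>x. occ k (grid a b n i) (grid a b n (Suc i)) x w)))"
      by (rule block_size_chaining[OF w ab uv Q rate_gt_1])
    also have "\<dots> \<le> ennreal (?K powr Q) * (\<Sum>n. ennreal (rate powr (n * Q)) * (\<Sum>i\<in>cells a b n u v. ?B k n i))"
    proof (intro mult_left_mono suminf_le sum_mono)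
      fix n i assume "i \<in> cells a b n u v"
      then have i: "i < 2 ^ n" by (simp add: cells_def)
      have gi: "a \<le> grid a b n i" "grid a b n (Suc i) \<le> b" "grid a b n i < grid a b n (Suc i)"
        using grid_in[of a b i n] grid_in[of a b "Suc i" n] grid_less[OF ab, of n i] i ab by auto
      show "block_size q Q (\<lambda>x. occ k (grid a b n i) (grid a b n (Suc i)) x w) \<le> ?B k n i"
        using Bd gi w unfolding block_moments_def by blast
    qed auto
    finally have "ennreal_powr (block_size q Q (\<lambda>x. occ k u v x w)) ?r \<le>
      ennreal_powr (ennreal (?K powr Q) * (\<Sum>n. ennreal (rate powr (n * Q)) * (\<Sum>i\<in>cells a b n u v. ?B k n i))) ?r"
      using r by (intro ennreal_powr_mono) auto
    also have "\<dots> = ennreal (?K powr P) * ennreal_powr (\<Sum>n. ennreal (rate powr (n * Q)) * (\<Sum>i\<in>cells a b n u v. ?B k n i)) ?r"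
      using r Q by (subst ennreal_powr_cmult) (auto simp: powr_powr)
    also have "\<dots> \<le> ennreal (?K powr P) * (\<Sum>n. ennreal_powr (ennreal (rate powr (n * Q)) * (\<Sum>i\<in>cells a b n u v. ?B k n i)) ?r)"
      using r by (intro mult_left_mono ennreal_powr_suminf_le) auto
    also have "\<dots> \<le> ennreal (?K powr P) * (\<Sum>n. ennreal (rate powr (n * P)) * (\<Sum>i\<in>cells a b n u v. ennreal_powr (?B k n i) ?r))"
    proof (intro mult_left_mono suminf_le)
      fix n
      have "ennreal_powr (ennreal (rate powr (n * Q)) * (\<Sum>i\<in>cells a b n u v. ?B k n i)) ?r
        = ennreal (rate powr (n * P)) * ennreal_powr (\<Sum>i\<in>cells a b n u v. ?B k n i) ?r"
        using r Q by (subst ennreal_powr_cmult) (auto simp: powr_powr)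
      also have "\<dots> \<le> ennreal (rate powr (n * P)) * (\<Sum>i\<in>cells a b n u v. ennreal_powr (?B k n i) ?r)"
        using r by (intro mult_left_mono ennreal_powr_sum_le) auto
      finally show "ennreal_powr (ennreal (rate powr (n * Q)) * (\<Sum>i\<in>cells a b n u v. ?B k n i)) ?r
        \<le> ennreal (rate powr (n * P)) * (\<Sum>i\<in>cells a b n u v. ennreal_powr (?B k n i) ?r)" .
    qed auto
    finally show ?thesis .
  qed
  have "ennreal_powr (besov_norm \<psi> \<phi> \<alpha> q \<infinity> T) P \<le>
    (\<Sum>k. ennreal ((2 ^ k) powr (\<alpha> * P)) * ennreal_powr (block_size q Q (lp_block \<psi> \<phi> k T)) ?r)"
    by (rule besov_norm_powr_le[OF _ Q q \<alpha>(1) P]) (use occ_measurable_x[OF w] in \<open>simp add: T'\<close>)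
  also have "\<dots> \<le> (\<Sum>k. ennreal ((2 ^ k) powr (\<alpha> * P)) * (ennreal (?K powr P) * (\<Sum>n. ennreal (rate powr (n * P)) * (\<Sum>i\<in>cells a b n u v. ennreal_powr (?B k n i) ?r))))"
    unfolding T' by (intro suminf_le mult_left_mono blk) auto
  also have "\<dots> = ennreal (?K powr P) * (\<Sum>k. \<Sum>n. ennreal (rate powr (n * P)) * (\<Sum>i\<in>cells a b n u v. ennreal ((2 ^ k) powr (\<alpha> * P)) * ennreal_powr (?B k n i) ?r))"
    by (simp only: ennreal_suminf_cmult[symmetric] sum_distrib_left mult_ac)
  also have "(\<Sum>k. \<Sum>n. ennreal (rate powr (n * P)) * (\<Sum>i\<in>cells a b n u v. ennreal ((2 ^ k) powr (\<alpha> * P)) * ennreal_powr (?B k n i) ?r))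
    = (\<Sum>n. \<Sum>k. ennreal (rate powr (n * P)) * (\<Sum>i\<in>cells a b n u v. ennreal ((2 ^ k) powr (\<alpha> * P)) * ennreal_powr (?B k n i) ?r))"
    by (rule suminf_swap_ennreal)
  also have "\<dots> = (\<Sum>n. ennreal (rate powr (n * P)) * (\<Sum>i\<in>cells a b n u v. cell_weight n i w))"
    unfolding cell_weight_def by (simp add: suminf_sum)
  finally show ?thesis .
qed

end

end

section \<open>Paths of finite variation in the Besov space\<close>

lemma besov_norm_minus_commute:
  "besov_norm \<psi> \<phi> s p q (T - U) = besov_norm \<psi> \<phi> s p q (U - T)"
  unfolding besov_norm_def lp_block_def by (simp add: norm_minus_commute)

text \<open>The seminorm is a supremum of reals and bounds its terms only if they are bounded, which
  the Schwartz condition without weight and derivatives supplies.\<close>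

lemma schwartz_bounded_by_seminorm:
  assumes "f \<in> schwartz" shows "norm (f x) \<le> schwartz_seminorm 0 f"
proof -
  have "bounded (range (\<lambda>x. (1 + norm x) ^ 0 *\<^sub>R iter_deriv [] f x))"
  proof -
    have "\<forall>vs N. set vs \<subseteq> Basis \<longrightarrow> bounded (range (\<lambda>x. (1 + norm x) ^ N *\<^sub>R iter_deriv vs f x))"
      using assms by (simp add: schwartz_def)
    from this[rule_format, of "[]" 0] show ?thesis by simp
  qed
  then have "bounded (range f)" by simp
  then obtain B where B: "\<And>x. norm (f x) \<le> B" unfolding bounded_iff by auto
  let ?A = "{vs. set vs \<subseteq> Basis \<and> length vs \<le> 0} \<times> UNIV :: ('a list \<times> 'a) set"
  let ?g = "\<lambda>p. case p of (vs, x) \<Rightarrow> (1 + norm x) ^ 0 * norm (iter_deriv vs f x)"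
  have "?g ([], x) \<le> (SUP p\<in>?A. ?g p)"
    by (rule cSUP_upper) (use B in \<open>auto intro!: bdd_aboveI2\<close>)
  then show ?thesis by (simp add: schwartz_seminorm_def)
qed

lemma schwartz_continuous: "f \<in> schwartz \<Longrightarrow> continuous_on UNIV f"
  by (rule smooth_continuous) (simp add: schwartz_def)

lemma measure_distribution_occupation:
  assumes X: "continuous_on UNIV X" and g [measurable]: "g \<in> borel_measurable borel"
  shows "measure_distribution (occupation_measure X a t) g = (\<integral>\<tau>. indicator {a..t} \<tau> *\<^sub>R g (X \<tau>) \<partial>lborel)"
proof -
  have [measurable]: "X \<in> borel_measurable borel" using X by (rule borel_measurable_continuous_onI)
  have "X \<in> restrict_space lborel {a..t} \<rightarrow>\<^sub>M borel" by (rule measurable_restrict_space1) simp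
  then show ?thesis unfolding measure_distribution_def occupation_measure_def
    by (subst integral_distr) (auto simp: integral_restrict_space)
qed

lemma tempered_occupation_measure:
  fixes X :: "real \<Rightarrow> 'a::euclidean_space"
  assumes X: "continuous_on UNIV X" and at: "a \<le> t"
  shows "tempered_distribution (measure_distribution (occupation_measure X a t))"
proof -
  have m: "f \<in> borel_measurable borel" if "f \<in> schwartz" for f :: "'a \<Rightarrow> complex"
    using schwartz_continuous[OF that] by (rule borel_measurable_continuous_onI)
  have int: "integrable lborel (\<lambda>\<tau>. indicator {a..t} \<tau> *\<^sub>R f (X \<tau>))" if "f \<in> schwartz" for f
    by (intro borel_integrable_compact continuous_on_compose2[OF schwartz_continuous[OF that]] continuous_on_subset[OF X]) auto
  show ?thesis unfolding tempered_distribution_def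
  proof (intro conjI ballI allI)
    fix f g :: "'a \<Rightarrow> complex" assume fg: "f \<in> schwartz" "g \<in> schwartz"
    note [measurable] = m[OF fg(1)] m[OF fg(2)]
    show "measure_distribution (occupation_measure X a t) (\<lambda>x. f x + g x) =
      measure_distribution (occupation_measure X a t) f + measure_distribution (occupation_measure X a t) g"
      by (simp add: measure_distribution_occupation[OF X] scaleR_add_right Bochner_Integration.integral_add int fg)
  next
    fix c and f :: "'a \<Rightarrow> complex" assume f: "f \<in> schwartz"
    show "measure_distribution (occupation_measure X a t) (\<lambda>x. c * f x) = c * measure_distribution (occupation_measure X a t) f"
      unfolding measure_distribution_def by (rule integral_mult_right_zero)
  next
    show "\<exists>C N. \<forall>f\<in>schwartz. norm (measure_distribution (occupation_measure X a t) f) \<le> C * schwartz_seminorm N f"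
    proof (intro exI ballI)
      fix f :: "'a \<Rightarrow> complex" assume f: "f \<in> schwartz"
      have "norm (measure_distribution (occupation_measure X a t) f) \<le> (\<integral>\<tau>. norm (indicator {a..t} \<tau> *\<^sub>R f (X \<tau>)) \<partial>lborel)"
        unfolding measure_distribution_occupation[OF X m[OF f]] by (rule integral_norm_bound)
      also have "\<dots> \<le> (\<integral>\<tau>. indicator {a..t} \<tau> * schwartz_seminorm 0 f \<partial>lborel)"
      proof (rule integral_mono)
        show "integrable lborel (\<lambda>\<tau>. indicator {a..t} \<tau> * schwartz_seminorm 0 f)"
          by (intro integrable_mult_left integrable_real_indicator) (use at in auto)
      qed (use integrable_norm[OF int[OF f]] schwartz_bounded_by_seminorm[OF f] in \<open>auto simp: indicator_def\<close>)
      also have "\<dots> = (t - a) * schwartz_seminorm 0 f" using at by simp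
      finally show "norm (measure_distribution (occupation_measure X a t) f) \<le> (t - a) * schwartz_seminorm 0 f" .
    qed
  qed
qed

lemma ennreal_powr_finite: "x < \<infinity> \<Longrightarrow> ennreal_powr x r < \<infinity>"
  by (cases x) (auto simp: ennreal_powr_ennreal)

lemma cells_subset: "cells a b n u v \<subseteq> {..<2 ^ n}"
  by (auto simp: cells_def)

lemma cells_empty:
  assumes "v - u < (b - a) / 2 ^ n" shows "cells a b n u v = {}"
proof (rule ccontr)
  assume "cells a b n u v \<noteq> {}"
  then obtain i where "u \<le> grid a b n i" "grid a b n (Suc i) \<le> v" by (auto simp: cells_def)
  with grid_diff[of a b n i] assms show False by linarith
qed

lemma cells_disjoint:
  assumes "a < b" "v \<le> u'" shows "cells a b n u v \<inter> cells a b n u' v' = {}"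
proof (rule ccontr)
  assume "cells a b n u v \<inter> cells a b n u' v' \<noteq> {}"
  then obtain i where "grid a b n (Suc i) \<le> v" "u' \<le> grid a b n i" by (auto simp: cells_def)
  with grid_less[OF assms(1), of n i] assms(2) show False by linarith
qed

lemma ennreal_tail_small:
  fixes h :: "nat \<Rightarrow> ennreal"
  assumes "(\<Sum>n. h n) < \<infinity>" "0 < e"
  shows "\<exists>n0. (\<Sum>n. h (n + n0)) < ennreal e"
proof -
  have fin: "h n < top" for n
  proof -
    have "h n \<le> (\<Sum>n. h n)" using sum_le_suminf[of h "{n}"] by simp
    then show ?thesis using assms(1) by (simp add: order_le_less_trans)
  qed
  define h' where "h' n = enn2real (h n)" for n
  have hh: "h n = ennreal (h' n)" for n using fin[of n] by (simp add: h'_def)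
  have h0: "h' n \<ge> 0" for n by (simp add: h'_def)
  have s: "summable h'" using assms(1) h0 unfolding hh by (intro summable_suminf_not_top) auto
  from suminf_exist_split[OF assms(2) s] obtain n0 where n0: "norm (\<Sum>i. h' (i + n0)) < e" by blast
  have "(\<Sum>n. h (n + n0)) = ennreal (\<Sum>i. h' (i + n0))"
    unfolding hh using h0 s by (intro suminf_ennreal2) (auto simp: summable_iff_shift)
  also have "\<dots> < ennreal e" using n0 assms(2) by (intro ennreal_lessI) auto
  finally show ?thesis by blast
qed

context lnd_process begin

lemma lp_block_increment:
  assumes w: "w \<in> space M" and st: "a \<le> s" "s \<le> t"
  shows "lp_block \<psi> \<phi> k (measure_distribution (occupation_measure (\<lambda>\<tau>. \<omega> \<tau> w) a t)
    - measure_distribution (occupation_measure (\<lambda>\<tau>. \<omega> \<tau> w) a s)) x = occ k s t x w"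
proof -
  have "(\<lambda>y. lp_kernel \<psi> \<phi> k (x - y)) \<in> borel_measurable borel"
    using lp_kernel_measurable[OF dy, of k] by simp
  from measure_distribution_occupation[OF path_continuous[OF w] this]
  have "measure_distribution (occupation_measure (\<lambda>\<tau>. \<omega> \<tau> w) a t) (\<lambda>y. lp_kernel \<psi> \<phi> k (x - y)) = occ k a t x w" for t
    by (simp add: smoothed_occupation_def)
  then show ?thesis
    unfolding lp_block_def lp_kernel_def[symmetric] using occ_additive[OF w st, of k x] by simp
qed

lemma lp_block_occupation:
  assumes w: "w \<in> space M"
  shows "lp_block \<psi> \<phi> k (measure_distribution (occupation_measure (\<lambda>\<tau>. \<omega> \<tau> w) a t)) x = occ k a t x w"
proof -
  have "(\<lambda>y. lp_kernel \<psi> \<phi> k (x - y)) \<in> borel_measurable borel"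
    using lp_kernel_measurable[OF dy, of k] by simp
  from measure_distribution_occupation[OF path_continuous[OF w] this] show ?thesis
    unfolding lp_block_def lp_kernel_def[symmetric] by (simp add: smoothed_occupation_def)
qed

end

text \<open>Short intervals contain no coarse cells, so their increments are controlled by a tail of
  the convergent series, which gives continuity. Consecutive partition intervals share no cells, so
  the bounds of all increments add up to at most the whole series.\<close>

lemma C_pvar_from_cell_weights:
  fixes f :: "real \<Rightarrow> 'e::minus" and N :: "'e \<Rightarrow> ennreal" and cw :: "nat \<Rightarrow> nat \<Rightarrow> ennreal"
  assumes ab: "a < b" and P: "1 \<le> P" "p \<noteq> \<infinity> \<longrightarrow> P = enn2real p"
    and mem: "\<And>t. t \<in> {a..b} \<Longrightarrow> f t \<in> E"
    and sym: "\<And>s t. N (f s - f t) = N (f t - f s)"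
    and incr: "\<And>u v. a \<le> u \<Longrightarrow> u \<le> v \<Longrightarrow> v \<le> b \<Longrightarrow>
      ennreal_powr (N (f v - f u)) P \<le> ennreal K * (\<Sum>n. r n * (\<Sum>i\<in>cells a b n u v. cw n i))"
    and fin: "(\<Sum>n. r n * (\<Sum>i<2 ^ n. cw n i)) < \<infinity>"
  shows "f \<in> C_pvar E N p a b"
proof -
  define h where "h n = r n * (\<Sum>i<2 ^ n. cw n i)" for n
  have cell_le: "r n * (\<Sum>i\<in>cells a b n u v. cw n i) \<le> h n" for n u v
    unfolding h_def by (intro mult_left_mono sum_mono2 cells_subset) auto
  have "((\<lambda>s. N (f s - f t)) \<longlongrightarrow> 0) (at t within {a..b})" if t: "t \<in> {a..b}" for t
  proof (rule order_tendstoI)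
    fix y :: ennreal assume y: "0 < y"
    have py: "0 < ennreal_powr y P" using y P by (cases y) (auto simp: ennreal_powr_ennreal)
    \<comment> \<open>The tail bound that forces the increment below \<open>y\<close>; for infinite
      \<open>y\<close> any positive value serves.\<close>
    obtain e where e: "0 < e" "ennreal K * ennreal e \<le> ennreal_powr y P"
    proof (cases "ennreal_powr y P")
      case top
      then show ?thesis using that[of 1] by simp
    next
      case (real c)
      then have "c > 0" using py by simp
      define d where "d = c / (\<bar>K\<bar> + 1)"
      have d: "d > 0" using \<open>c > 0\<close> by (simp add: d_def)
      have "K * d \<le> (\<bar>K\<bar> + 1) * d" using d by (intro mult_right_mono) auto
      also have "\<dots> = c" by (simp add: d_def)
      finally have "ennreal K * ennreal d \<le> ennreal c"
        using d by (simp add: ennreal_mult''[symmetric] ennreal_leI)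
      then show ?thesis using real d that[of d] by simp
    qed
    obtain n0 where n0: "(\<Sum>n. h (n + n0)) < ennreal e"
      using ennreal_tail_small[OF _ e(1), of h] fin unfolding h_def by blast
    \<comment> \<open>The length of a cell of level \<open>n0\<close>: a shorter interval contains
      no cell of level up to \<open>n0\<close>.\<close>
    define \<eta> where "\<eta> = (b - a) / 2 ^ n0"
    have \<eta>: "\<eta> > 0" using ab by (simp add: \<eta>_def)
    have tail: "(\<Sum>n. r n * (\<Sum>i\<in>cells a b n u v. cw n i)) \<le> (\<Sum>n. h (n + n0))" if "v - u < \<eta>" for u v
    proof -
      let ?g = "\<lambda>n. r n * (\<Sum>i\<in>cells a b n u v. cw n i)"
      have z: "?g n = 0" if "n < n0" for n
      proof -
        have "(b - a) / 2 ^ n0 \<le> (b - a) / 2 ^ n" using \<open>n < n0\<close> ab by (intro divide_left_mono) (auto intro: power_increasing)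
        then show ?thesis using cells_empty[of v u b a n] \<open>v - u < \<eta>\<close> by (simp add: \<eta>_def)
      qed
      have "(\<Sum>n. ?g n) = (\<Sum>n. ?g (n + n0)) + (\<Sum>n<n0. ?g n)"
        by (rule suminf_offset) simp
      also have "(\<Sum>n<n0. ?g n) = 0" using z by simp
      finally show ?thesis using cell_le by (auto intro!: suminf_le)
    qed
    have small: "N (f v - f u) < y" if uv: "a \<le> u" "u \<le> v" "v \<le> b" "v - u < \<eta>" and K: "K > 0" for u v
    proof (rule ccontr)
      assume "\<not> N (f v - f u) < y"
      then have "ennreal_powr y P \<le> ennreal_powr (N (f v - f u)) P" using P by (intro ennreal_powr_mono) auto
      also have "\<dots> \<le> ennreal K * (\<Sum>n. r n * (\<Sum>i\<in>cells a b n u v. cw n i))" by (rule incr[OF uv(1-3)])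
      also have "\<dots> \<le> ennreal K * (\<Sum>n. h (n + n0))" by (intro mult_left_mono tail uv) auto
      also have "\<dots> < ennreal K * ennreal e" using n0 K by (intro ennreal_mult_strict_left_mono) auto
      also have "\<dots> \<le> ennreal_powr y P" by (rule e(2))
      finally show False by simp
    qed
    have small': "N (f v - f u) < y" if uv: "a \<le> u" "u \<le> v" "v \<le> b" "v - u < \<eta>" for u v
    proof (cases "K > 0")
      case False
      then have "ennreal_powr (N (f v - f u)) P \<le> 0" using incr[OF uv(1-3)] by (simp add: ennreal_neg)
      then have lt: "ennreal_powr (N (f v - f u)) P < ennreal_powr y P" using py by simp
      show ?thesis
      proof (rule ccontr)
        assume "\<not> N (f v - f u) < y"
        then have "ennreal_powr y P \<le> ennreal_powr (N (f v - f u)) P" using P by (intro ennreal_powr_mono) auto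
        with lt show False by simp
      qed
    qed (rule small[OF uv])
    show "\<forall>\<^sub>F s in at t within {a..b}. N (f s - f t) < y"
      unfolding eventually_at
    proof (intro exI[of _ \<eta>] conjI ballI impI)
      fix s assume s: "s \<in> {a..b}" "s \<noteq> t \<and> dist s t < \<eta>"
      show "N (f s - f t) < y"
      proof (cases "t \<le> s")
        case True
        then show ?thesis using small'[of t s] s t by (auto simp: dist_real_def)
      next
        case False
        then have "N (f t - f s) < y" using small'[of s t] s t by (auto simp: dist_real_def)
        then show ?thesis by (simp add: sym[of s t])
      qed
    qed (rule \<eta>)
  qed simp
  moreover have "p_variation N p a b f < \<infinity>"
  proof -
    let ?B = "ennreal K * (\<Sum>n. h n)"
    have B: "?B < \<infinity>" using fin unfolding h_def by (simp add: ennreal_mult_less_top)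
    have mono: "t h \<in> {a..b}" if "(n, t) \<in> partitions a b" "h \<le> n" for n t h
    proof -
      have t: "strict_mono_on {0..n} t" "t 0 = a" "t n = b" using that by (auto simp: partitions_def)
      have "t 0 \<le> t h" "t h \<le> t n" by (intro strict_mono_on_leD[OF t(1)]; use that(2) in simp)+
      then show ?thesis using t by simp
    qed
    have step: "t (h - 1) \<le> t h" if "(n, t) \<in> partitions a b" "h \<in> {1..n}" for n t h
    proof -
      have "strict_mono_on {0..n} t" using that(1) by (simp add: partitions_def)
      then show ?thesis by (rule strict_mono_on_leD) (use that(2) in auto)
    qed
    show ?thesis
    proof (cases "p = \<infinity>")
      case True
      have "p_variation N p a b f \<le> ennreal_powr ?B (1 / P)"
        unfolding p_variation_def if_P[OF True]
      proof (rule SUP_least, clarify, rule SUP_least)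
        fix n t h assume nt: "(n, t) \<in> partitions a b" and h: "h \<in> {1..n}"
        have "ennreal_powr (N (f (t h) - f (t (h - 1)))) P \<le> ennreal K * (\<Sum>m. r m * (\<Sum>i\<in>cells a b m (t (h - 1)) (t h). cw m i))"
          using mono[OF nt, of h] mono[OF nt, of "h - 1"] step[OF nt h] h by (intro incr) auto
        also have "\<dots> \<le> ?B" by (intro mult_left_mono suminf_le cell_le) auto
        finally show "N (f (t h) - f (t (h - 1))) \<le> ennreal_powr ?B (1 / P)"
          using P le_ennreal_powr_iff[of P] by simp
      qed
      also have "\<dots> < \<infinity>" by (rule ennreal_powr_finite[OF B])
      finally show ?thesis .
    next
      case False
      have "p_variation N p a b f \<le> ?B"
        unfolding p_variation_def if_not_P[OF False]
      proof (rule SUP_least, clarify)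
        fix n t assume nt: "(n, t) \<in> partitions a b"
        have Pp: "enn2real p = P" using P False by simp
        have "(\<Sum>h = 1..n. ennreal_powr (N (f (t h) - f (t (h - 1)))) (enn2real p))
          \<le> (\<Sum>h = 1..n. ennreal K * (\<Sum>m. r m * (\<Sum>i\<in>cells a b m (t (h - 1)) (t h). cw m i)))"
        proof (rule sum_mono)
          fix h assume h: "h \<in> {1..n}"
          show "ennreal_powr (N (f (t h) - f (t (h - 1)))) (enn2real p) \<le> ennreal K * (\<Sum>m. r m * (\<Sum>i\<in>cells a b m (t (h - 1)) (t h). cw m i))"
            unfolding Pp using mono[OF nt, of h] mono[OF nt, of "h - 1"] step[OF nt h] h by (intro incr) auto
        qed
        also have "\<dots> = ennreal K * (\<Sum>h = 1..n. \<Sum>m. r m * (\<Sum>i\<in>cells a b m (t (h - 1)) (t h). cw m i))"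
          by (rule sum_distrib_left[symmetric])
        also have "\<dots> = ennreal K * (\<Sum>m. \<Sum>h = 1..n. r m * (\<Sum>i\<in>cells a b m (t (h - 1)) (t h). cw m i))"
          by (rule arg_cong[OF suminf_sum[symmetric]]) (rule summableI)
        also have "\<dots> = ennreal K * (\<Sum>m. r m * (\<Sum>h = 1..n. \<Sum>i\<in>cells a b m (t (h - 1)) (t h). cw m i))"
          by (simp only: sum_distrib_left)
        also have "\<dots> \<le> ?B"
        proof (intro mult_left_mono suminf_le)
          fix m
          \<comment> \<open>Cells inside intervals with disjoint interiors are different, so the
            double sum counts each cell of level \<open>m\<close> at most once.\<close>
          have "(\<Sum>h = 1..n. \<Sum>i\<in>cells a b m (t (h - 1)) (t h). cw m i) = (\<Sum>i\<in>(\<Union>h\<in>{1..n}. cells a b m (t (h - 1)) (t h)). cw m i)"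
          proof (rule sum.UNION_disjoint[symmetric])
            show "\<forall>h\<in>{1..n}. \<forall>h'\<in>{1..n}. h \<noteq> h' \<longrightarrow> cells a b m (t (h - 1)) (t h) \<inter> cells a b m (t (h' - 1)) (t h') = {}"
            proof (intro ballI impI)
              fix h h' assume hh: "h \<in> {1..n}" "h' \<in> {1..n}" "h \<noteq> h'"
              have smo: "strict_mono_on {0..n} t" using nt by (auto simp: partitions_def)
              show "cells a b m (t (h - 1)) (t h) \<inter> cells a b m (t (h' - 1)) (t h') = {}"
              proof (cases "h < h'")
                case True
                then have "t h \<le> t (h' - 1)" using hh by (intro strict_mono_on_leD[OF smo]) auto
                then show ?thesis by (rule cells_disjoint[OF ab])
              next
                case False
                then have "t h' \<le> t (h - 1)" using hh by (intro strict_mono_on_leD[OF smo]) auto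
                then show ?thesis by (subst Int_commute) (rule cells_disjoint[OF ab])
              qed
            qed
          qed auto
          also have "\<dots> \<le> (\<Sum>i<2 ^ m. cw m i)" by (intro sum_mono2 UN_least cells_subset) auto
          finally show "r m * (\<Sum>h = 1..n. \<Sum>i\<in>cells a b m (t (h - 1)) (t h). cw m i) \<le> h m"
            unfolding h_def by (rule mult_left_mono) simp
        qed auto
        finally show "(\<Sum>h = 1..n. ennreal_powr (N (f (t h) - f (t (h - 1)))) (enn2real p)) \<le> ?B" .
      qed
      then show ?thesis using B by (rule order_le_less_trans)
    qed
  qed
  ultimately show ?thesis using mem by (simp add: C_pvar_def)
qed

context lnd_process begin

lemma besov_norm_zero_blocks:
  fixes T :: "('a \<Rightarrow> complex) \<Rightarrow> complex"
  assumes T: "\<And>k x. lp_block \<psi> \<phi> k T x = 0" and q: "1 \<le> q" and \<alpha>: "0 \<le> \<alpha>"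
  shows "besov_norm \<psi> \<phi> \<alpha> q \<infinity> T = 0"
proof -
  define Q where "Q = (if q = \<infinity> then 1 else enn2real q)"
  have Q: "0 < Q" "q \<noteq> \<infinity> \<longrightarrow> Q = enn2real q"
    using enn2real_one_divide(2)[OF q] by (auto simp: Q_def)
  have T': "lp_block \<psi> \<phi> k T = (\<lambda>x. 0)" for k using T by (rule ext)
  have "ennreal_powr (besov_norm \<psi> \<phi> \<alpha> q \<infinity> T) 1 \<le>
    (\<Sum>k. ennreal ((2 ^ k) powr (\<alpha> * 1)) * ennreal_powr (block_size q Q (lp_block \<psi> \<phi> k T)) (1 / Q))"
    by (rule besov_norm_powr_le[OF _ Q(1) q Q(2) \<alpha>]) (simp_all add: T')
  also have "\<dots> = 0" by (simp add: T' block_size_def)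
  finally show ?thesis by (simp add: ennreal_powr_one)
qed

text \<open>The dyadic argument needs cells of positive length. For \<open>a = b\<close> the only
  partition has no increments, all blocks vanish, and there is no other point to approach.\<close>

lemma occupation_C_pvar_trivial:
  assumes ab: "a = b" and q: "1 \<le> q" and \<alpha>: "0 \<le> \<alpha>" and w: "w \<in> space M"
    and f: "\<And>t. t \<in> {a..b} \<Longrightarrow> f t = measure_distribution (occupation_measure (\<lambda>\<tau>. \<omega> \<tau> w) a t)"
  shows "f \<in> C_pvar (besov_space \<psi> \<phi> \<alpha> q \<infinity>) (besov_norm \<psi> \<phi> \<alpha> q \<infinity>) p a b"
proof -
  have fa: "f a = measure_distribution (occupation_measure (\<lambda>\<tau>. \<omega> \<tau> w) a a)" using f ab by simp
  have "besov_norm \<psi> \<phi> \<alpha> q \<infinity> (f a) = 0"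
    unfolding fa by (rule besov_norm_zero_blocks[OF _ q \<alpha>]) (simp add: lp_block_occupation[OF w])
  then have "f a \<in> besov_space \<psi> \<phi> \<alpha> q \<infinity>"
    unfolding besov_space_def using tempered_occupation_measure[OF path_continuous[OF w], of a a] by (simp add: fa)
  moreover have "p_variation (besov_norm \<psi> \<phi> \<alpha> q \<infinity>) p a b f \<le> 0"
    unfolding p_variation_def
  proof (rule SUP_least, clarify)
    fix n and t :: "nat \<Rightarrow> real" assume "(n, t) \<in> partitions a b"
    then have t: "t 0 = t n" "strict_mono_on {0..n} t" using ab by (auto simp: partitions_def)
    have "n = 0"
    proof (rule ccontr)
      assume "n \<noteq> 0"
      then have "t 0 < t n" by (intro strict_mono_onD[OF t(2)]) auto
      with t(1) show False by simp
    qed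
    then show "(if p = \<infinity> then SUP h\<in>{1..n}. besov_norm \<psi> \<phi> \<alpha> q \<infinity> (f (t h) - f (t (h - 1)))
        else \<Sum>h = 1..n. ennreal_powr (besov_norm \<psi> \<phi> \<alpha> q \<infinity> (f (t h) - f (t (h - 1)))) (enn2real p)) \<le> 0"
      by (simp add: bot_ennreal)
  qed
  ultimately show ?thesis
    using ab by (simp add: C_pvar_def at_within_def)
qed

text \<open>All \<open>f\<close> that agree with the occupation measures on \<open>[a,b]\<close> are
  treated outside the exceptional set. This allows the result for the clamped process to be
  transferred to the original one, where the two functions of \<open>t\<close> need agree only on
  \<open>[a,b]\<close>.\<close>

lemma occupation_C_pvar:
  fixes p q :: ennreal and \<alpha> :: real
  assumes ab: "a < b" and \<alpha>: "0 \<le> \<alpha>" and pq: "1 \<le> p" "p \<le> q"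
    and h1: "enn2real (1 / p) + (\<alpha> - DIM('a) * enn2real (1 / q)) * H < 1 - DIM('a) * H"
    and h2: "\<alpha> < (1 / H - DIM('a)) * min (1 / 2) (1 - enn2real (1 / q))"
  shows "AE w in M. \<forall>f. (\<forall>t\<in>{a..b}. f t = measure_distribution (occupation_measure (\<lambda>\<tau>. \<omega> \<tau> w) a t))
    \<longrightarrow> f \<in> C_pvar (besov_space \<psi> \<phi> \<alpha> q \<infinity>) (besov_norm \<psi> \<phi> \<alpha> q \<infinity>) p a b"
proof -
  obtain Q P \<beta> \<gamma> C Bd where par: "1 \<le> P" "P \<le> Q" "\<alpha> < \<beta>" "1 < \<gamma> * P" "p \<noteq> \<infinity> \<longrightarrow> P = enn2real p"
    "q \<noteq> \<infinity> \<longrightarrow> Q = enn2real q" "0 < C" and Bd: "block_moments q Q \<beta> \<gamma> C Bd"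
    using block_moments_exist[OF \<alpha> pq h1 h2] by blast
  have q1: "1 \<le> q" using pq by (rule order_trans)
  note hyps = par(1,2) q1 par(6) \<alpha> par(3,4,7) Bd ab
  let ?cw = "cell_weight P Q \<alpha> Bd" and ?r = "\<lambda>n::nat. ennreal (rate P \<gamma> powr (n * P))"
    and ?K = "(2 / (1 - 1 / rate P \<gamma>)) powr P"
  have incr: "ennreal_powr (besov_norm \<psi> \<phi> \<alpha> q \<infinity> T) P \<le> ennreal ?K * (\<Sum>n. ?r n * (\<Sum>i\<in>cells a b n u v. ?cw n i w))"
    if "w \<in> space M" "a \<le> u" "u \<le> v" "v \<le> b" "\<And>k x. lp_block \<psi> \<phi> k T x = occ k u v x w" for w u v T
    by (rule besov_norm_increment_le[OF hyps that])
  have "AE w in M. total_weight P Q \<alpha> \<gamma> Bd w < \<infinity>"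
    by (rule total_weight_finite[OF hyps])
  then show ?thesis
    using AE_space
  proof eventually_elim
    case (elim w)
    then have w: "w \<in> space M" and fin: "(\<Sum>n. ?r n * (\<Sum>i<2 ^ n. ?cw n i w)) < \<infinity>"
      by (simp_all add: total_weight_def[OF hyps])
    show ?case
    proof (intro allI impI)
      fix f assume f: "\<forall>t\<in>{a..b}. f t = measure_distribution (occupation_measure (\<lambda>\<tau>. \<omega> \<tau> w) a t)"
      show "f \<in> C_pvar (besov_space \<psi> \<phi> \<alpha> q \<infinity>) (besov_norm \<psi> \<phi> \<alpha> q \<infinity>) p a b"
      proof (rule C_pvar_from_cell_weights[where K = ?K and r = ?r and cw = "\<lambda>n i. ?cw n i w", OF ab par(1,5) _ _ _ fin])
        show "besov_norm \<psi> \<phi> \<alpha> q \<infinity> (f s - f t) = besov_norm \<psi> \<phi> \<alpha> q \<infinity> (f t - f s)" for s t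
          by (rule besov_norm_minus_commute)
      next
        fix t assume t: "t \<in> {a..b}"
        have ft: "f t = measure_distribution (occupation_measure (\<lambda>\<tau>. \<omega> \<tau> w) a t)" using f t by blast
        \<comment> \<open>The blocks of \<open>f t\<close> itself are those of an increment over
          \<open>[a,t]\<close>, so the increment bound also yields membership in the Besov
          space.\<close>
        have "ennreal_powr (besov_norm \<psi> \<phi> \<alpha> q \<infinity> (f t)) P \<le> ennreal ?K * (\<Sum>n. ?r n * (\<Sum>i\<in>cells a b n a t. ?cw n i w))"
          by (rule incr[OF w]) (use t lp_block_occupation[OF w] in \<open>auto simp: ft\<close>)
        also have "\<dots> \<le> ennreal ?K * (\<Sum>n. ?r n * (\<Sum>i<2 ^ n. ?cw n i w))"
          by (intro mult_left_mono suminf_le sum_mono2 cells_subset) auto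
        also have "\<dots> < \<infinity>" using fin by (simp add: ennreal_mult_less_top)
        finally have "besov_norm \<psi> \<phi> \<alpha> q \<infinity> (f t) < \<infinity>"
          by (cases "besov_norm \<psi> \<phi> \<alpha> q \<infinity> (f t)") auto
        then show "f t \<in> besov_space \<psi> \<phi> \<alpha> q \<infinity>"
          using tempered_occupation_measure[OF path_continuous[OF w], of a t] t by (simp add: besov_space_def ft)
      next
        fix u v assume uv: "a \<le> u" "u \<le> v" "v \<le> b"
        then have "f u = measure_distribution (occupation_measure (\<lambda>\<tau>. \<omega> \<tau> w) a u)"
          "f v = measure_distribution (occupation_measure (\<lambda>\<tau>. \<omega> \<tau> w) a v)" using f by auto
        then show "ennreal_powr (besov_norm \<psi> \<phi> \<alpha> q \<infinity> (f v - f u)) P \<le> ennreal ?K * (\<Sum>n. ?r n * (\<Sum>i\<in>cells a b n u v. ?cw n i w))"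
          using lp_block_increment[OF w uv(1,2)] by (intro incr[OF w uv]) simp
      qed
    qed
  qed
qed

end

section \<open>Reduction to a process on the whole line, and the result\<close>

lemma gaussian_process_measurable:
  fixes \<omega> :: "real \<Rightarrow> 'w \<Rightarrow> 'a::euclidean_space"
  assumes "gaussian_process M I \<omega>" "t \<in> I"
  shows "\<omega> t \<in> borel_measurable M"
proof -
  have "(\<lambda>w. \<omega> t w \<bullet> x) \<in> borel_measurable M" for x
  proof -
    have "gaussian_rv M (\<lambda>w. \<Sum>s\<in>{t}. x \<bullet> \<omega> s w)"
      using assms(1)[unfolded gaussian_process_def, rule_format, of "{t}" "\<lambda>_. x"] assms(2) by simp
    then show ?thesis by (simp add: gaussian_rv_def inner_commute)
  qed
  then show ?thesis by (subst borel_measurable_euclidean_space) simp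
qed

text \<open>The hypotheses concern times in \<open>[a,b]\<close> only, whereas
  \<open>lnd_process\<close> asks for measurability and path continuity on the whole line. Freezing
  the path outside \<open>[a,b]\<close> provides both and changes nothing at the times that the
  Gaussian and nondeterminism conditions see.\<close>

lemma lnd_process_clamp:
  fixes \<omega> :: "real \<Rightarrow> 'w \<Rightarrow> 'a::euclidean_space" and a b H :: real
  assumes "prob_space M" and ab: "a \<le> b" and H: "0 < H" "H * DIM('a) < 1"
    and gp: "gaussian_process M {a..b} \<omega>" and cont: "\<forall>w\<in>space M. continuous_on {a..b} (\<lambda>t. \<omega> t w)"
    and lnd: "locally_nondeterministic M a b H \<omega>" and dy: "dyadic_partition \<psi> \<phi>"
  shows "lnd_process M (\<lambda>t. \<omega> (max a (min b t))) a b H \<psi> \<phi>"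
proof -
  interpret prob_space M by fact
  let ?c = "\<lambda>t. max a (min b t)"
  have c: "?c t \<in> {a..b}" for t using ab by auto
  have id: "?c t = t" if "t \<in> {a..b}" for t using that by auto
  show ?thesis
  proof
    show "\<omega> (?c t) \<in> borel_measurable M" for t by (rule gaussian_process_measurable[OF gp c])
    show "continuous_on UNIV (\<lambda>t. \<omega> (?c t) w)" if "w \<in> space M" for w
      by (rule continuous_on_compose2[OF cont[rule_format, OF that]]) (use c in \<open>auto intro!: continuous_intros\<close>)
    show "gaussian_process M {a..b} (\<lambda>t. \<omega> (?c t))"
      unfolding gaussian_process_def
    proof (intro allI impI)
      fix J and x :: "real \<Rightarrow> 'a" assume J: "finite J \<and> J \<subseteq> {a..b}"
      have "(\<lambda>w. \<Sum>t\<in>J. x t \<bullet> \<omega> (?c t) w) = (\<lambda>w. \<Sum>t\<in>J. x t \<bullet> \<omega> t w)"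
      proof
        fix w show "(\<Sum>t\<in>J. x t \<bullet> \<omega> (?c t) w) = (\<Sum>t\<in>J. x t \<bullet> \<omega> t w)"
          by (rule sum.cong[OF refl]) (use J id in auto)
      qed
      then show "gaussian_rv M (\<lambda>w. \<Sum>t\<in>J. x t \<bullet> \<omega> (?c t) w)"
        using gp J unfolding gaussian_process_def by simp
    qed
    show "locally_nondeterministic M a b H (\<lambda>t. \<omega> (?c t))"
      unfolding locally_nondeterministic_def
    proof (intro allI impI)
      fix n :: nat assume n: "2 \<le> n"
      then obtain c \<delta> where cd: "c > 0" "\<delta> > 0" and L: "\<forall>(s::nat \<Rightarrow> real) (x::nat \<Rightarrow> 'a).
        strict_mono_on {1..n} s \<and> a \<le> s 1 \<and> s n \<le> b \<and> \<bar>s n - s 1\<bar> \<le> \<delta> \<longrightarrow>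
          variance (\<lambda>w. \<Sum>k=1..n-1. x k \<bullet> (\<omega> (s (k + 1)) w - \<omega> (s k) w))
            \<ge> 2 * c * (\<Sum>k=1..n-1. (norm (x k))\<^sup>2 * \<bar>s (k + 1) - s k\<bar> powr (2 * H))"
        using lnd unfolding locally_nondeterministic_def by blast
      show "\<exists>c>0. \<exists>\<delta>>0. \<forall>(s::nat \<Rightarrow> real) (x::nat \<Rightarrow> 'a).
        strict_mono_on {1..n} s \<and> a \<le> s 1 \<and> s n \<le> b \<and> \<bar>s n - s 1\<bar> \<le> \<delta> \<longrightarrow>
          variance (\<lambda>w. \<Sum>k=1..n-1. x k \<bullet> (\<omega> (?c (s (k + 1))) w - \<omega> (?c (s k)) w))
            \<ge> 2 * c * (\<Sum>k=1..n-1. (norm (x k))\<^sup>2 * \<bar>s (k + 1) - s k\<bar> powr (2 * H))"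
      proof (rule exI[of _ c], rule conjI[OF cd(1)], rule exI[of _ \<delta>], rule conjI[OF cd(2)], intro allI impI)
        fix s :: "nat \<Rightarrow> real" and x :: "nat \<Rightarrow> 'a"
        assume s: "strict_mono_on {1..n} s \<and> a \<le> s 1 \<and> s n \<le> b \<and> \<bar>s n - s 1\<bar> \<le> \<delta>"
        have sid: "?c (s k) = s k" if "k \<in> {1..n}" for k
        proof (rule id)
          have sm: "strict_mono_on {1..n} s" using s by simp
          have "s 1 \<le> s k" "s k \<le> s n" by (rule strict_mono_on_leD[OF sm]; use that in simp)+
          then show "s k \<in> {a..b}" using s by auto
        qed
        have E: "(\<lambda>w. \<Sum>k=1..n-1. x k \<bullet> (\<omega> (?c (s (k + 1))) w - \<omega> (?c (s k)) w))
          = (\<lambda>w. \<Sum>k=1..n-1. x k \<bullet> (\<omega> (s (k + 1)) w - \<omega> (s k) w))"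
          by (intro ext sum.cong[OF refl]) (use sid in auto)
        show "variance (\<lambda>w. \<Sum>k=1..n-1. x k \<bullet> (\<omega> (?c (s (k + 1))) w - \<omega> (?c (s k)) w))
            \<ge> 2 * c * (\<Sum>k=1..n-1. (norm (x k))\<^sup>2 * \<bar>s (k + 1) - s k\<bar> powr (2 * H))"
          by (rule order_trans[OF L[rule_format, OF s, of x] eq_refl[OF arg_cong[OF E, of "\<lambda>X. variance X", symmetric]]])
      qed
    qed
  qed (use H dy in auto)
qed

lemma occupation_measure_cong:
  "(\<And>\<tau>. \<tau> \<in> {s..t} \<Longrightarrow> X \<tau> = Y \<tau>) \<Longrightarrow> occupation_measure X s t = occupation_measure Y s t"
  unfolding occupation_measure_def by (intro distr_cong refl) (simp add: space_restrict_space)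

theorem corollary5p3:
  fixes M :: "'w measure"
    and \<omega> :: "real \<Rightarrow> 'w \<Rightarrow> real ^ 'd"
    and a b H \<alpha> :: real
    and p q :: ennreal
    and \<psi> \<phi> :: "real ^ 'd \<Rightarrow> real"
  assumes "prob_space M"
    and "a \<le> b"
    and "0 < H" and "H < 1 / real CARD('d)"
    and "gaussian_process M {a..b} \<omega>"
    and "\<forall>w\<in>space M. continuous_on {a..b} (\<lambda>t. \<omega> t w)"
    and "locally_nondeterministic M a b H \<omega>"
    and "0 \<le> \<alpha>" and "1 \<le> p" and "p \<le> q"
    and "enn2real (1 / p) + (\<alpha> - real CARD('d) * enn2real (1 / q)) * H < 1 - real CARD('d) * H"
    and "\<alpha> < (1 / H - real CARD('d)) * min (1 / 2) (1 - enn2real (1 / q))"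
    and "dyadic_partition \<psi> \<phi>"
  shows "AE w in M.
    (\<lambda>t. measure_distribution (occupation_measure (\<lambda>\<tau>. \<omega> \<tau> w) a t))
      \<in> C_pvar (besov_space \<psi> \<phi> \<alpha> q \<infinity>) (besov_norm \<psi> \<phi> \<alpha> q \<infinity>) p a b"
proof -
  have dim: "DIM(real ^ 'd) = CARD('d)" by simp
  have Hd: "H * real DIM(real ^ 'd) < 1"
    using assms(4) by (simp add: pos_less_divide_eq)
  interpret lnd_process M "\<lambda>t. \<omega> (max a (min b t))" a b H \<psi> \<phi>
    by (rule lnd_process_clamp[OF assms(1,2,3) Hd assms(5,6,7,13)])
  have occ_eq: "occupation_measure (\<lambda>\<tau>. \<omega> \<tau> w) a t = occupation_measure (\<lambda>\<tau>. \<omega> (max a (min b \<tau>)) w) a t" if "t \<in> {a..b}" for t w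
    using that by (intro occupation_measure_cong) (auto simp: min_absorb2 max_absorb2)
  show ?thesis
  proof (cases "a = b")
    case True
    have "1 \<le> q" using assms(9,10) by (rule order_trans)
    then show ?thesis
      by (intro AE_I2 occupation_C_pvar_trivial[OF True _ assms(8)]) (simp_all only: occ_eq)
  next
    case False
    then have ab: "a < b" using assms(2) by simp
    have "AE w in M. \<forall>f. (\<forall>t\<in>{a..b}. f t = measure_distribution (occupation_measure (\<lambda>\<tau>. \<omega> (max a (min b \<tau>)) w) a t))
      \<longrightarrow> f \<in> C_pvar (besov_space \<psi> \<phi> \<alpha> q \<infinity>) (besov_norm \<psi> \<phi> \<alpha> q \<infinity>) p a b"
      by (rule occupation_C_pvar[OF ab assms(8-10)]) (use assms(11,12) in \<open>simp_all only: dim\<close>)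
    then show ?thesis by eventually_elim (simp add: occ_eq)
  qed
qed

end
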